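(* Let $g\in H^\infty(\mathbb{B}^d)$ be such that $\|g\|_\infty\le1$ and $1/g\in H^\infty(\mathbb{B}^d)$, and let $w=|g|^2$ (on $\mathbb{B}^d$, and $\sigma$-a.e. on $\partial\mathbb{B}^d$ through boundary values). Let $\mu_{\mathrm{s}}$ be a discrete measure on $\partial\mathbb{B}^d$ such that $d\mu(\zeta):=w(\zeta)\,d\sigma(\zeta)+d\mu_{\mathrm{s}}(\zeta)$ is a probability measure, and let $(\gamma_{\alpha,\beta})_{\alpha,\beta\in\mathbb{N}_0^d}$ be the Verblunsky coefficients of $\mu$. Then $$\prod_{\alpha\in\mathbb{N}_0^d}(1-|\gamma_{0,\alpha}|^2)=\exp\left(\int_{\partial\mathbb{B}^d}\log(w(\zeta))\,d\sigma(\zeta)\right).$$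
   Context: $\mathbb{B}^d$ is the open unit ball of $\mathbb{C}^d$, $\partial\mathbb{B}^d$ the unit sphere, $\sigma$ the rotation-invariant Lebesgue probability measure on $\partial\mathbb{B}^d$. $H^\infty(\mathbb{B}^d)$ is the space of bounded holomorphic functions on $\mathbb{B}^d$ with sup norm $\|\cdot\|_\infty$; for $\sigma$-a.e. $\zeta$, $g(\zeta)$ denotes the $K$-limit of $g$ at $\zeta$ (limit as $z\to\zeta$ within each Kor\'anyi region $\{z\in\mathbb{B}^d:|1-\langle z,\zeta\rangle|<\frac c2(1-\|z\|^2)\}$, $c>1$), which exists $\sigma$-a.e. and coincides with the radial limit. A measure is discrete if it is a countable sum $\sum_k\rho_k\delta_{\zeta_k}$, $\rho_k>0$, of point masses (possibly zero). Shortlex order $\prec$ on $\mathbb{N}_0^d$: $\alpha\prec\beta$ if $|\alpha|<|\beta|$ (where $|\alpha|=\sum\alpha_i$), or if $|\alpha|=|\beta|$ and $\alpha_i>\beta_i$ at the first index where they differ. Infinite products over $\mathbb{N}_0^d$ are limits of partial products in this order. Verblunsky coefficients of $\mu$: let $K(\alpha,\beta)=\int_{\partial\mathbb{B}^d}\zeta^\alpha\overline{\zeta}^\beta d\mu$ (its finite sections are positive definite here). For $\alpha\prec\beta$ let $S=\{\delta:\alpha\prec\delta\prec\beta\}$, $M=[K(\delta,\delta')]_{\delta,\delta'\in S}$, $u=[K(\alpha,\delta)]_{\delta\in S}$ (row), $v=[K(\delta,\beta)]_{\delta\in S}$ (column), and $$\gamma_{\alpha,\beta}=\frac{K(\alpha,\beta)-uM^{-1}v}{\sqrt{K(\alpha,\alpha)-uM^{-1}u^*}\,\sqrt{K(\beta,\beta)-v^*M^{-1}v}},$$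 where terms involving $M$ are omitted if $S=\emptyset$; $\gamma_{\alpha,\alpha}=0$, $\gamma_{\beta,\alpha}=\overline{\gamma_{\alpha,\beta}}$. *)

theory Defs
  imports
    "HOL-Analysis.Analysis"
    "HOL-Probability.Probability"
    "Jordan_Normal_Form.Gauss_Jordan_Elimination"
    "Jordan_Normal_Form.Conjugate"
begin

unbundle no vec_syntax

text \<open>
  The space $\mathbb{C}^d$ is \<^typ>\<open>complex ^ 'n\<close> with \<^term>\<open>CARD('n) = d\<close>, and multi-indices are
  elements of \<^typ>\<open>nat ^ 'n\<close>.  The index type is linearly ordered because the shortlex order
  refers to the first coordinate in which two multi-indices differ.  Coordinates are written with
  \<^const>\<open>vec_nth\<close>, since the infix dollar sign is used for the vectors of \<open>Jordan_Normal_Form\<close>.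
\<close>

type_synonym 'n cspace = "complex ^ 'n"
type_synonym 'n multi_index = "nat ^ 'n"

section \<open>Bounded holomorphic functions and their boundary values\<close>

definition herm :: "'n::finite cspace \<Rightarrow> 'n cspace \<Rightarrow> complex" where
  "herm z w = (\<Sum>i\<in>UNIV. vec_nth z i * cnj (vec_nth w i))"

text \<open>Complex Fr\'echet differentiability at every point; the library's \<^const>\<open>holomorphic_on\<close>
  covers one variable only.\<close>

definition holomorphic_several :: "('n::finite cspace \<Rightarrow> complex) \<Rightarrow> 'n cspace set \<Rightarrow> bool" where
  "holomorphic_several f S \<longleftrightarrow>
     (\<forall>z\<in>S. \<exists>f'. (f has_derivative f') (at z within S) \<and> (\<forall>c v. f' (c *s v) = c * f' v))"

definition H_inf :: "('n::finite cspace \<Rightarrow> complex) set" where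
  "H_inf = {g. holomorphic_several g (ball 0 1) \<and> bounded (g ` ball 0 1)}"

definition H_inf_norm :: "('n::finite cspace \<Rightarrow> complex) \<Rightarrow> real" where
  "H_inf_norm g = (SUP z\<in>ball 0 1. cmod (g z))"

definition koranyi_region :: "real \<Rightarrow> 'n::finite cspace \<Rightarrow> 'n cspace set" where
  "koranyi_region c \<zeta> = {z \<in> ball 0 1. cmod (1 - herm z \<zeta>) < c / 2 * (1 - (norm z)\<^sup>2)}"

definition has_K_limit :: "('n::finite cspace \<Rightarrow> complex) \<Rightarrow> 'n cspace \<Rightarrow> complex \<Rightarrow> bool" where
  "has_K_limit g \<zeta> l \<longleftrightarrow> (\<forall>c>1. (g \<longlongrightarrow> l) (at \<zeta> within koranyi_region c \<zeta>))"

text \<open>The value is unspecified at those points of the sphere where no K-limit exists.\<close>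

definition boundary_value :: "('n::finite cspace \<Rightarrow> complex) \<Rightarrow> 'n cspace \<Rightarrow> complex" where
  "boundary_value g \<zeta> = (THE l. has_K_limit g \<zeta> l)"

lemma has_K_limit_imp_boundary_value:
  assumes "norm \<zeta> = 1" "has_K_limit g \<zeta> l"
  shows "boundary_value g \<zeta> = l"
proof -
  have herm: "herm (r *\<^sub>R \<zeta>) \<zeta> = of_real r" for r :: real
  proof -
    have "(\<Sum>i\<in>UNIV. (cmod (vec_nth \<zeta> i))\<^sup>2) = 1"
      using assms(1) by (simp add: norm_vec_def L2_set_def)
    then have "herm \<zeta> \<zeta> = 1"
      unfolding herm_def complex_norm_square [symmetric] of_real_sum [symmetric] by simp
    then show ?thesis
      by (simp add: herm_def scaleR_sum_right [symmetric] scaleR_conv_of_real [of _ "1::complex"])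
  qed
  have mem: "r *\<^sub>R \<zeta> \<in> koranyi_region 2 \<zeta>" if "0 < r" "r < 1" for r
  proof -
    have "cmod (1 - of_real r) = 1 - r"
      using that by (metis of_real_1 of_real_diff norm_of_real abs_of_pos diff_gt_0_iff_gt)
    moreover have "r\<^sup>2 < r" using that by (simp add: power2_eq_square)
    ultimately show ?thesis
      using that assms(1) by (simp add: koranyi_region_def herm)
  qed
  have "((\<lambda>r. r *\<^sub>R \<zeta>) \<longlongrightarrow> 1 *\<^sub>R \<zeta>) (at_left 1)"
    by (intro tendsto_intros)
  moreover have "\<forall>\<^sub>F r::real in at_left 1. r *\<^sub>R \<zeta> \<in> koranyi_region 2 \<zeta> - {\<zeta>}"
  proof -
    have "\<forall>\<^sub>F r::real in at_left 1. r \<in> {0<..<1}"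
      by (rule eventually_at_left_real) simp
    then show ?thesis
    proof eventually_elim
      fix r :: real assume elim: "r \<in> {0<..<1}"
      then have "norm (r *\<^sub>R \<zeta>) \<noteq> norm \<zeta>" using assms(1) by simp
      then show "r *\<^sub>R \<zeta> \<in> koranyi_region 2 \<zeta> - {\<zeta>}" 
        using elim mem by (metis Diff_iff greaterThanLessThan_iff singletonD)
    qed
  qed
  ultimately have "filterlim (\<lambda>r. r *\<^sub>R \<zeta>) (at \<zeta> within koranyi_region 2 \<zeta>) (at_left 1)"
    by (simp add: filterlim_at eventually_conj_iff)
  then have nt: "at \<zeta> within koranyi_region 2 \<zeta> \<noteq> bot"
    by (auto simp: filterlim_def filtermap_bot_iff bot_unique)
  show ?thesis
    unfolding boundary_value_def
  proof (rule the_equality)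
    show "l' = l" if "has_K_limit g \<zeta> l'" for l'
      using tendsto_unique [OF nt] that assms(2) unfolding has_K_limit_def
      by (metis one_less_numeral_iff semiring_norm(76))
  qed (fact assms(2))
qed

section \<open>Measures on the unit sphere\<close>

text \<open>
  The rotation-invariant probability measure on the unit sphere, obtained by projecting normalised
  Lebesgue measure on the unit ball radially onto the sphere.  Its total mass and its invariance
  are proved below.
\<close>

definition sphere_measure :: "'a::euclidean_space measure" where
  "sphere_measure =
     restrict_space (distr (uniform_measure lborel (ball 0 1)) borel (\<lambda>z. z /\<^sub>R norm z)) (sphere 0 1)"

lemma basis_isometry:
  assumes "DIM('a::euclidean_space) = DIM('b::euclidean_space)"
  obtains f :: "'a::euclidean_space \<Rightarrow> 'b::euclidean_space" and g :: "'b::euclidean_space \<Rightarrow> 'a::euclidean_space"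
  where "linear f" "linear g" "\<And>x. g (f x) = x" "\<And>y. f (g y) = y" "\<And>x. norm (f x) = norm x"
    "distr lborel borel f = lborel" "distr lborel borel g = lborel"
proof -
  obtain \<phi> :: "'a \<Rightarrow> 'b" where \<phi>: "bij_betw \<phi> Basis Basis"
    using assms by (metis finite_Basis finite_same_card_bij)
  define f where "f x = (\<Sum>b\<in>Basis. inner x b *\<^sub>R \<phi> b)" for x
  define g where "g y = (\<Sum>b\<in>Basis. inner y (\<phi> b) *\<^sub>R b)" for y
  have \<phi>_in: "\<phi> b \<in> Basis" if "b \<in> Basis" for b
    using \<phi> that by (auto simp: bij_betw_def)
  have \<phi>_eq: "\<phi> b = \<phi> c \<longleftrightarrow> b = c" if "b \<in> Basis" "c \<in> Basis" for b c
    using \<phi> that by (auto simp: bij_betw_def inj_on_def)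
  have f_inner: "inner (f x) (\<phi> b) = inner x b" if b: "b \<in> Basis" for x b
  proof -
    have "inner (f x) (\<phi> b) = (\<Sum>c\<in>Basis. inner x c * (if c = b then 1 else 0))"
      unfolding f_def inner_sum_left inner_scaleR_left
      using b by (intro sum.cong refl) (simp add: inner_Basis \<phi>_in \<phi>_eq)
    then show ?thesis using b by (simp add: if_distrib cong: if_cong)
  qed
  have g_inner: "inner (g y) b = inner y (\<phi> b)" if b: "b \<in> Basis" for y b
    unfolding g_def using b by (simp add: inner_sum_left inner_Basis if_distrib cong: if_cong)
  have lin: "linear f" "linear g"
    unfolding f_def [abs_def] g_def [abs_def]
    by (auto intro!: linearI simp: inner_add_left scaleR_add_left sum.distrib scaleR_sum_right)
  have gf: "g (f x) = x" for x
    by (rule euclidean_eqI) (simp add: g_inner f_inner)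
  have fg: "f (g y) = y" for y
  proof (rule euclidean_eqI)
    fix c :: 'b assume "c \<in> Basis"
    then obtain b where b: "b \<in> Basis" "c = \<phi> b" using \<phi> by (auto simp: bij_betw_def)
    then show "inner (f (g y)) c = inner y c" by (simp add: f_inner g_inner)
  qed
  have nf: "norm (f x) = norm x" for x
  proof -
    have "inner (f x) (f x) = (\<Sum>b\<in>Basis. inner x b * inner x b)"
      using f_inner by (subst (2) f_def) (simp add: inner_sum_right)
    then show ?thesis
      by (simp add: norm_eq_sqrt_inner euclidean_inner [of x x])
  qed
  have meas: "f \<in> borel_measurable borel" "g \<in> borel_measurable borel"
    using lin by (auto intro!: borel_measurable_continuous_onI linear_continuous_on simp: linear_conv_bounded_linear)
  have df: "distr lborel borel f = lborel"
  proof (rule lborel_eqI [symmetric])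
    fix l u :: 'b assume le: "\<And>b. b \<in> Basis \<Longrightarrow> inner l b \<le> inner u b"
    have "f -` box l u = box (g l) (g u)"
    proof (intro Set.set_eqI iffI)
      fix x assume "x \<in> f -` box l u"
      then have "\<forall>b\<in>Basis. inner l (\<phi> b) < inner (f x) (\<phi> b) \<and> inner (f x) (\<phi> b) < inner u (\<phi> b)"
        using \<phi>_in by (auto simp: mem_box)
      then show "x \<in> box (g l) (g u)" by (simp add: mem_box g_inner f_inner)
    next
      fix x assume x: "x \<in> box (g l) (g u)"
      have "inner l c < inner (f x) c \<and> inner (f x) c < inner u c" if "c \<in> Basis" for c
      proof -
        from that obtain b where b: "b \<in> Basis" "c = \<phi> b" using \<phi> by (auto simp: bij_betw_def)
        then show ?thesis using x by (auto simp: mem_box g_inner f_inner)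
      qed
      then show "x \<in> f -` box l u" by (simp add: mem_box)
    qed
    moreover have "emeasure lborel (box (g l) (g u)) = (\<Prod>b\<in>Basis. inner (g u - g l) b)"
      by (rule emeasure_lborel_box) (simp add: g_inner le \<phi>_in)
    moreover have "(\<Prod>b\<in>Basis. inner (g u - g l) b) = (\<Prod>c\<in>Basis. inner (u - l) c)"
      using prod.reindex_bij_betw [OF \<phi>, of "\<lambda>c. inner (u - l) c"]
      by (simp add: inner_diff_left g_inner)
    ultimately show "emeasure (distr lborel borel f) (box l u) = (\<Prod>c\<in>Basis. inner (u - l) c)"
      using meas by (subst emeasure_distr) auto
  qed simp
  have "distr lborel borel g = distr (distr lborel borel f) borel g"
    by (simp add: df)
  also have "\<dots> = distr lborel borel (\<lambda>x. x)"
    using meas by (subst distr_distr) (auto simp: o_def gf)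
  also have "\<dots> = lborel"
    by (simp add: distr_id2)
  finally show thesis
    using that lin gf fg nf df by blast
qed

lemma distr_lborel_orthogonal_cart:
  fixes T :: "real ^ 'm::{finite,wellorder} \<Rightarrow> real ^ 'm::{finite,wellorder}"
  assumes T: "orthogonal_transformation T"
  shows "distr lborel borel T = lborel"
proof (rule lborel_eqI [symmetric])
  fix l u :: "real ^ 'm::{finite,wellorder}" assume le: "\<And>b. b \<in> Basis \<Longrightarrow> inner l b \<le> inner u b"
  obtain T' where T': "orthogonal_transformation T'" "\<And>x. T' (T x) = x" "\<And>x. T (T' x) = x"
    using T by (metis orthogonal_transformation_inv orthogonal_transformation_bij
        bij_is_inj bij_is_surj inv_f_f surj_f_inv_f)
  have vim: "T -` S = T' ` S" for S
    using T'(2,3) by (auto simp: image_iff) metis+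
  have meas: "T \<in> borel_measurable borel"
    using orthogonal_transformation_linear [OF T]
    by (auto intro!: borel_measurable_continuous_onI linear_continuous_on simp: linear_conv_bounded_linear)
  have "T -` box l u \<in> lmeasurable" "measure lebesgue (T -` box l u) = measure lebesgue (box l u)"
    unfolding vim using T'(1) by (simp_all add: measurable_orthogonal_image measure_orthogonal_image)
  then have "emeasure lebesgue (T -` box l u) = emeasure lebesgue (box l u)"
    by (simp add: emeasure_eq_measure2 lmeasurable_box)
  moreover have "T -` box l u \<in> sets lborel"
    using measurable_sets_borel [OF meas, of "box l u"] by simp
  ultimately have "emeasure lborel (T -` box l u) = emeasure lborel (box l u)"
    by simp
  then show "emeasure (distr lborel borel T) (box l u) = (\<Prod>c\<in>Basis. inner (u - l) c)"
    using meas le by (simp add: emeasure_distr emeasure_lborel_box)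
qed simp

lemma distr_lborel_orthogonal:
  fixes U :: "'n::finite cspace \<Rightarrow> 'n cspace"
  assumes U: "orthogonal_transformation U"
  shows "distr lborel borel U = lborel"
proof -
  have "DIM('n cspace) = DIM(real ^ 'n bit0)" by simp
  then obtain f :: "'n cspace \<Rightarrow> real ^ 'n bit0" and g
    where fg: "linear f" "linear g" "\<And>x. g (f x) = x" "\<And>y. f (g y) = y" "\<And>x. norm (f x) = norm x"
      "distr lborel borel f = lborel" "distr lborel borel g = lborel"
    by (rule basis_isometry) (rule that)
  have ng: "norm (g y) = norm y" for y by (metis fg(4,5))
  let ?T = "f \<circ> U \<circ> g"
  have T: "orthogonal_transformation ?T"
    using U fg ng by (auto simp: orthogonal_transformation intro!: linear_compose)
  have meas: "f \<in> borel_measurable borel" "g \<in> borel_measurable borel" "U \<in> borel_measurable borel"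
    using fg(1,2) orthogonal_transformation_linear [OF U]
    by (auto intro!: borel_measurable_continuous_onI linear_continuous_on simp: linear_conv_bounded_linear)
  have U_eq: "U = g \<circ> (?T \<circ> f)" using fg by (simp add: fun_eq_iff)
  have "distr lborel borel U = distr (distr (distr lborel borel f) borel ?T) borel g"
    using meas by (subst U_eq) (simp add: distr_distr comp_assoc)
  also have "\<dots> = lborel"
    by (simp add: fg distr_lborel_orthogonal_cart [OF T])
  finally show ?thesis .
qed

lemma measurable_radial_projection [measurable]:
  "(\<lambda>z::'a::euclidean_space. z /\<^sub>R norm z) \<in> borel_measurable borel"
  by measurable

lemma sets_sphere_measure [simp]:
  "sets (sphere_measure :: 'a::euclidean_space measure) = sets (restrict_space borel (sphere 0 1))"
  unfolding sphere_measure_def by (rule sets_restrict_space_cong) simp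

lemma space_sphere_measure [simp]: "space (sphere_measure :: 'a::euclidean_space measure) = sphere 0 1"
  by (simp add: sphere_measure_def space_restrict_space)

lemma emeasure_sphere_measure:
  fixes A :: "'a::euclidean_space set"
  assumes "A \<in> sets sphere_measure"
  shows "emeasure sphere_measure A =
    emeasure lborel {z \<in> ball 0 1. z /\<^sub>R norm z \<in> A} / emeasure lborel (ball (0 :: 'a) 1)"
proof -
  have A: "A \<in> sets borel" "A \<subseteq> sphere 0 1"
    using assms by (auto simp: sets_restrict_space_iff)
  have "emeasure sphere_measure A
      = emeasure (distr (uniform_measure lborel (ball 0 1)) borel (\<lambda>z. z /\<^sub>R norm z)) A"
    unfolding sphere_measure_def using A by (intro emeasure_restrict_space) auto
  also have "\<dots> = emeasure (uniform_measure lborel (ball 0 1)) ((\<lambda>z. z /\<^sub>R norm z) -` A)"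
    using A by (subst emeasure_distr) auto
  also have "\<dots> = emeasure lborel (ball 0 1 \<inter> (\<lambda>z. z /\<^sub>R norm z) -` A) / emeasure lborel (ball (0 :: 'a) 1)"
    using A measurable_sets_borel [OF measurable_radial_projection, of A]
    by (intro emeasure_uniform_measure) auto
  also have "ball 0 1 \<inter> (\<lambda>z. z /\<^sub>R norm z) -` A = {z \<in> ball 0 1. z /\<^sub>R norm z \<in> A}"
    by auto
  finally show ?thesis .
qed

lemma prob_space_sphere_measure: "prob_space (sphere_measure :: 'a::euclidean_space measure)"
proof
  let ?B = "ball (0 :: 'a) 1"
  have *: "{z \<in> ?B. z /\<^sub>R norm z \<in> sphere 0 1} = ?B - {0}"
    by (auto simp: dist_norm)
  have "emeasure lborel (?B - {0}) = emeasure lborel ?B"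
    by (intro emeasure_Diff_null_set) auto
  moreover have "0 < emeasure lborel ?B" "emeasure lborel ?B < \<infinity>"
    by (simp_all add: emeasure_lborel_ball_finite emeasure_ball unit_ball_vol_pos ennreal_zero_less_top)
  ultimately show "emeasure (sphere_measure :: 'a measure) (space sphere_measure) = 1"
    unfolding space_sphere_measure
    by (subst emeasure_sphere_measure, simp add: sets_restrict_space_iff)
       (simp only: *, simp add: ennreal_divide_self)
qed

lemma sphere_measure_rotation_invariant:
  fixes U :: "'n::finite cspace \<Rightarrow> 'n cspace"
  assumes U: "orthogonal_transformation U"
  shows "distr sphere_measure sphere_measure U = sphere_measure"
proof (rule measure_eqI)
  fix A assume "A \<in> sets (distr sphere_measure sphere_measure U)"
  then have A: "A \<in> sets sphere_measure" by simp
  then have A': "A \<in> sets borel" "A \<subseteq> sphere 0 1" by (auto simp: sets_restrict_space_iff)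
  have lin: "linear U" and nU: "\<And>x. norm (U x) = norm x"
    using U by (auto simp: orthogonal_transformation)
  have mU: "U \<in> borel_measurable borel"
    using lin by (auto intro!: borel_measurable_continuous_onI linear_continuous_on simp: linear_conv_bounded_linear)
  have "U \<in> measurable sphere_measure sphere_measure"
    unfolding measurable_cong_sets [OF sets_sphere_measure sets_sphere_measure]
    by (rule measurable_restrict_space3) (use mU nU in auto)
  then have "emeasure (distr sphere_measure sphere_measure U) A
      = emeasure sphere_measure (U -` A \<inter> sphere 0 1)"
    using A by (simp add: emeasure_distr)
  also have "\<dots> = emeasure lborel {z \<in> ball 0 1. z /\<^sub>R norm z \<in> U -` A \<inter> sphere 0 1}
      / emeasure lborel (ball (0 :: 'n cspace) 1)"
    using A' measurable_sets_borel [OF mU, of A]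
    by (intro emeasure_sphere_measure) (auto simp: sets_restrict_space_iff)
  also have "{z \<in> ball 0 1. z /\<^sub>R norm z \<in> U -` A \<inter> sphere 0 1}
      = U -` {z \<in> ball 0 1. z /\<^sub>R norm z \<in> A}"
    using A'(2) nU by (auto simp: dist_norm linear_scale [OF lin])
  also have "emeasure lborel \<dots> = emeasure lborel {z \<in> ball 0 1. z /\<^sub>R norm z \<in> A}"
  proof -
    have "{z \<in> ball 0 1. z /\<^sub>R norm z \<in> A} \<in> sets borel"
      using A' by measurable
    then show ?thesis
      using mU by (subst (2) distr_lborel_orthogonal [OF U, symmetric]) (simp add: emeasure_distr)
  qed
  finally show "emeasure (distr sphere_measure sphere_measure U) A = emeasure sphere_measure A"
    using A by (simp only: emeasure_sphere_measure)
qed simp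

text \<open>The index set \<open>I\<close> may be empty, finite or infinite.\<close>

definition discrete_sphere_measure :: "'a::euclidean_space measure \<Rightarrow> bool" where
  "discrete_sphere_measure \<nu> \<longleftrightarrow>
     sets \<nu> = sets (restrict_space borel (sphere 0 1)) \<and>
     (\<exists>(I :: nat set) (\<rho> :: nat \<Rightarrow> real) \<zeta>.
        (\<forall>k\<in>I. \<rho> k > 0 \<and> \<zeta> k \<in> sphere 0 1) \<and>
        (\<forall>A\<in>sets \<nu>. emeasure \<nu> A = (\<Sum>k. if k \<in> I then ennreal (\<rho> k) * indicator A (\<zeta> k) else 0)))"

section \<open>Shortlex order\<close>

definition mi_abs :: "'n::finite multi_index \<Rightarrow> nat" where
  "mi_abs \<alpha> = (\<Sum>i\<in>UNIV. vec_nth \<alpha> i)"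

definition shortlex :: "'n::{finite,linorder} multi_index \<Rightarrow> 'n multi_index \<Rightarrow> bool" (infix \<open>\<prec>\<^sub>s\<close> 50) where
  "\<alpha> \<prec>\<^sub>s \<beta> \<longleftrightarrow> mi_abs \<alpha> < mi_abs \<beta> \<or>
     (mi_abs \<alpha> = mi_abs \<beta> \<and>
      (\<exists>i. (\<forall>j<i. vec_nth \<alpha> j = vec_nth \<beta> j) \<and> vec_nth \<alpha> i > vec_nth \<beta> i))"

text \<open>The \<open>n\<close>-th multi-index in shortlex order, counting from 0.\<close>

definition shortlex_enum :: "nat \<Rightarrow> 'n::{finite,linorder} multi_index" where
  "shortlex_enum n = (THE \<alpha>. card {\<delta>. \<delta> \<prec>\<^sub>s \<alpha>} = n)"

definition has_shortlex_prod :: "('n::{finite,linorder} multi_index \<Rightarrow> real) \<Rightarrow> real \<Rightarrow> bool" where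
  "has_shortlex_prod f L \<longleftrightarrow> (\<lambda>N. \<Prod>k<N. f (shortlex_enum k)) \<longlonglongrightarrow> L"

definition shortlex_between :: "'n::{finite,linorder} multi_index \<Rightarrow> 'n multi_index \<Rightarrow> 'n multi_index list" where
  "shortlex_between \<alpha> \<beta> = (THE xs. sorted_wrt (\<prec>\<^sub>s) xs \<and> set xs = {\<delta>. \<alpha> \<prec>\<^sub>s \<delta> \<and> \<delta> \<prec>\<^sub>s \<beta>})"

lemma shortlex_irrefl: "\<not> \<alpha> \<prec>\<^sub>s \<alpha>"
  by (simp add: shortlex_def)

lemma shortlex_trans: "\<alpha> \<prec>\<^sub>s \<beta> \<Longrightarrow> \<beta> \<prec>\<^sub>s \<gamma> \<Longrightarrow> \<alpha> \<prec>\<^sub>s \<gamma>"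
  unfolding shortlex_def
  by (smt (verit, ccfv_SIG) dual_order.strict_trans linorder_neqE)

lemma shortlex_total: "\<alpha> \<prec>\<^sub>s \<beta> \<or> \<alpha> = \<beta> \<or> \<beta> \<prec>\<^sub>s \<alpha>"
proof (cases "\<alpha> = \<beta>")
  case False
  let ?D = "{i. vec_nth \<alpha> i \<noteq> vec_nth \<beta> i}"
  have "?D \<noteq> {}" using False by (auto simp: Finite_Cartesian_Product.vec_eq_iff)
  then have "Min ?D \<in> ?D" by (intro Min_in) auto
  moreover have "vec_nth \<alpha> j = vec_nth \<beta> j" if "j < Min ?D" for j
    using that Min_le [of ?D j] by (auto simp: not_le [symmetric])
  ultimately have "\<exists>i. (\<forall>j<i. vec_nth \<alpha> j = vec_nth \<beta> j) \<and> vec_nth \<alpha> i \<noteq> vec_nth \<beta> i"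
    by blast
  then show ?thesis
    unfolding shortlex_def by (metis linorder_neqE_nat)
qed simp

lemma finite_shortlex_below: "finite {\<delta>. \<delta> \<prec>\<^sub>s \<alpha>}"
proof -
  have "vec_nth ` {\<delta>. \<delta> \<prec>\<^sub>s \<alpha>} \<subseteq> UNIV \<rightarrow>\<^sub>E {..mi_abs \<alpha>}"
  proof (rule image_subsetI, unfold PiE_UNIV_domain Pi_iff, intro ballI, unfold atMost_iff)
    fix \<delta> i assume "\<delta> \<in> {\<delta>. \<delta> \<prec>\<^sub>s \<alpha>}"
    then have "mi_abs \<delta> \<le> mi_abs \<alpha>" by (auto simp: shortlex_def)
    moreover have "vec_nth \<delta> i \<le> mi_abs \<delta>"
      unfolding mi_abs_def by (rule member_le_sum) auto
    ultimately show "vec_nth \<delta> i \<le> mi_abs \<alpha>" by simp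
  qed
  then have "finite (vec_nth ` {\<delta>. \<delta> \<prec>\<^sub>s \<alpha>})"
    by (rule finite_subset) (simp add: finite_PiE)
  then show ?thesis
    by (rule finite_imageD) (simp add: inj_on_def vec_nth_inject)
qed

lemma shortlex_rank_strict_mono:
  assumes "\<alpha> \<prec>\<^sub>s \<beta>" shows "card {\<delta>. \<delta> \<prec>\<^sub>s \<alpha>} < card {\<delta>. \<delta> \<prec>\<^sub>s \<beta>}"
  using assms shortlex_trans shortlex_irrefl
  by (intro psubset_card_mono finite_shortlex_below) blast

lemma bij_shortlex_rank: "bij (\<lambda>\<alpha> :: 'n::{finite,linorder} multi_index. card {\<delta>. \<delta> \<prec>\<^sub>s \<alpha>})"
proof (rule bijI)
  let ?r = "\<lambda>\<alpha> :: 'n multi_index. card {\<delta>. \<delta> \<prec>\<^sub>s \<alpha>}"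
  show inj: "inj ?r"
    by (rule injI) (metis shortlex_total shortlex_rank_strict_mono less_irrefl)
  have down: "?r ` {\<delta>. \<delta> \<prec>\<^sub>s \<alpha>} = {..<?r \<alpha>}" for \<alpha>
    by (rule card_subset_eq)
       (auto intro: shortlex_rank_strict_mono simp: card_image inj_on_subset [OF inj])
  have "infinite (range ?r)"
  proof
    assume "finite (range ?r)"
    then have "finite (UNIV :: 'n multi_index set)"
      using inj by (rule finite_imageD)
    moreover have "inj (\<lambda>k::nat. vec_lambda (\<lambda>i. k) :: 'n multi_index)"
      by (metis (no_types, lifting) injI vec_lambda_beta)
    ultimately show False
      by (metis finite_imageD finite_subset infinite_UNIV_nat subset_UNIV)
  qed
  show "surj ?r"
  proof -
    have "n \<in> range ?r" for n
    proof -
      obtain m where "m \<in> range ?r" "n < m"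
        using \<open>infinite (range ?r)\<close> by (meson infinite_nat_iff_unbounded)
      then obtain \<alpha> where "n \<in> {..<?r \<alpha>}" by auto
      then show ?thesis unfolding down [symmetric] by auto
    qed
    then show ?thesis by blast
  qed
qed

lemma card_below_shortlex_enum:
  "card {\<delta> :: 'n::{finite,linorder} multi_index. \<delta> \<prec>\<^sub>s shortlex_enum n} = n"
proof -
  have "\<exists>!\<alpha> :: 'n multi_index. card {\<delta>. \<delta> \<prec>\<^sub>s \<alpha>} = n"
    using bij_shortlex_rank [where 'n = 'n] unfolding bij_iff by blast
  then show ?thesis unfolding shortlex_enum_def by (rule theI')
qed

lemma shortlex_enum_less_iff: "shortlex_enum m \<prec>\<^sub>s shortlex_enum n \<longleftrightarrow> m < n"
  by (metis card_below_shortlex_enum shortlex_rank_strict_mono shortlex_total less_asym' less_irrefl)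

lemma bij_shortlex_enum: "bij shortlex_enum"
  unfolding bij_def inj_def surj_def
  by (metis card_below_shortlex_enum bij_shortlex_rank bij_is_inj inj_eq)

lemma shortlex_between:
  fixes \<alpha> \<beta> :: "'n::{finite,linorder} multi_index"
  shows "sorted_wrt (\<prec>\<^sub>s) (shortlex_between \<alpha> \<beta>)"
    "set (shortlex_between \<alpha> \<beta>) = {\<delta>. \<alpha> \<prec>\<^sub>s \<delta> \<and> \<delta> \<prec>\<^sub>s \<beta>}"
proof -
  have order: "\<not> x \<prec>\<^sub>s x" "x \<prec>\<^sub>s y \<Longrightarrow> y \<prec>\<^sub>s z \<Longrightarrow> x \<prec>\<^sub>s z" "x \<prec>\<^sub>s y \<or> x = y \<or> y \<prec>\<^sub>s x"
    for x y z :: "'n multi_index"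
    by (fact shortlex_irrefl shortlex_trans shortlex_total)+
  interpret sl: linorder "\<lambda>x y :: 'n multi_index. x \<prec>\<^sub>s y \<or> x = y" "(\<prec>\<^sub>s)"
  proof unfold_locales
    fix x y z :: "'n multi_index"
    show "x \<prec>\<^sub>s y \<longleftrightarrow> (x \<prec>\<^sub>s y \<or> x = y) \<and> \<not> (y \<prec>\<^sub>s x \<or> y = x)"
      using order(1) order(2) [of x y x] by auto
    show "x \<prec>\<^sub>s z \<or> x = z" if "x \<prec>\<^sub>s y \<or> x = y" "y \<prec>\<^sub>s z \<or> y = z"
      using that order(2) [of x y z] by auto
    show "x = y" if "x \<prec>\<^sub>s y \<or> x = y" "y \<prec>\<^sub>s x \<or> y = x"
      using that order(1) order(2) [of x y x] by auto
    show "(x \<prec>\<^sub>s y \<or> x = y) \<or> y \<prec>\<^sub>s x \<or> y = x"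
      using order(3) [of x y] by auto
  qed simp
  let ?S = "{\<delta>. \<alpha> \<prec>\<^sub>s \<delta> \<and> \<delta> \<prec>\<^sub>s \<beta>}"
  have "finite ?S"
    by (rule finite_subset [OF _ finite_shortlex_below [of \<beta>]]) auto
  then have "\<exists>!xs. sorted_wrt (\<prec>\<^sub>s) xs \<and> set xs = ?S"
    by (metis (no_types, lifting) sl.strict_sorted_list_of_set sl.set_sorted_list_of_set
        sl.strict_sorted_equal)
  then have "sorted_wrt (\<prec>\<^sub>s) (shortlex_between \<alpha> \<beta>) \<and> set (shortlex_between \<alpha> \<beta>) = ?S"
    unfolding shortlex_between_def by (rule theI')
  then show "sorted_wrt (\<prec>\<^sub>s) (shortlex_between \<alpha> \<beta>)" "set (shortlex_between \<alpha> \<beta>) = ?S"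
    by auto
qed

section \<open>Moments and Verblunsky coefficients\<close>

definition monomial :: "'n::finite multi_index \<Rightarrow> 'n cspace \<Rightarrow> complex" where
  "monomial \<alpha> z = (\<Prod>i\<in>UNIV. vec_nth z i ^ vec_nth \<alpha> i)"

definition moment :: "'n::finite cspace measure \<Rightarrow> 'n multi_index \<Rightarrow> 'n multi_index \<Rightarrow> complex" where
  "moment \<mu> \<alpha> \<beta> = (\<integral>\<zeta>. monomial \<alpha> \<zeta> * cnj (monomial \<beta> \<zeta>) \<partial>\<mu>)"

text \<open>
  Here \<open>\<bullet>\<close> is the bilinear scalar product of vectors, without conjugation.  If no multi-index
  lies strictly between \<open>\<alpha>\<close> and \<open>\<beta>\<close>, then all the vectors are empty and the terms involving
  \<open>Minv\<close> vanish.
\<close>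

definition verblunsky_above ::
    "('n::{finite,linorder} multi_index \<Rightarrow> 'n multi_index \<Rightarrow> complex) \<Rightarrow> 'n multi_index \<Rightarrow> 'n multi_index \<Rightarrow> complex" where
  "verblunsky_above K \<alpha> \<beta> =
     (let S = shortlex_between \<alpha> \<beta>;
          m = length S;
          M = Matrix.mat m m (\<lambda>(i, j). K (S ! i) (S ! j));
          u = Matrix.vec m (\<lambda>j. K \<alpha> (S ! j));
          v = Matrix.vec m (\<lambda>i. K (S ! i) \<beta>);
          Minv = the (mat_inverse M)
      in (K \<alpha> \<beta> - u \<bullet> (Minv *\<^sub>v v)) /
         (csqrt (K \<alpha> \<alpha> - u \<bullet> (Minv *\<^sub>v conjugate u)) *
          csqrt (K \<beta> \<beta> - conjugate v \<bullet> (Minv *\<^sub>v v))))"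

definition verblunsky ::
    "'n::{finite,linorder} cspace measure \<Rightarrow> 'n multi_index \<Rightarrow> 'n multi_index \<Rightarrow> complex" where
  "verblunsky \<mu> \<alpha> \<beta> =
     (if \<alpha> = \<beta> then 0
      else if \<alpha> \<prec>\<^sub>s \<beta> then verblunsky_above (moment \<mu>) \<alpha> \<beta>
      else cnj (verblunsky_above (moment \<mu>) \<beta> \<alpha>))"

end

theory Submission
  imports
    Defs
    "HOL-Complex_Analysis.Complex_Analysis"
    "Jordan_Normal_Form.Determinant"
begin

text \<open>Write \<open>d\<close> for the dimension, \<open>\<sigma>\<close> for \<^const>\<open>sphere_measure\<close> and \<open>g\<^sup>*\<close> for the boundary values of \<open>g\<close>.
  The argument is that of Szego on the circle: both sides of the formula are equal to \<open>\<bar>g 0\<bar>\<^sup>2\<close>.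

  On the left-hand side, the Verblunsky coefficient \<open>\<gamma>\<close> of \<open>0\<close> and \<open>\<alpha>\<close> is the correlation coefficient, in
  \<open>L\<^sup>2(\<mu>)\<close>, between the residuals of \<open>1\<close> and \<open>\<zeta>\<^sup>\<alpha>\<close> after projecting out the monomials strictly between them.
  Adjoining \<open>\<zeta>\<^sup>\<alpha>\<close> to these monomials is one step of Gram--Schmidt, which multiplies the squared distance
  of \<open>1\<close> from their span by \<open>1 - \<bar>\<gamma>\<bar>\<^sup>2\<close>.  The partial products therefore telescope
  (\<open>verblunsky_product\<close>), and they decrease to the infimum of \<open>\<integral>\<bar>p\<bar>\<^sup>2 d\<mu>\<close> over all polynomials
  \<open>p\<close> with \<open>p 0 = 1\<close> (\<open>verblunsky_product_limit\<close>).

  This infimum is at least \<open>\<bar>g 0\<bar>\<^sup>2\<close>: the mean of \<open>p g\<^sup>*\<close> over the sphere is \<open>p 0 * g 0\<close>, and the mean of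
  \<open>\<bar>p g\<^sup>*\<bar>\<^sup>2\<close> is at most \<open>\<integral>\<bar>p\<bar>\<^sup>2 d\<mu>\<close> (\<open>szego_lower_bound\<close>).  For the converse, the atoms of \<open>\<mu>\<close>
  cost nothing: a factor \<open>1 - f\<^sup>n\<close>, where \<open>f z = (1 + \<langle>z, \<xi>\<rangle>) / 2\<close>, vanishes at \<open>\<xi>\<close>, tends to \<open>1\<close> elsewhere
  on the sphere and is \<open>1 - 2\<^sup>-\<^sup>n\<close> at the origin (\<open>remove_countably_many_points\<close>).  This leaves the weight
  \<open>\<bar>g\<^sup>*\<bar>\<^sup>2\<close>, for which the Taylor polynomials of the dilations of \<open>g 0 / g\<close> are nearly extremal because
  \<open>1 / g\<close> is bounded (\<open>szego_upper_bound\<close>).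

  On the right-hand side, \<open>g\<close> has a holomorphic logarithm in the unit disc of every complex line through the
  origin, so \<open>ln \<bar>g\<bar>\<close> has the mean value property on the spheres of radius \<open>r < 1\<close>.  It is bounded since \<open>g\<close> and \<open>1 / g\<close> are, and \<open>r\<close> can tend to \<open>1\<close>
  (\<open>integral_ln_weight\<close>).

  All this presupposes that \<open>g\<^sup>*\<close> exists almost everywhere and is measurable, which is the analytic core.  The unitary group is
  transitive on the sphere, so the reproducing kernel of the polynomials of degree at most \<open>n\<close> is radial on the diagonal and
  at most \<open>(1 - \<bar>z\<bar>\<^sup>2)\<^bsup>-d\<^esup>\<close> (\<open>point_evaluation_bound\<close>).  Applied to a polynomial times a power of the Cauchy
  kernel, this bound becomes the Poisson--Szego majorant (\<open>poisson_szego_bound\<close>).  That majorant is controlled by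
  averages over the balls of the metric \<open>\<bar>1 - \<langle>a, b\<rangle>\<bar>\<^bsup>1/2\<^esup>\<close>, of which one of radius \<open>\<rho>\<close>
  has measure at most of order \<open>\<rho>\<^bsup>2 d\<^esup>\<close>, and a Vitali covering gives a weak-type maximal inequality over Koranyi regions (\<open>maximal_inequality\<close>).  The homogeneous components of a bounded
  holomorphic function are polynomials whose square norms are summable, so its Taylor polynomials approximate it in the
  sense of this inequality, and K-limits exist almost everywhere (\<open>AE_has_K_limit\<close>).\<close>

section \<open>Hermitian geometry\<close>

lemma herm_add_left: "herm (x + y) z = herm x z + herm y z"
  by (simp add: herm_def distrib_right sum.distrib)

lemma herm_diff_left: "herm (x - y) z = herm x z - herm y z"
  by (simp add: herm_def left_diff_distrib sum_subtractf)

lemma herm_scale_left: "herm (c *s x) z = c * herm x z"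
  by (simp add: herm_def sum_distrib_left mult.assoc)

lemma cnj_herm: "cnj (herm x y) = herm y x"
  by (simp add: herm_def mult.commute)

lemma herm_diff_right: "herm z (x - y) = herm z x - herm z y"
  by (metis cnj_herm complex_cnj_diff herm_diff_left)

lemma herm_scale_right: "herm z (c *s x) = cnj c * herm z x"
  by (metis cnj_herm complex_cnj_mult herm_scale_left)

lemma herm_zero_left [simp]: "herm 0 z = 0"
  by (simp add: herm_def)

lemma scaleR_eq_smult: "r *\<^sub>R (x :: 'n::finite cspace) = of_real r *s x"
  unfolding Finite_Cartesian_Product.vec_eq_iff vector_scaleR_component
  by (simp add: scaleR_conv_of_real [of _ "_ :: complex"])

lemma herm_scaleR_left: "herm (r *\<^sub>R x) z = of_real r * herm x z"
  by (simp add: scaleR_eq_smult herm_scale_left)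

lemma herm_scaleR_right: "herm z (r *\<^sub>R x) = of_real r * herm z x"
  by (simp add: scaleR_eq_smult herm_scale_right)

lemma inner_eq_Re_herm: "inner x y = Re (herm x y)"
  by (simp add: herm_def inner_vec_def inner_complex_def)

lemma herm_self: "herm z z = of_real ((norm z)\<^sup>2)"
proof -
  have "Im (herm z z) = 0"
    using cnj_herm [of z z] by (simp add: complex_eq_iff)
  then show ?thesis
    by (simp add: complex_eq_iff power2_norm_eq_inner inner_eq_Re_herm)
qed

lemma norm_smult: "norm (c *s (z :: 'n::finite cspace)) = cmod c * norm z"
proof -
  have "(norm (c *s z))\<^sup>2 = (cmod c * norm z)\<^sup>2"
  proof -
    have "complex_of_real ((norm (c *s z))\<^sup>2) = c * cnj c * of_real ((norm z)\<^sup>2)"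
      by (simp only: herm_self [symmetric] herm_scale_left herm_scale_right mult_ac)
    also have "\<dots> = of_real ((cmod c * norm z)\<^sup>2)"
      unfolding complex_norm_square [symmetric] by (simp add: power_mult_distrib)
    finally show ?thesis using of_real_eq_iff by blast
  qed
  then show ?thesis by simp
qed

lemma phase_exists: "\<exists>u. cmod u = 1 \<and> u * a = of_real (cmod a)"
proof (cases "a = 0")
  case False
  show ?thesis
  proof (intro exI conjI)
    show "cmod (cnj a / of_real (cmod a)) = 1"
      using False by (simp add: norm_divide)
    have "cnj a / of_real (cmod a) * a = (a * cnj a) / of_real (cmod a)"
      by (simp add: mult.commute)
    also have "\<dots> = of_real (cmod a)"
      unfolding complex_norm_square [symmetric] of_real_divide [symmetric]
      using False by (simp add: power2_eq_square)
    finally show "cnj a / of_real (cmod a) * a = of_real (cmod a)" .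
  qed
qed (auto intro: exI [of _ 1])

lemma herm_Cauchy_Schwarz: "cmod (herm x y) \<le> norm x * norm y"
proof -
  obtain u where u: "cmod u = 1" "u * herm x y = of_real (cmod (herm x y))"
    using phase_exists by blast
  then have "cmod (herm x y) = inner (u *s x) y"
    by (simp add: inner_eq_Re_herm herm_scale_left)
  also have "\<dots> \<le> norm (u *s x) * norm y"
    by (rule norm_cauchy_schwarz)
  finally show ?thesis using u by (simp add: norm_smult)
qed

lemma continuous_on_herm [continuous_intros]:
  "continuous_on S f \<Longrightarrow> continuous_on S h \<Longrightarrow> continuous_on S (\<lambda>x. herm (f x) (h x))"
  unfolding herm_def by (intro continuous_intros)

text \<open>
  The anisotropic quantity \<open>\<bar>1 - \<langle>a, b\<rangle>\<bar>\<close> is the square of a metric on the sphere.  Splitting off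
  the components orthogonal to \<open>b\<close>, one has
  \<open>1 - \<langle>a, c\<rangle> = (1 - \<langle>a, b\<rangle>) + \<langle>a, b\<rangle> (1 - \<langle>b, c\<rangle>) - \<langle>a', c'\<rangle>\<close>, and the squared length of \<open>a'\<close> is
  \<open>1 - \<bar>\<langle>a, b\<rangle>\<bar>\<^sup>2 \<le> 2 \<bar>1 - \<langle>a, b\<rangle>\<bar>\<close>.
\<close>

lemma anisotropic_triangle:
  assumes "norm a = 1" "norm b = 1" "norm c = 1"
  shows "sqrt (cmod (1 - herm a c)) \<le> sqrt (cmod (1 - herm a b)) + sqrt (cmod (1 - herm b c))"
proof -
  define a' where "a' = a - herm a b *s b"
  define c' where "c' = c - herm c b *s b"
  have bb: "herm b b = 1" using assms(2) by (simp add: herm_self)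
  have len: "(norm (x - herm x b *s b))\<^sup>2 \<le> 2 * cmod (1 - herm x b)" if "norm x = 1" for x
  proof -
    have "complex_of_real ((norm (x - herm x b *s b))\<^sup>2) = herm x x - herm x b * cnj (herm x b)"
      by (simp only: herm_self [symmetric])
         (simp add: herm_diff_left herm_diff_right herm_scale_left herm_scale_right bb cnj_herm algebra_simps)
    also have "\<dots> = of_real (1 - (cmod (herm x b))\<^sup>2)"
      unfolding complex_norm_square [symmetric] using that by (simp add: herm_self)
    finally have eq: "(norm (x - herm x b *s b))\<^sup>2 = 1 - (cmod (herm x b))\<^sup>2"
      using of_real_eq_iff by blast
    have le1: "cmod (herm x b) \<le> 1"
      using herm_Cauchy_Schwarz [of x b] that assms by simp
    have "1 - (cmod (herm x b))\<^sup>2 = (1 + cmod (herm x b)) * (1 - cmod (herm x b))"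
      by (simp add: power2_eq_square algebra_simps)
    also have "\<dots> \<le> 2 * (1 - cmod (herm x b))"
      using le1 by (intro mult_right_mono) auto
    also have "1 - cmod (herm x b) \<le> cmod (1 - herm x b)"
      using norm_triangle_ineq2 [of 1 "herm x b"] by simp
    finally show ?thesis using eq by simp
  qed
  let ?A = "cmod (1 - herm a b)" and ?B = "cmod (1 - herm b c)"
  have B: "cmod (1 - herm c b) = ?B"
    by (metis cnj_herm complex_cnj_diff complex_cnj_one complex_mod_cnj)
  have "norm a' * norm c' \<le> sqrt (2 * ?A) * sqrt (2 * ?B)"
    unfolding a'_def c'_def using len [OF assms(1)] len [OF assms(3)] B
    by (intro mult_mono) (auto intro!: real_le_rsqrt)
  also have "\<dots> = 2 * (sqrt ?A * sqrt ?B)"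
    by (simp add: real_sqrt_mult)
  finally have cross: "cmod (herm a' c') \<le> 2 * (sqrt ?A * sqrt ?B)"
    using herm_Cauchy_Schwarz [of a' c'] by linarith
  have "herm a' c' = herm a c - herm a b * herm b c"
    unfolding a'_def c'_def
    by (simp add: herm_diff_left herm_diff_right herm_scale_left herm_scale_right bb cnj_herm algebra_simps)
  then have eq: "1 - herm a c = (1 - herm a b) + herm a b * (1 - herm b c) - herm a' c'"
    by (simp add: algebra_simps)
  have "cmod (1 - herm a c) \<le> ?A + cmod (herm a b) * ?B + cmod (herm a' c')"
    using norm_triangle_ineq4 [of "(1 - herm a b) + herm a b * (1 - herm b c)" "herm a' c'"]
      norm_triangle_ineq [of "1 - herm a b" "herm a b * (1 - herm b c)"]
    unfolding eq norm_mult by linarith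
  also have "cmod (herm a b) * ?B \<le> ?B"
    using herm_Cauchy_Schwarz [of a b] assms by (intro mult_left_le_one_le) auto
  also have "?A + ?B + cmod (herm a' c') \<le> (sqrt ?A + sqrt ?B)\<^sup>2"
    using cross by (simp add: power2_eq_square algebra_simps)
  finally show ?thesis
    by (intro real_le_lsqrt) auto
qed

section \<open>Unitary maps\<close>

definition unitary :: "('n::finite cspace \<Rightarrow> 'n cspace) \<Rightarrow> bool" where
  "unitary U \<longleftrightarrow> linear U \<and> (\<forall>c v. U (c *s v) = c *s U v) \<and> (\<forall>x y. herm (U x) (U y) = herm x y)"

lemma unitary_imp_orthogonal: "unitary U \<Longrightarrow> orthogonal_transformation U"
  by (simp add: unitary_def orthogonal_transformation_def inner_eq_Re_herm)

text \<open>A complex Householder reflection exchanges two vectors of the same length whose Hermitian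
  product is real; the product becomes real after one of them is multiplied by a phase.\<close>

lemma unitary_transitive:
  assumes "norm a = norm b"
  obtains U where "unitary U" "U a = b"
proof -
  obtain u where u: "cmod u = 1" "u * herm b a = of_real (cmod (herm b a))"
    using phase_exists by blast
  define b' where "b' = u *s b"
  have real: "herm b' a = of_real (cmod (herm b a))"
    using u by (simp add: b'_def herm_scale_left)
  then have real': "herm a b' = herm b' a"
    by (metis cnj_herm complex_cnj_complex_of_real)
  have uu: "cnj u * u = 1"
    using u by (metis complex_norm_square mult.commute of_real_1 one_power2)
  define v where "v = a - b'"
  have aa: "herm b' b' = herm a a"
    using assms u by (simp add: herm_self b'_def norm_smult)
  have vv: "herm v v = 2 * herm a v"
    unfolding v_def by (simp add: herm_diff_left herm_diff_right aa real')
  define k where "k = 2 / herm v v"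
  define H where "H x = x - (k * herm x v) *s v" for x
  have H_lin: "linear H"
  proof (rule linearI)
    show "H (x + y) = H x + H y" for x y
      unfolding H_def
      by (simp add: Finite_Cartesian_Product.vec_eq_iff herm_add_left algebra_simps)
    show "H (r *\<^sub>R x) = r *\<^sub>R H x" for r x
      unfolding H_def scaleR_eq_smult
      by (simp add: Finite_Cartesian_Product.vec_eq_iff herm_scale_left algebra_simps)
  qed
  have H_sc: "H (c *s x) = c *s H x" for c x
    unfolding H_def
    by (simp add: Finite_Cartesian_Product.vec_eq_iff herm_scale_left algebra_simps)
  have H_herm: "herm (H x) (H y) = herm x y" for x y
  proof (cases "herm v v = 0")
    case True
    then show ?thesis by (simp add: H_def k_def)
  next
    case False
    have cv: "cnj (herm v v) = herm v v" by (simp add: herm_self)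
    show ?thesis
      using False unfolding H_def k_def
      by (simp add: herm_diff_left herm_diff_right herm_scale_left herm_scale_right cnj_herm cv field_simps)
  qed
  have Ha: "H a = b'"
  proof (cases "v = 0")
    case True
    then show ?thesis by (simp add: H_def v_def)
  next
    case False
    then have "herm v v \<noteq> 0" by (simp add: herm_self)
    then have "k * herm a v = 1" by (simp add: k_def vv)
    then show ?thesis by (simp add: H_def v_def)
  qed
  show thesis
  proof
    show "unitary (\<lambda>x. cnj u *s H x)"
      unfolding unitary_def
    proof (intro conjI allI)
      show "linear (\<lambda>x. cnj u *s H x)"
      proof (rule linearI)
        show "cnj u *s H (x + y) = cnj u *s H x + cnj u *s H y" for x y
          by (simp add: linear_add [OF H_lin] vector_add_ldistrib)
        show "cnj u *s H (r *\<^sub>R x) = r *\<^sub>R (cnj u *s H x)" for r x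
          unfolding scaleR_eq_smult H_sc by (simp add: mult.commute)
      qed
      show "cnj u *s H (c *s x) = c *s (cnj u *s H x)" for c x
        by (simp add: H_sc mult.commute)
      show "herm (cnj u *s H x) (cnj u *s H y) = herm x y" for x y
      proof -
        have "herm (cnj u *s H x) (cnj u *s H y) = (cnj u * u) * herm x y"
          by (simp add: herm_scale_left herm_scale_right H_herm)
        then show ?thesis by (simp only: uu mult_1)
      qed
    qed
    show "cnj u *s H a = b"
      by (simp add: Ha b'_def uu)
  qed
qed

section \<open>Polynomial functions\<close>

lemma mi_abs_add: "mi_abs (\<alpha> + \<beta>) = mi_abs \<alpha> + mi_abs \<beta>"
  by (simp add: mi_abs_def sum.distrib)

lemma monomial_add: "monomial (\<alpha> + \<beta>) z = monomial \<alpha> z * monomial \<beta> z"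
  by (simp add: monomial_def power_add prod.distrib)

lemma mi_abs_zero [simp]: "mi_abs 0 = 0"
  by (simp add: mi_abs_def)

lemma monomial_zero [simp]: "monomial 0 z = 1"
  by (simp add: monomial_def)

lemma monomial_scale: "monomial \<alpha> (c *s z) = c ^ mi_abs \<alpha> * monomial \<alpha> z"
  by (simp add: monomial_def mi_abs_def power_mult_distrib prod.distrib power_sum)

lemma monomial_at_zero: "monomial \<alpha> 0 = (if \<alpha> = 0 then 1 else 0)"
proof (cases "\<alpha> = 0")
  case False
  then obtain i where "vec_nth \<alpha> i \<noteq> 0"
    by (auto simp: Finite_Cartesian_Product.vec_eq_iff)
  then have "(\<Prod>i\<in>UNIV. (0::complex) ^ vec_nth \<alpha> i) = 0"
    by (intro prod_zero) auto
  then show ?thesis using False by (simp add: monomial_def)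
qed simp

lemma continuous_on_monomial [continuous_intros]:
  "continuous_on S f \<Longrightarrow> continuous_on S (\<lambda>x. monomial \<alpha> (f x))"
  unfolding monomial_def by (intro continuous_intros)

lemma continuous_monomial: "continuous_on S (monomial \<alpha>)"
  using continuous_on_monomial [OF continuous_on_id] by simp

lemma vec_nth_le_mi_abs: "vec_nth \<alpha> i \<le> mi_abs \<alpha>"
  unfolding mi_abs_def by (rule member_le_sum) auto

lemma vec_nth_mi_abs_le_subset:
  "vec_nth ` {\<alpha> :: 'n::finite multi_index. mi_abs \<alpha> \<le> n} \<subseteq> UNIV \<rightarrow>\<^sub>E {..n}"
proof (rule image_subsetI, unfold PiE_UNIV_domain Pi_iff, intro ballI, unfold atMost_iff)
  fix \<alpha> :: "'n multi_index" and i assume "\<alpha> \<in> {\<alpha>. mi_abs \<alpha> \<le> n}"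
  then show "vec_nth \<alpha> i \<le> n" using vec_nth_le_mi_abs [of \<alpha> i] by simp
qed

lemma finite_mi_abs_le [simp]: "finite {\<alpha> :: 'n::finite multi_index. mi_abs \<alpha> \<le> n}"
proof -
  have "finite (vec_nth ` {\<alpha> :: 'n multi_index. mi_abs \<alpha> \<le> n})"
    using vec_nth_mi_abs_le_subset
    by (rule finite_subset) (simp add: finite_PiE)
  then show ?thesis
    by (rule finite_imageD) (simp add: inj_on_def vec_nth_inject)
qed

definition poly_fun :: "nat \<Rightarrow> ('n::finite cspace \<Rightarrow> complex) \<Rightarrow> bool" where
  "poly_fun n f \<longleftrightarrow> (\<exists>c. f = (\<lambda>z. \<Sum>\<alpha> | mi_abs \<alpha> \<le> n. c \<alpha> * monomial \<alpha> z))"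

lemma poly_funE:
  assumes "poly_fun n f"
  obtains c where "\<And>z. f z = (\<Sum>\<alpha> | mi_abs \<alpha> \<le> n. c \<alpha> * monomial \<alpha> z)"
  using assms unfolding poly_fun_def by auto

lemma poly_fun_finite_sum:
  assumes "finite A" "\<And>\<alpha>. \<alpha> \<in> A \<Longrightarrow> mi_abs \<alpha> \<le> n" "\<And>z. f z = (\<Sum>\<alpha>\<in>A. c \<alpha> * monomial \<alpha> z)"
  shows "poly_fun n f"
  unfolding poly_fun_def
proof (intro exI ext)
  fix z
  show "f z = (\<Sum>\<alpha> | mi_abs \<alpha> \<le> n. (if \<alpha> \<in> A then c \<alpha> else 0) * monomial \<alpha> z)"
    unfolding assms(3)
    by (rule sum.mono_neutral_cong_left) (use assms in auto)
qed

lemma poly_fun_monomial: "mi_abs \<alpha> \<le> n \<Longrightarrow> poly_fun n (monomial \<alpha>)"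
  by (rule poly_fun_finite_sum [where A = "{\<alpha>}" and c = "\<lambda>_. 1"]) auto

lemma poly_fun_mono: "poly_fun m f \<Longrightarrow> m \<le> n \<Longrightarrow> poly_fun n f"
  by (auto elim!: poly_funE intro!: poly_fun_finite_sum [where A = "{\<alpha>. mi_abs \<alpha> \<le> m}"])

lemma poly_fun_add: "poly_fun n f \<Longrightarrow> poly_fun n h \<Longrightarrow> poly_fun n (\<lambda>z. f z + h z)"
  unfolding poly_fun_def
  by (elim exE, rule_tac x = "\<lambda>\<alpha>. c \<alpha> + ca \<alpha>" in exI) (simp add: sum.distrib distrib_right)

lemma poly_fun_cmult: "poly_fun n f \<Longrightarrow> poly_fun n (\<lambda>z. a * f z)"
  unfolding poly_fun_def
  by (elim exE, rule_tac x = "\<lambda>\<alpha>. a * c \<alpha>" in exI) (simp add: sum_distrib_left mult.assoc)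

lemma poly_fun_const: "poly_fun n (\<lambda>z. a)"
  using poly_fun_cmult [OF poly_fun_monomial [of 0 n], of a] by simp

lemma poly_fun_diff: "poly_fun n f \<Longrightarrow> poly_fun n h \<Longrightarrow> poly_fun n (\<lambda>z. f z - h z)"
  using poly_fun_add [of n f "\<lambda>z. -1 * h z"] poly_fun_cmult [of n h "-1"] by simp

lemma poly_fun_sum:
  "(\<And>i. i \<in> I \<Longrightarrow> poly_fun n (f i)) \<Longrightarrow> poly_fun n (\<lambda>z. \<Sum>i\<in>I. f i z)"
  by (induction I rule: infinite_finite_induct) (auto intro: poly_fun_add poly_fun_const)

lemma ex_poly_fun_sum:
  assumes "finite I" "\<And>i. i \<in> I \<Longrightarrow> \<exists>m. poly_fun m (f i)"
  shows "\<exists>m. poly_fun m (\<lambda>z. \<Sum>i\<in>I. f i z)"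
proof -
  obtain m where m: "\<And>i. i \<in> I \<Longrightarrow> poly_fun (m i) (f i)" using assms(2) by metis
  have "poly_fun (\<Sum>i\<in>I. m i) (f i)" if "i \<in> I" for i
    by (rule poly_fun_mono [OF m [OF that]]) (use that assms(1) in \<open>auto intro: member_le_sum\<close>)
  then show ?thesis using poly_fun_sum [of I "\<Sum>i\<in>I. m i" f] by blast
qed

lemma poly_fun_mult:
  assumes "poly_fun m f" "poly_fun n h"
  shows "poly_fun (m + n) (\<lambda>z. f z * h z)"
proof -
  obtain c where c: "\<And>z. f z = (\<Sum>\<alpha> | mi_abs \<alpha> \<le> m. c \<alpha> * monomial \<alpha> z)"
    using assms(1) by (elim poly_funE) (rule that)
  obtain e where e: "\<And>z. h z = (\<Sum>\<beta> | mi_abs \<beta> \<le> n. e \<beta> * monomial \<beta> z)"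
    using assms(2) by (elim poly_funE) (rule that)
  have eq: "f z * h z = (\<Sum>\<alpha> | mi_abs \<alpha> \<le> m. \<Sum>\<beta> | mi_abs \<beta> \<le> n.
      (c \<alpha> * e \<beta>) * monomial (\<alpha> + \<beta>) z)" for z
    by (simp add: c e sum_product monomial_add mult_ac)
  show ?thesis
    unfolding eq by (intro poly_fun_sum poly_fun_cmult poly_fun_monomial) (auto simp: mi_abs_add)
qed

lemma poly_fun_power: "poly_fun m f \<Longrightarrow> poly_fun (k * m) (\<lambda>z. f z ^ k)"
  by (induction k) (auto intro: poly_fun_const poly_fun_mult)

lemma poly_fun_prod:
  assumes "finite I" "\<And>i. i \<in> I \<Longrightarrow> poly_fun (m i) (f i)"
  shows "poly_fun (\<Sum>i\<in>I. m i) (\<lambda>z. \<Prod>i\<in>I. f i z)"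
  using assms by (induction I rule: finite_induct) (auto intro: poly_fun_const poly_fun_mult)

lemma poly_fun_coord: "poly_fun 1 (\<lambda>z. vec_nth z (i :: 'n::finite))"
proof -
  define \<epsilon> :: "'n multi_index" where "\<epsilon> = vec_lambda (\<lambda>j. if j = i then 1 else 0)"
  have *: "vec_nth \<epsilon> j = (if j = i then 1 else 0)" for j by (simp add: \<epsilon>_def)
  have "mi_abs \<epsilon> = 1"
    by (simp add: mi_abs_def *)
  moreover have "monomial \<epsilon> z = vec_nth z i" for z
    by (simp add: monomial_def * if_distrib [of "\<lambda>k. _ ^ k"] cong: if_cong)
  ultimately show ?thesis
    by (intro poly_fun_finite_sum [where A = "{\<epsilon>}" and c = "\<lambda>_. 1"]) auto
qed

lemma poly_fun_herm: "poly_fun 1 (\<lambda>z. herm z w)"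
  unfolding herm_def
  by (subst mult.commute) (intro poly_fun_sum poly_fun_cmult poly_fun_coord)

lemma poly_fun_compose_unitary:
  assumes "unitary U" "poly_fun n f"
  shows "poly_fun n (\<lambda>z. f (U z))"
proof -
  have U: "linear U" "\<And>c v. U (c *s v) = c *s U v" using assms(1) by (auto simp: unitary_def)
  have coord: "poly_fun 1 (\<lambda>z. vec_nth (U z) i)" for i
  proof -
    have "U z = (\<Sum>j\<in>UNIV. vec_nth z j *s U (axis j 1))" for z
    proof -
      have "z = (\<Sum>j\<in>UNIV. vec_nth z j *s axis j 1)"
        by (simp add: Finite_Cartesian_Product.vec_eq_iff axis_def sum_component if_distrib cong: if_cong)
      then have "U z = U (\<Sum>j\<in>UNIV. vec_nth z j *s axis j 1)" by (rule arg_cong)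
      also have "\<dots> = (\<Sum>j\<in>UNIV. vec_nth z j *s U (axis j 1))"
        by (simp add: linear_sum [OF U(1)] U(2))
      finally show ?thesis .
    qed
    from arg_cong [OF this, of "\<lambda>v. vec_nth v i"]
    have eq: "vec_nth (U z) i = (\<Sum>j\<in>UNIV. vec_nth z j * vec_nth (U (axis j 1)) i)" for z
      unfolding sum_component vector_smult_component .
    show ?thesis
      by (subst eq, subst mult.commute) (intro poly_fun_sum poly_fun_cmult poly_fun_coord)
  qed
  have mono: "poly_fun (mi_abs \<alpha>) (\<lambda>z. monomial \<alpha> (U z))" for \<alpha>
  proof -
    have "poly_fun (\<Sum>i\<in>UNIV. vec_nth \<alpha> i * 1) (\<lambda>z. monomial \<alpha> (U z))"
      unfolding monomial_def by (intro poly_fun_prod poly_fun_power coord) auto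
    then show ?thesis by (simp add: mi_abs_def)
  qed
  obtain c where c: "\<And>z. f z = (\<Sum>\<alpha> | mi_abs \<alpha> \<le> n. c \<alpha> * monomial \<alpha> z)"
    using assms(2) by (elim poly_funE) (rule that)
  show ?thesis
    unfolding c
    by (intro poly_fun_sum poly_fun_cmult) (auto intro: poly_fun_mono [OF mono])
qed

lemma continuous_on_poly_fun: "poly_fun n f \<Longrightarrow> continuous_on S f"
  by (auto simp: poly_fun_def intro!: continuous_intros)

section \<open>Integration over the sphere\<close>

interpretation sphere: prob_space "sphere_measure :: 'a::euclidean_space measure"
  by (rule prob_space_sphere_measure)

lemma borel_measurable_sphere_restrict:
  "f \<in> borel_measurable borel \<Longrightarrow> f \<in> borel_measurable sphere_measure"
  unfolding measurable_cong_sets [OF sets_sphere_measure refl]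
  by (rule measurable_restrict_space1)

lemma borel_measurable_sphere_cont:
  fixes f :: "'a::euclidean_space \<Rightarrow> 'b::topological_space"
  assumes "continuous_on (sphere 0 1) f"
  shows "f \<in> borel_measurable sphere_measure"
  unfolding measurable_cong_sets [OF sets_sphere_measure refl]
  using assms by (rule borel_measurable_continuous_on_restrict)

lemma integrable_continuous_on_sphere:
  fixes f :: "'a::euclidean_space \<Rightarrow> 'b::{banach, second_countable_topology}"
  assumes "finite_measure \<mu>" and sets_mu: "sets \<mu> = sets sphere_measure"
    and cont: "continuous_on (sphere 0 1) f"
  shows "integrable \<mu> f"
proof -
  interpret \<mu>: finite_measure \<mu> by fact
  have space_mu: "space \<mu> = sphere 0 1" using sets_eq_imp_space_eq [OF sets_mu] by simp
  obtain B where B: "\<And>x. x \<in> sphere 0 1 \<Longrightarrow> norm (f x) \<le> B"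
    using continuous_on_compact_bound [OF compact_sphere cont] by blast
  show ?thesis
  proof (rule \<mu>.integrable_const_bound)
    show "f \<in> borel_measurable \<mu>"
      unfolding measurable_cong_sets [OF sets_mu refl] by (rule borel_measurable_sphere_cont [OF cont])
    show "AE x in \<mu>. norm (f x) \<le> B"
      by (rule AE_I2) (simp only: space_mu B)
  qed
qed

lemma integrable_sphere_cont:
  fixes f :: "'a::euclidean_space \<Rightarrow> 'b::{banach, second_countable_topology}"
  assumes "continuous_on (sphere 0 1) f"
  shows "integrable sphere_measure f"
  by (rule integrable_continuous_on_sphere [OF sphere.finite_measure_axioms refl assms])

lemma measurable_unitary_sphere:
  assumes "unitary U"
  shows "U \<in> measurable sphere_measure sphere_measure"
proof -
  have lin: "linear U" and nU: "\<And>x. norm (U x) = norm x"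
    using unitary_imp_orthogonal [OF assms] by (auto simp: orthogonal_transformation)
  have mU: "U \<in> borel_measurable borel"
    using lin by (auto intro!: borel_measurable_continuous_onI linear_continuous_on simp: linear_conv_bounded_linear)
  then show ?thesis
    unfolding measurable_cong_sets [OF sets_sphere_measure sets_sphere_measure]
    by (intro measurable_restrict_space3) (use nU in auto)
qed

lemma integral_sphere_unitary:
  fixes f :: "'n::finite cspace \<Rightarrow> 'b::{banach, second_countable_topology}"
  assumes "unitary U" "f \<in> borel_measurable sphere_measure"
  shows "(\<integral>\<zeta>. f (U \<zeta>) \<partial>sphere_measure) = (\<integral>\<zeta>. f \<zeta> \<partial>sphere_measure)"
proof -
  have "(\<integral>\<zeta>. f \<zeta> \<partial>sphere_measure) = (\<integral>\<zeta>. f \<zeta> \<partial>distr sphere_measure sphere_measure U)"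
    by (simp add: sphere_measure_rotation_invariant [OF unitary_imp_orthogonal [OF assms(1)]])
  also have "\<dots> = (\<integral>\<zeta>. f (U \<zeta>) \<partial>sphere_measure)"
    using measurable_unitary_sphere [OF assms(1)] assms(2) by (rule integral_distr)
  finally show ?thesis ..
qed

lemma unitary_diagonal:
  assumes "\<And>i. cmod (a i) = 1"
  shows "unitary (\<lambda>z :: 'n::finite cspace. vec_lambda (\<lambda>i. a i * vec_nth z i))"
proof -
  have "herm (vec_lambda (\<lambda>i. a i * vec_nth x i)) (vec_lambda (\<lambda>i. a i * vec_nth y i)) = herm x y" for x y :: "'n cspace"
  proof -
    have "a i * vec_nth x i * cnj (a i * vec_nth y i) = vec_nth x i * cnj (vec_nth y i)" for i
    proof -
      have one: "a i * cnj (a i) = 1" by (metis assms complex_norm_square of_real_1 one_power2)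
      have "a i * vec_nth x i * cnj (a i * vec_nth y i) = (a i * cnj (a i)) * (vec_nth x i * cnj (vec_nth y i))"
        by (simp add: mult_ac)
      then show ?thesis by (simp only: one mult_1)
    qed
    then show ?thesis unfolding herm_def vec_lambda_beta by (intro sum.cong refl)
  qed
  then show ?thesis
    unfolding unitary_def
    by (auto intro!: linearI simp: Finite_Cartesian_Product.vec_eq_iff algebra_simps)
qed

lemma unitary_phase: "cmod c = 1 \<Longrightarrow> unitary (\<lambda>z :: 'n::finite cspace. c *s z)"
  using unitary_diagonal [of "\<lambda>_. c"] by (simp add: vector_scalar_mult_def)

text \<open>Eigenspaces of a unitary operator for different eigenvalues are orthogonal; here the operator
  is \<open>f \<mapsto> f \<circ> U\<close>, and \<open>a \<noteq> b\<close> reads \<open>a * cnj b \<noteq> 1\<close> for eigenvalues on the unit circle.\<close>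

lemma eigenfunctions_orthogonal:
  fixes f h :: "'n::finite cspace \<Rightarrow> complex"
  assumes U: "unitary U" and cont: "continuous_on (sphere 0 1) f" "continuous_on (sphere 0 1) h"
    and eig: "\<And>z. f (U z) = a * f z" "\<And>z. h (U z) = b * h z" and ne: "a * cnj b \<noteq> 1"
  shows "(\<integral>\<zeta>. f \<zeta> * cnj (h \<zeta>) \<partial>sphere_measure) = 0" (is "?I = 0")
proof -
  have "?I = (\<integral>\<zeta>. f (U \<zeta>) * cnj (h (U \<zeta>)) \<partial>sphere_measure)"
    by (rule integral_sphere_unitary [OF U, symmetric])
       (intro borel_measurable_sphere_cont continuous_intros cont)
  also have "\<dots> = (\<integral>\<zeta>. (a * cnj b) * (f \<zeta> * cnj (h \<zeta>)) \<partial>sphere_measure)"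
    by (simp add: eig mult_ac)
  also have "\<dots> = (a * cnj b) * ?I"
    by simp
  finally have I: "?I = (a * cnj b) * ?I" .
  have "(a * cnj b - 1) * ?I = 0"
    by (simp only: left_diff_distrib mult_1 I [symmetric] diff_self)
  then show ?thesis using ne by simp
qed

lemma exists_separating_phase:
  assumes "j \<noteq> k"
  obtains c where "cmod c = 1" "c ^ j * cnj (c ^ k) \<noteq> 1"
proof
  let ?c = "cis (pi / (real j - real k))"
  show "cmod ?c = 1" by simp
  have "?c ^ j * cnj (?c ^ k) = cis ((real j - real k) * (pi / (real j - real k)))"
    unfolding complex_cnj_power cis_cnj Complex.DeMoivre cis_mult
    by (rule arg_cong [where f = cis]) (simp add: left_diff_distrib diff_divide_distrib)
  also have "(real j - real k) * (pi / (real j - real k)) = pi"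
    using assms by simp
  finally have "?c ^ j * cnj (?c ^ k) = -1" by (simp only: cis_pi)
  then show "?c ^ j * cnj (?c ^ k) \<noteq> 1" by (simp only:) simp
qed

text \<open>The rotation of a coordinate in which \<open>\<alpha>\<close> and \<open>\<beta>\<close> differ separates the two monomials.\<close>

lemma monomial_orthogonal:
  fixes \<alpha> \<beta> :: "'n::finite multi_index"
  assumes "\<alpha> \<noteq> \<beta>"
  shows "(\<integral>\<zeta>. monomial \<alpha> \<zeta> * cnj (monomial \<beta> \<zeta>) \<partial>sphere_measure) = 0"
proof -
  obtain i where "vec_nth \<alpha> i \<noteq> vec_nth \<beta> i"
    using assms by (auto simp: Finite_Cartesian_Product.vec_eq_iff)
  then obtain t where t: "cmod t = 1" "t ^ vec_nth \<alpha> i * cnj (t ^ vec_nth \<beta> i) \<noteq> 1"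
    by (rule exists_separating_phase)
  define a where "a j = (if j = i then t else 1)" for j
  define U where "U z = vec_lambda (\<lambda>j. a j * vec_nth z j)" for z :: "'n cspace"
  have U: "unitary U"
    unfolding U_def by (rule unitary_diagonal) (simp add: a_def t)
  have mono: "monomial \<gamma> (U z) = t ^ vec_nth \<gamma> i * monomial \<gamma> z" for \<gamma> z
    by (simp add: monomial_def U_def power_mult_distrib prod.distrib a_def
        if_distrib [of "\<lambda>x. x ^ _"] cong: if_cong)
  show ?thesis
    by (rule eigenfunctions_orthogonal [OF U continuous_monomial continuous_monomial mono mono t(2)])
qed

section \<open>Point evaluation and the Poisson--Szego kernel\<close>

definition sphere_norm2 :: "('n::finite cspace \<Rightarrow> complex) \<Rightarrow> real" where
  "sphere_norm2 f = (\<integral>\<zeta>. (cmod (f \<zeta>))\<^sup>2 \<partial>sphere_measure)"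

lemma sphere_norm2_nonneg: "0 \<le> sphere_norm2 f"
  by (simp add: sphere_norm2_def)

lemma sphere_norm2_orthogonal_sum:
  fixes f :: "'i \<Rightarrow> 'n::finite cspace \<Rightarrow> complex"
  assumes "finite A" and cont: "\<And>i. i \<in> A \<Longrightarrow> continuous_on (sphere 0 1) (f i)"
    and orth: "\<And>i j. i \<in> A \<Longrightarrow> j \<in> A \<Longrightarrow> i \<noteq> j \<Longrightarrow> (\<integral>\<zeta>. f i \<zeta> * cnj (f j \<zeta>) \<partial>sphere_measure) = 0"
  shows "sphere_norm2 (\<lambda>\<zeta>. \<Sum>i\<in>A. c i * f i \<zeta>) = (\<Sum>i\<in>A. (cmod (c i))\<^sup>2 * sphere_norm2 (f i))"
proof -
  have int: "integrable sphere_measure (\<lambda>\<zeta>. f i \<zeta> * cnj (f j \<zeta>))" if "i \<in> A" "j \<in> A" for i j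
    by (intro integrable_sphere_cont continuous_intros cont that)
  have diag: "(\<integral>\<zeta>. f i \<zeta> * cnj (f i \<zeta>) \<partial>sphere_measure) = of_real (sphere_norm2 (f i))" for i
    unfolding complex_norm_square [symmetric] sphere_norm2_def
    by (rule integral_complex_of_real)
  have "complex_of_real (sphere_norm2 (\<lambda>\<zeta>. \<Sum>i\<in>A. c i * f i \<zeta>))
      = (\<integral>\<zeta>. (\<Sum>i\<in>A. c i * f i \<zeta>) * cnj (\<Sum>j\<in>A. c j * f j \<zeta>) \<partial>sphere_measure)"
    unfolding complex_norm_square [symmetric] sphere_norm2_def
    by (rule integral_complex_of_real [symmetric])
  also have "\<dots> = (\<integral>\<zeta>. (\<Sum>i\<in>A. \<Sum>j\<in>A. (c i * cnj (c j)) * (f i \<zeta> * cnj (f j \<zeta>))) \<partial>sphere_measure)"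
    by (simp add: sum_product mult_ac)
  also have "\<dots> = (\<Sum>i\<in>A. \<Sum>j\<in>A. (c i * cnj (c j)) * (\<integral>\<zeta>. f i \<zeta> * cnj (f j \<zeta>) \<partial>sphere_measure))"
    using int by (simp add: Bochner_Integration.integral_sum)
  also have "\<dots> = (\<Sum>i\<in>A. \<Sum>j\<in>A. if j = i then of_real ((cmod (c i))\<^sup>2 * sphere_norm2 (f i)) else 0)"
    by (intro sum.cong refl) (auto simp: diag orth complex_norm_square simp del: of_real_power)
  also have "\<dots> = of_real (\<Sum>i\<in>A. (cmod (c i))\<^sup>2 * sphere_norm2 (f i))"
    using \<open>finite A\<close> by simp
  finally show ?thesis using of_real_eq_iff by blast
qed

text \<open>The cone over the points of the sphere with a vanishing coordinate lies in a hyperplane.\<close>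

lemma null_coordinate_sphere:
  "AE \<zeta> in (sphere_measure :: 'n::finite cspace measure). vec_nth \<zeta> i \<noteq> 0"
proof -
  let ?N = "{\<zeta> \<in> sphere 0 1. vec_nth (\<zeta> :: 'n cspace) i = 0}"
  have "?N = sphere 0 1 \<inter> (\<lambda>\<zeta>. vec_nth \<zeta> i) -` {0}" by auto
  moreover have "closed (sphere 0 1 \<inter> (\<lambda>\<zeta> :: 'n cspace. vec_nth \<zeta> i) -` {0})"
    by (intro continuous_closed_preimage continuous_intros) auto
  ultimately have "closed ?N" by simp
  then have N: "?N \<in> sets sphere_measure"
    by (auto simp: sets_restrict_space_iff)
  let ?M = "{z \<in> ball 0 1. z /\<^sub>R norm z \<in> ?N}"
  have "negligible {z :: 'n cspace. inner (axis i 1) z = 0}"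
    by (rule negligible_hyperplane) (simp add: axis_eq_0_iff)
  moreover have "?M \<subseteq> {z :: 'n cspace. inner (axis i 1) z = 0}"
    by (auto simp: inner_axis' inner_complex_def)
  ultimately have "negligible ?M" by (rule negligible_subset)
  then have null: "emeasure lebesgue ?M = 0"
    unfolding negligible_iff_null_sets by (rule null_setsD1)
  have "?M \<in> sets borel"
  proof -
    have "(\<lambda>z. z /\<^sub>R norm z) -` ?N \<in> sets borel"
      using measurable_sets_borel [OF measurable_radial_projection, of ?N] \<open>closed ?N\<close> by simp
    moreover have "?M = ball 0 1 \<inter> (\<lambda>z. z /\<^sub>R norm z) -` ?N" by auto
    ultimately show ?thesis by simp
  qed
  then have M: "?M \<in> sets lborel" by (simp only: sets_lborel)
  then have "emeasure lborel ?M = 0"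
    using emeasure_completion [OF sets_completionI_sets [OF M]] by (simp only: null main_part [OF M])
  then have "emeasure sphere_measure ?N = 0"
    by (simp only: emeasure_sphere_measure [OF N]) simp
  then show ?thesis
    using N by (intro AE_I [of _ _ ?N]) auto
qed

lemma monomial_nonzero_AE:
  "AE \<zeta> in (sphere_measure :: 'n::finite cspace measure). monomial \<alpha> \<zeta> \<noteq> 0"
proof -
  have "AE \<zeta> in (sphere_measure :: 'n cspace measure). \<forall>i\<in>UNIV. vec_nth \<zeta> i \<noteq> 0"
    by (intro AE_finite_allI null_coordinate_sphere) simp
  then show ?thesis
    by eventually_elim (simp add: monomial_def)
qed

definition monomial_mass :: "'n::finite multi_index \<Rightarrow> real" where
  "monomial_mass \<alpha> = sphere_norm2 (monomial \<alpha>)"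

lemma monomial_mass_pos: "0 < monomial_mass \<alpha>"
proof -
  have int: "integrable sphere_measure (\<lambda>\<zeta>. (cmod (monomial \<alpha> \<zeta>))\<^sup>2)"
    by (intro integrable_sphere_cont continuous_intros)
  have "monomial_mass \<alpha> \<noteq> 0"
  proof
    assume "monomial_mass \<alpha> = 0"
    then have "AE \<zeta> in sphere_measure. (cmod (monomial \<alpha> \<zeta>))\<^sup>2 = 0"
      using integral_nonneg_eq_0_iff_AE [OF int] by (simp add: monomial_mass_def sphere_norm2_def)
    then have "AE \<zeta> in (sphere_measure :: 'a cspace measure). False"
      using monomial_nonzero_AE [of \<alpha>] by eventually_elim simp
    then show False by simp
  qed
  then show ?thesis
    using sphere_norm2_nonneg [of "monomial \<alpha>"] by (simp add: monomial_mass_def)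
qed

lemma monomial_mass_nonneg [simp]: "0 \<le> monomial_mass \<alpha>"
  and monomial_mass_nonzero [simp]: "monomial_mass \<alpha> \<noteq> 0"
  using monomial_mass_pos [of \<alpha>] by auto

lemma sphere_norm2_sum_monomials:
  assumes "finite A"
  shows "sphere_norm2 (\<lambda>\<zeta>. \<Sum>\<alpha>\<in>A. c \<alpha> * monomial \<alpha> \<zeta>) = (\<Sum>\<alpha>\<in>A. (cmod (c \<alpha>))\<^sup>2 * monomial_mass \<alpha>)"
  unfolding monomial_mass_def
  by (rule sphere_norm2_orthogonal_sum [OF assms continuous_monomial monomial_orthogonal])

lemma sphere_norm2_unitary:
  assumes "unitary U" "continuous_on (sphere 0 1) f"
  shows "sphere_norm2 (\<lambda>z. f (U z)) = sphere_norm2 f"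
  unfolding sphere_norm2_def
  by (rule integral_sphere_unitary [OF assms(1)])
     (intro borel_measurable_sphere_cont continuous_intros assms(2))

text \<open>The reproducing kernel on the diagonal of the space of polynomials of degree at most \<open>n\<close>.\<close>

definition eval_norm2 :: "nat \<Rightarrow> 'n::finite cspace \<Rightarrow> real" where
  "eval_norm2 n z = (\<Sum>\<alpha> | mi_abs \<alpha> \<le> n. (cmod (monomial \<alpha> z))\<^sup>2 / monomial_mass \<alpha>)"

text \<open>The monomials are orthogonal, so this is the Cauchy--Schwarz inequality for the coefficients.\<close>

lemma eval_norm2_bound:
  assumes "poly_fun n f"
  shows "(cmod (f z))\<^sup>2 \<le> eval_norm2 n z * sphere_norm2 f"
proof -
  obtain c where c: "\<And>z. f z = (\<Sum>\<alpha> | mi_abs \<alpha> \<le> n. c \<alpha> * monomial \<alpha> z)"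
    using assms by (elim poly_funE) (rule that)
  let ?A = "{\<alpha> :: 'a multi_index. mi_abs \<alpha> \<le> n}"
  have "cmod (f z) \<le> (\<Sum>\<alpha>\<in>?A. cmod (c \<alpha>) * cmod (monomial \<alpha> z))"
    unfolding c by (rule order_trans [OF norm_sum]) (simp add: norm_mult)
  also have "\<dots> = (\<Sum>\<alpha>\<in>?A. (cmod (monomial \<alpha> z) / sqrt (monomial_mass \<alpha>)) * (cmod (c \<alpha>) * sqrt (monomial_mass \<alpha>)))"
    by (intro sum.cong refl) simp
  finally have "(cmod (f z))\<^sup>2 \<le> (\<Sum>\<alpha>\<in>?A. (cmod (monomial \<alpha> z) / sqrt (monomial_mass \<alpha>)) * (cmod (c \<alpha>) * sqrt (monomial_mass \<alpha>)))\<^sup>2"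
    by (rule power_mono) simp
  also have "\<dots> \<le> (\<Sum>\<alpha>\<in>?A. (cmod (monomial \<alpha> z) / sqrt (monomial_mass \<alpha>))\<^sup>2) * (\<Sum>\<alpha>\<in>?A. (cmod (c \<alpha>) * sqrt (monomial_mass \<alpha>))\<^sup>2)"
    by (rule Cauchy_Schwarz_ineq_sum)
  also have "\<dots> = eval_norm2 n z * (\<Sum>\<alpha>\<in>?A. (cmod (c \<alpha>))\<^sup>2 * monomial_mass \<alpha>)"
    by (simp add: eval_norm2_def power_divide power_mult_distrib)
  also have "(\<Sum>\<alpha>\<in>?A. (cmod (c \<alpha>))\<^sup>2 * monomial_mass \<alpha>) = sphere_norm2 f"
    by (simp add: c [abs_def] sphere_norm2_sum_monomials)
  finally show ?thesis .
qed

lemma eval_norm2_pos: "0 < eval_norm2 n z"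
  unfolding eval_norm2_def
  using monomial_mass_pos by (intro sum_pos2 [of _ 0]) (auto simp: less_imp_le)

text \<open>The kernel function at \<open>U z\<close> attains the bound; composed with \<open>U\<close> it competes at \<open>z\<close>.\<close>

lemma eval_norm2_unitary_le:
  assumes "unitary U"
  shows "eval_norm2 n (U z) \<le> eval_norm2 n z"
proof -
  let ?A = "{\<alpha> :: 'a multi_index. mi_abs \<alpha> \<le> n}"
  define c where "c \<alpha> = cnj (monomial \<alpha> (U z)) / of_real (monomial_mass \<alpha>)" for \<alpha>
  define F where "F w = (\<Sum>\<alpha>\<in>?A. c \<alpha> * monomial \<alpha> w)" for w
  have F: "poly_fun n F"
    unfolding poly_fun_def F_def by blast
  have "F (U z) = of_real (eval_norm2 n (U z))"
    unfolding F_def eval_norm2_def c_def of_real_sum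
    by (intro sum.cong refl) (simp only: of_real_divide complex_norm_square times_divide_eq_left mult.commute [of "cnj _"])
  then have FU: "(cmod (F (U z)))\<^sup>2 = (eval_norm2 n (U z))\<^sup>2"
    by simp
  have normF: "sphere_norm2 F = eval_norm2 n (U z)"
    unfolding F_def [abs_def] eval_norm2_def
    using monomial_mass_pos
    by (subst sphere_norm2_sum_monomials)
       (auto simp: c_def norm_divide power_divide power2_eq_square less_imp_neq [THEN not_sym] abs_of_pos intro!: sum.cong)
  have "(cmod (F (U z)))\<^sup>2 \<le> eval_norm2 n z * sphere_norm2 (\<lambda>w. F (U w))"
    by (rule eval_norm2_bound [where f = "\<lambda>w. F (U w)"]) (rule poly_fun_compose_unitary [OF assms F])
  also have "sphere_norm2 (\<lambda>w. F (U w)) = eval_norm2 n (U z)"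
    using sphere_norm2_unitary [OF assms continuous_on_poly_fun [OF F]] normF by simp
  finally show ?thesis
    using FU eval_norm2_pos [of n "U z"] by (simp add: power2_eq_square)
qed

lemma sum_power_mi_abs_le:
  fixes x :: real
  assumes "0 \<le> x" "x < 1"
  shows "(\<Sum>\<alpha> :: 'n::finite multi_index | mi_abs \<alpha> \<le> n. x ^ mi_abs \<alpha>) \<le> (1 / (1 - x)) ^ CARD('n)"
proof -
  let ?A = "{\<alpha> :: 'n multi_index. mi_abs \<alpha> \<le> n}"
  have "(\<Sum>\<alpha>\<in>?A. x ^ mi_abs \<alpha>) = (\<Sum>\<alpha>\<in>?A. \<Prod>i\<in>UNIV. x ^ vec_nth \<alpha> i)"
    by (simp add: mi_abs_def power_sum)
  also have "\<dots> = (\<Sum>h\<in>vec_nth ` ?A. \<Prod>i\<in>UNIV. x ^ h i)"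
    by (subst sum.reindex) (auto simp: inj_on_def vec_nth_inject)
  also have "\<dots> \<le> (\<Sum>h\<in>(UNIV :: 'n set) \<rightarrow>\<^sub>E {..n}. \<Prod>i\<in>UNIV. x ^ h i)"
    using assms by (intro sum_mono2 prod_nonneg vec_nth_mi_abs_le_subset) (auto simp: finite_PiE)
  also have "\<dots> = (\<Prod>i\<in>(UNIV :: 'n set). \<Sum>k\<le>n. x ^ k)"
    by (rule prod_sum_PiE [symmetric]) auto
  also have "\<dots> \<le> (\<Prod>i\<in>(UNIV :: 'n set). 1 / (1 - x))"
  proof (intro prod_mono conjI sum_nonneg)
    have "(\<Sum>k\<le>n. x ^ k) \<le> (\<Sum>k. x ^ k)"
      using assms by (intro sum_le_suminf summable_geometric) auto
    then show "(\<Sum>k\<le>n. x ^ k) \<le> 1 / (1 - x)"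
      using assms by (simp add: suminf_geometric)
  qed (use assms in auto)
  finally show ?thesis by simp
qed

lemma exists_unit_direction:
  obtains \<zeta> :: "'n::finite cspace" where "norm \<zeta> = 1" "z = norm z *\<^sub>R \<zeta>"
proof (cases "z = 0")
  case True
  have "norm (axis undefined 1 :: 'n cspace) = 1"
    by (rule norm_Basis) (auto simp: Basis_vec_def Basis_complex_def)
  then show ?thesis by (rule that) (simp add: True)
next
  case False
  then show ?thesis by (intro that [of "z /\<^sub>R norm z"]) auto
qed

text \<open>By unitary invariance the kernel is constant on every sphere, so it equals its mean there,
  and in the mean every monomial contributes only a power of the radius.\<close>

lemma eval_norm2_le:
  fixes z :: "'n::finite cspace"
  assumes "norm z < 1"
  shows "eval_norm2 n z \<le> (1 / (1 - (norm z)\<^sup>2)) ^ CARD('n)"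
proof -
  define r where "r = norm z"
  obtain \<zeta> where \<zeta>: "norm \<zeta> = 1" "z = r *\<^sub>R \<zeta>"
    unfolding r_def by (rule exists_unit_direction)
  let ?A = "{\<alpha> :: 'n multi_index. mi_abs \<alpha> \<le> n}"
  have le: "eval_norm2 n z \<le> eval_norm2 n (r *\<^sub>R \<eta>)" if "norm \<eta> = 1" for \<eta> :: "'n cspace"
  proof -
    have "norm (r *\<^sub>R \<eta>) = norm z" using that by (simp add: r_def)
    then obtain U where U: "unitary U" "U (r *\<^sub>R \<eta>) = z" by (rule unitary_transitive)
    then show ?thesis
      using eval_norm2_unitary_le [OF U(1), of n "r *\<^sub>R \<eta>"] by simp
  qed
  have cont: "continuous_on (sphere 0 1) (\<lambda>\<eta> :: 'n cspace. eval_norm2 n (r *\<^sub>R \<eta>))"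
    unfolding eval_norm2_def divide_inverse by (intro continuous_intros)
  have "eval_norm2 n z = (\<integral>\<eta>. eval_norm2 n z \<partial>(sphere_measure :: 'n cspace measure))"
    by (simp add: sphere.prob_space del: space_sphere_measure)
  also have "\<dots> \<le> (\<integral>\<eta>. eval_norm2 n (r *\<^sub>R \<eta>) \<partial>(sphere_measure :: 'n cspace measure))"
    using le by (intro integral_mono integrable_sphere_cont cont continuous_intros) auto
  also have "\<dots> = (\<Sum>\<alpha>\<in>?A. \<integral>\<eta>. (r\<^sup>2) ^ mi_abs \<alpha> / monomial_mass \<alpha> * (cmod (monomial \<alpha> \<eta>))\<^sup>2 \<partial>sphere_measure)"
    unfolding eval_norm2_def
  proof (subst Bochner_Integration.integral_sum)
    have eq: "(cmod (monomial \<alpha> (r *\<^sub>R \<eta>)))\<^sup>2 = (r\<^sup>2) ^ mi_abs \<alpha> * (cmod (monomial \<alpha> \<eta>))\<^sup>2" for \<alpha> \<eta>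
      using r_def by (simp add: scaleR_eq_smult monomial_scale norm_mult norm_power power_mult_distrib flip: power_mult)
        (simp add: mult.commute)
    show "integrable sphere_measure (\<lambda>\<eta>. (cmod (monomial \<alpha> (r *\<^sub>R \<eta>)))\<^sup>2 / monomial_mass \<alpha>)" for \<alpha>
      unfolding divide_inverse by (intro integrable_sphere_cont continuous_intros)
    show "(\<Sum>\<alpha>\<in>?A. \<integral>\<eta>. (cmod (monomial \<alpha> (r *\<^sub>R \<eta>)))\<^sup>2 / monomial_mass \<alpha> \<partial>sphere_measure) =
        (\<Sum>\<alpha>\<in>?A. \<integral>\<eta>. (r\<^sup>2) ^ mi_abs \<alpha> / monomial_mass \<alpha> * (cmod (monomial \<alpha> \<eta>))\<^sup>2 \<partial>sphere_measure)"
      by (simp only: eq times_divide_eq_left)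
  qed
  also have "\<dots> = (\<Sum>\<alpha>\<in>?A. (r\<^sup>2) ^ mi_abs \<alpha>)"
    by (intro sum.cong refl)
       (simp add: monomial_mass_def [unfolded sphere_norm2_def, symmetric])
  also have "\<dots> \<le> (1 / (1 - r\<^sup>2)) ^ CARD('n)"
    using assms by (intro sum_power_mi_abs_le) (auto simp: r_def abs_square_less_1)
  finally show ?thesis by (simp add: r_def)
qed

lemma point_evaluation_bound:
  fixes z :: "'n::finite cspace"
  assumes "poly_fun n f" "norm z < 1"
  shows "(cmod (f z))\<^sup>2 \<le> (1 / (1 - (norm z)\<^sup>2)) ^ CARD('n) * sphere_norm2 f"
  using eval_norm2_bound [OF assms(1), of z] eval_norm2_le [OF assms(2), of n] sphere_norm2_nonneg [of f]
  by (meson mult_right_mono order_trans)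

text \<open>
  The Poisson--Szego majorant: apply the evaluation bound to \<open>f\<close> times the Cauchy kernel
  \<open>(1 - \<langle>\<cdot>, z\<rangle>)\<^bsup>-d\<^esup>\<close>, approximated by powers of partial sums of the geometric series.
\<close>

lemma poisson_szego_bound:
  fixes z :: "'n::finite cspace"
  assumes f: "poly_fun n f" and z: "norm z < 1"
  shows "(cmod (f z))\<^sup>2 \<le>
    (\<integral>\<zeta>. (cmod (f \<zeta>))\<^sup>2 * ((1 - (norm z)\<^sup>2) / (cmod (1 - herm \<zeta> z))\<^sup>2) ^ CARD('n) \<partial>sphere_measure)"
proof -
  let ?d = "CARD('n)"
  define t where "t = 1 - (norm z)\<^sup>2"
  have t: "t > 0" using z by (simp add: t_def abs_square_less_1)
  define S where "S J w = (\<Sum>j<J. herm w z ^ j)" for J w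
  define F where "F J w = f w * S J w ^ ?d" for J w
  have polyF: "\<exists>m. poly_fun m (F J)" for J
  proof -
    have "poly_fun J (S J)"
      unfolding S_def
    proof (rule poly_fun_sum)
      fix j assume "j \<in> {..<J}"
      have "poly_fun (j * 1) (\<lambda>w. herm w z ^ j)"
        by (intro poly_fun_power poly_fun_herm)
      then show "poly_fun J (\<lambda>w. herm w z ^ j)"
        by (rule poly_fun_mono) (use \<open>j \<in> {..<J}\<close> in auto)
    qed
    then show ?thesis
      unfolding F_def using poly_fun_mult [OF f poly_fun_power] by blast
  qed
  have bound: "(cmod (F J z))\<^sup>2 \<le> (1 / t) ^ ?d * sphere_norm2 (F J)" for J
    using polyF [of J] point_evaluation_bound [OF _ z] by (auto simp: t_def)
  have lt: "cmod (herm w z) \<le> norm z" if "norm w \<le> 1" for w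
    using herm_Cauchy_Schwarz [of w z] that mult_right_mono [of "norm w" 1 "norm z"] by simp
  have lim: "(\<lambda>J. F J w) \<longlonglongrightarrow> f w * (1 / (1 - herm w z)) ^ ?d" if "norm w \<le> 1" for w
  proof -
    have "(\<lambda>j. herm w z ^ j) sums (1 / (1 - herm w z))"
      using lt [OF that] z by (intro geometric_sums) linarith
    then have "(\<lambda>J. S J w) \<longlonglongrightarrow> 1 / (1 - herm w z)"
      unfolding sums_def S_def .
    then show ?thesis
      unfolding F_def by (intro tendsto_intros)
  qed
  obtain B where B: "\<And>w. w \<in> sphere 0 1 \<Longrightarrow> cmod (f w) \<le> B"
    using continuous_on_compact_bound [OF compact_sphere continuous_on_poly_fun [OF f]] by blast
  have Sb: "cmod (S J w) \<le> 1 / (1 - norm z)" if "norm w \<le> 1" for J w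
  proof -
    have "cmod (S J w) \<le> (\<Sum>j<J. norm z ^ j)"
      unfolding S_def using lt [OF that]
      by (intro order_trans [OF norm_sum] sum_mono) (simp add: norm_power power_mono)
    also have "\<dots> \<le> (\<Sum>j. norm z ^ j)"
      using z by (intro sum_le_suminf summable_geometric) auto
    finally show ?thesis using z by (simp add: suminf_geometric)
  qed
  have "(\<lambda>J. sphere_norm2 (F J)) \<longlonglongrightarrow> (\<integral>\<zeta>. (cmod (f \<zeta> * (1 / (1 - herm \<zeta> z)) ^ ?d))\<^sup>2 \<partial>sphere_measure)"
    unfolding sphere_norm2_def
  proof (rule integral_dominated_convergence)
    show "AE \<zeta> in sphere_measure. (\<lambda>J. (cmod (F J \<zeta>))\<^sup>2) \<longlonglongrightarrow> (cmod (f \<zeta> * (1 / (1 - herm \<zeta> z)) ^ ?d))\<^sup>2"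
      by (intro AE_I2 tendsto_intros lim) auto
    show "AE \<zeta> in sphere_measure. norm ((cmod (F J \<zeta>))\<^sup>2) \<le> (B * (1 / (1 - norm z)) ^ ?d)\<^sup>2" for J
    proof (intro AE_I2)
      fix \<zeta> :: "'n cspace" assume "\<zeta> \<in> space sphere_measure"
      then have "norm \<zeta> = 1" by simp
      then have "cmod (F J \<zeta>) \<le> B * (1 / (1 - norm z)) ^ ?d"
        unfolding F_def norm_mult norm_power using B [of \<zeta>] Sb [of \<zeta> J]
        by (intro mult_mono power_mono) (auto intro: order_trans [OF norm_ge_zero])
      then show "norm ((cmod (F J \<zeta>))\<^sup>2) \<le> (B * (1 / (1 - norm z)) ^ ?d)\<^sup>2"
        by (simp add: power_mono)
    qed
    show "(\<lambda>\<zeta>. (cmod (F J \<zeta>))\<^sup>2) \<in> borel_measurable sphere_measure" for J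
    proof -
      obtain m where "poly_fun m (F J)" using polyF by blast
      then show ?thesis
        by (intro borel_measurable_sphere_cont continuous_intros continuous_on_poly_fun)
    qed
    have "1 - herm \<zeta> z \<noteq> 0" if "norm \<zeta> = 1" for \<zeta> :: "'n cspace"
      using lt [of \<zeta>] z that by auto
    then show "(\<lambda>\<zeta>. (cmod (f \<zeta> * (1 / (1 - herm \<zeta> z)) ^ ?d))\<^sup>2) \<in> borel_measurable sphere_measure"
      by (intro borel_measurable_sphere_cont continuous_intros continuous_on_poly_fun [OF f]) auto
  qed simp
  then have limR: "(\<lambda>J. (1 / t) ^ ?d * sphere_norm2 (F J)) \<longlonglongrightarrow>
      (1 / t) ^ ?d * (\<integral>\<zeta>. (cmod (f \<zeta> * (1 / (1 - herm \<zeta> z)) ^ ?d))\<^sup>2 \<partial>sphere_measure)"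
    by (intro tendsto_intros)
  have limL: "(\<lambda>J. (cmod (F J z))\<^sup>2) \<longlonglongrightarrow> (cmod (f z * (1 / (1 - herm z z)) ^ ?d))\<^sup>2"
    using z by (intro tendsto_intros lim) simp
  have "(cmod (f z * (1 / (1 - herm z z)) ^ ?d))\<^sup>2
      \<le> (1 / t) ^ ?d * (\<integral>\<zeta>. (cmod (f \<zeta> * (1 / (1 - herm \<zeta> z)) ^ ?d))\<^sup>2 \<partial>sphere_measure)"
    by (rule LIMSEQ_le [OF limL limR]) (use bound in auto)
  moreover have "cmod (f z * (1 / (1 - herm z z)) ^ ?d) = cmod (f z) * (1 / t) ^ ?d"
  proof -
    have "1 - herm z z = of_real t" by (simp add: herm_self t_def)
    then show ?thesis using t by (simp add: norm_mult norm_power norm_divide)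
  qed
  ultimately have "(1 / t) ^ ?d * ((1 / t) ^ ?d * (cmod (f z))\<^sup>2)
      \<le> (1 / t) ^ ?d * (\<integral>\<zeta>. (cmod (f \<zeta> * (1 / (1 - herm \<zeta> z)) ^ ?d))\<^sup>2 \<partial>sphere_measure)"
    by (simp add: power_mult_distrib power2_eq_square mult_ac)
  then have "(1 / t) ^ ?d * (cmod (f z))\<^sup>2
      \<le> (\<integral>\<zeta>. (cmod (f \<zeta> * (1 / (1 - herm \<zeta> z)) ^ ?d))\<^sup>2 \<partial>sphere_measure)"
    by (rule mult_left_le_imp_le) (use t in simp)
  then have "t ^ ?d * ((1 / t) ^ ?d * (cmod (f z))\<^sup>2)
      \<le> t ^ ?d * (\<integral>\<zeta>. (cmod (f \<zeta> * (1 / (1 - herm \<zeta> z)) ^ ?d))\<^sup>2 \<partial>sphere_measure)"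
    by (rule mult_left_mono) (use t in simp)
  also have "t ^ ?d * ((1 / t) ^ ?d * (cmod (f z))\<^sup>2) = (cmod (f z))\<^sup>2"
    using t by (simp add: power_one_over)
  also have "t ^ ?d * (\<integral>\<zeta>. (cmod (f \<zeta> * (1 / (1 - herm \<zeta> z)) ^ ?d))\<^sup>2 \<partial>sphere_measure)
      = (\<integral>\<zeta>. (cmod (f \<zeta>))\<^sup>2 * (t / (cmod (1 - herm \<zeta> z))\<^sup>2) ^ ?d \<partial>sphere_measure)"
    unfolding Bochner_Integration.integral_mult_right_zero [symmetric]
    by (intro Bochner_Integration.integral_cong refl)
       (simp add: norm_mult norm_power norm_divide power_mult_distrib power_divide power_mult [symmetric] mult.commute)
  finally show ?thesis by (simp add: t_def)
qed

section \<open>Anisotropic balls on the sphere\<close>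

definition aball :: "'n::finite cspace \<Rightarrow> real \<Rightarrow> 'n cspace set" where
  "aball \<zeta> \<rho> = {\<eta> \<in> sphere 0 1. cmod (1 - herm \<zeta> \<eta>) < \<rho>}"

lemma cmod_one_minus_herm_commute: "cmod (1 - herm a b) = cmod (1 - herm b a)"
  by (metis cnj_herm complex_cnj_diff complex_cnj_one complex_mod_cnj)

lemma sets_sphere_open_Int:
  "open S \<Longrightarrow> {\<eta> \<in> sphere 0 1. \<eta> \<in> S} \<in> sets sphere_measure"
  by (auto simp: sets_restrict_space image_iff intro!: bexI [of _ S])

lemma sets_aball [measurable]: "aball \<zeta> \<rho> \<in> sets sphere_measure"
proof -
  have "open {\<eta>. cmod (1 - herm \<zeta> \<eta>) < \<rho>}"
    by (intro open_Collect_less continuous_intros)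
  from sets_sphere_open_Int [OF this] show ?thesis by (simp add: aball_def)
qed

text \<open>The square root of the radius is a radius for a metric, and \<open>9 = 3\<^sup>2\<close>.\<close>

lemma aball_subset:
  assumes "norm a = 1" "norm b = 1" "\<rho> \<le> \<rho>'" "aball a \<rho> \<inter> aball b \<rho>' \<noteq> {}"
  shows "aball a \<rho> \<subseteq> aball b (9 * \<rho>')"
proof
  fix \<eta> assume \<eta>: "\<eta> \<in> aball a \<rho>"
  obtain \<xi> where \<xi>: "\<xi> \<in> aball a \<rho>" "\<xi> \<in> aball b \<rho>'" using assms(4) by blast
  have n: "norm \<eta> = 1" "norm \<xi> = 1" using \<eta> \<xi> by (auto simp: aball_def)
  have 1: "sqrt (cmod (1 - herm a \<eta>)) < sqrt \<rho>'" "sqrt (cmod (1 - herm \<xi> a)) < sqrt \<rho>'"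
    "sqrt (cmod (1 - herm b \<xi>)) < sqrt \<rho>'"
    using \<eta> \<xi> assms(3) by (auto simp: aball_def cmod_one_minus_herm_commute [of \<xi> a])
  have "sqrt (cmod (1 - herm b \<eta>)) \<le> sqrt (cmod (1 - herm b \<xi>)) + sqrt (cmod (1 - herm \<xi> \<eta>))"
    by (rule anisotropic_triangle) (use assms n in auto)
  also have "sqrt (cmod (1 - herm \<xi> \<eta>)) \<le> sqrt (cmod (1 - herm \<xi> a)) + sqrt (cmod (1 - herm a \<eta>))"
    by (rule anisotropic_triangle) (use assms n in auto)
  finally have "sqrt (cmod (1 - herm b \<eta>)) < 3 * sqrt \<rho>'"
    using 1 by linarith
  also have "\<dots> = sqrt (9 * \<rho>')"
    by (simp add: real_sqrt_mult)
  finally show "\<eta> \<in> aball b (9 * \<rho>')"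
    using n by (simp add: aball_def)
qed

text \<open>Choose a ball of largest radius, discard all balls that meet it, and repeat.\<close>

lemma anisotropic_vitali:
  fixes \<zeta> :: "'i \<Rightarrow> 'n::finite cspace"
  assumes "finite J" "\<And>i. i \<in> J \<Longrightarrow> norm (\<zeta> i) = 1"
  shows "\<exists>I\<subseteq>J. disjoint_family_on (\<lambda>i. aball (\<zeta> i) (\<rho> i)) I \<and>
    (\<Union>i\<in>J. aball (\<zeta> i) (\<rho> i)) \<subseteq> (\<Union>i\<in>I. aball (\<zeta> i) (9 * \<rho> i))"
  using assms
proof (induction J rule: finite_psubset_induct)
  case (psubset J)
  show ?case
  proof (cases "J = {}")
    case False
    have "Max (\<rho> ` J) \<in> \<rho> ` J" using False psubset.hyps by (intro Max_in) auto
    then obtain j where j: "j \<in> J" "\<rho> j = Max (\<rho> ` J)" by auto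
    have max: "\<rho> i \<le> \<rho> j" if "i \<in> J" for i
      using that psubset.hyps by (simp add: j)
    define J' where "J' = {i\<in>J. i \<noteq> j \<and> aball (\<zeta> i) (\<rho> i) \<inter> aball (\<zeta> j) (\<rho> j) = {}}"
    have "J' \<subset> J" using j by (auto simp: J'_def)
    then have "\<exists>I\<subseteq>J'. disjoint_family_on (\<lambda>i. aball (\<zeta> i) (\<rho> i)) I \<and>
      (\<Union>i\<in>J'. aball (\<zeta> i) (\<rho> i)) \<subseteq> (\<Union>i\<in>I. aball (\<zeta> i) (9 * \<rho> i))"
      by (rule psubset.IH) (use psubset.prems in \<open>simp add: J'_def\<close>)
    then obtain I where I: "I \<subseteq> J'" "disjoint_family_on (\<lambda>i. aball (\<zeta> i) (\<rho> i)) I"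
      "(\<Union>i\<in>J'. aball (\<zeta> i) (\<rho> i)) \<subseteq> (\<Union>i\<in>I. aball (\<zeta> i) (9 * \<rho> i))"
      by (elim exE conjE) (rule that)
    show ?thesis
    proof (intro exI [of _ "insert j I"] conjI)
      show "insert j I \<subseteq> J" using I j by (auto simp: J'_def)
      show "disjoint_family_on (\<lambda>i. aball (\<zeta> i) (\<rho> i)) (insert j I)"
        using I(1,2) unfolding disjoint_family_on_def J'_def by blast
      show "(\<Union>i\<in>J. aball (\<zeta> i) (\<rho> i)) \<subseteq> (\<Union>i\<in>insert j I. aball (\<zeta> i) (9 * \<rho> i))"
      proof (rule UN_least)
        fix i assume i: "i \<in> J"
        show "aball (\<zeta> i) (\<rho> i) \<subseteq> (\<Union>i\<in>insert j I. aball (\<zeta> i) (9 * \<rho> i))"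
        proof (cases "i \<in> J'")
          case True then show ?thesis using I(3) by blast
        next
          case False
          have "aball (\<zeta> i) (\<rho> i) \<subseteq> aball (\<zeta> j) (9 * \<rho> j)"
          proof (cases "aball (\<zeta> i) (\<rho> i) = {}")
            case False
            with \<open>i \<notin> J'\<close> i have "aball (\<zeta> i) (\<rho> i) \<inter> aball (\<zeta> j) (\<rho> j) \<noteq> {}"
              by (auto simp: J'_def)
            then show ?thesis
              using psubset.prems i j(1) max by (intro aball_subset) auto
          qed simp
          then show ?thesis by blast
        qed
      qed
    qed
  qed (simp add: disjoint_family_on_def)
qed

lemma cart_box_measure:
  fixes c :: "'n::finite cspace" and r :: "'n \<Rightarrow> real"
  assumes "\<And>i. 0 \<le> r i"
  defines "B \<equiv> {z. \<forall>i. \<bar>Re (vec_nth z i - vec_nth c i)\<bar> \<le> r i \<and> \<bar>Im (vec_nth z i - vec_nth c i)\<bar> \<le> r i}"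
  shows "B \<in> lmeasurable" "measure lebesgue B = (\<Prod>i\<in>UNIV. (2 * r i)\<^sup>2)"
proof -
  define R :: "'n cspace" where "R = vec_lambda (\<lambda>i. Complex (r i) (r i))"
  have Basis: "(Basis :: 'n cspace set) = (\<lambda>(i, u). axis i u) ` (UNIV \<times> {1, \<i>})"
    by (auto simp: Basis_vec_def Basis_complex_def)
  have inj: "inj_on (\<lambda>(i, u). axis i u :: 'n cspace) (UNIV \<times> {1, \<i>})"
    by (auto simp: inj_on_def axis_eq_axis)
  have inner: "inner z (axis i u) = inner (vec_nth z i) u" for z :: "'n cspace" and i u
    by (simp add: inner_axis)
  have eq: "B = cbox (c - R) (c + R)"
  proof -
    have "z \<in> B \<longleftrightarrow> z \<in> cbox (c - R) (c + R)" for z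
      unfolding B_def mem_box Basis
      by (auto simp: inner R_def inner_complex_def abs_le_iff algebra_simps)
    then show ?thesis by blast
  qed
  show "B \<in> lmeasurable" unfolding eq by simp
  have "measure lebesgue B = measure lborel (cbox (c - R) (c + R))"
    unfolding eq by (rule measure_completion) simp
  also have "\<dots> = (\<Prod>b\<in>Basis. inner (c + R) b - inner (c - R) b)"
    by (rule content_cbox') (use assms(1) in \<open>auto simp: box_ne_empty Basis inner R_def inner_complex_def\<close>)
  also have "\<dots> = (\<Prod>b\<in>Basis. inner (c + R - (c - R)) b)"
    by (simp only: inner_diff_left)
  also have "\<dots> = (\<Prod>(i, u)\<in>UNIV \<times> {1, \<i>}. inner (vec_nth (2 *\<^sub>R R) i) u)"
    unfolding Basis by (subst prod.reindex [OF inj]) (auto simp: case_prod_unfold inner scaleR_2 intro!: prod.cong)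
  also have "\<dots> = (\<Prod>i\<in>UNIV. \<Prod>u\<in>{1, \<i>}. inner (vec_nth (2 *\<^sub>R R) i) u)"
    by (rule prod.cartesian_product [symmetric])
  also have "\<dots> = (\<Prod>i\<in>UNIV. (2 * r i)\<^sup>2)"
    by (intro prod.cong refl) (simp add: R_def inner_complex_def power2_eq_square complex_eq_iff)
  finally show "measure lebesgue B = (\<Prod>i\<in>UNIV. (2 * r i)\<^sup>2)" .
qed

lemma emeasure_lborel_eq_measure_lebesgue:
  assumes "A \<in> sets borel" "A \<in> lmeasurable"
  shows "emeasure lborel A = ennreal (measure lebesgue A)"
proof -
  have A: "A \<in> sets lborel" using assms(1) by (simp only: sets_lborel)
  have "emeasure lborel A = emeasure lebesgue A"
    using emeasure_completion [OF sets_completionI_sets [OF A]] by (simp only: main_part [OF A])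
  then show ?thesis
    using emeasure_eq_measure2 [OF assms(2)] by (simp only:)
qed

lemma measure_aball_unitary:
  fixes a b :: "'n::finite cspace"
  assumes "norm a = 1" "norm b = 1"
  shows "measure sphere_measure (aball a \<rho>) = measure sphere_measure (aball b \<rho>)"
proof -
  have "norm a = norm b" using assms by simp
  then obtain U where U: "unitary U" "U a = b" by (rule unitary_transitive)
  have nU: "norm (U x) = norm x" for x
    using unitary_imp_orthogonal [OF U(1)] by (simp add: orthogonal_transformation)
  have "measure sphere_measure (aball b \<rho>) = measure (distr sphere_measure sphere_measure U) (aball b \<rho>)"
    by (simp add: sphere_measure_rotation_invariant [OF unitary_imp_orthogonal [OF U(1)]])
  also have "\<dots> = measure sphere_measure (U -` aball b \<rho> \<inter> space sphere_measure)"
    by (rule measure_distr [OF measurable_unitary_sphere [OF U(1)] sets_aball])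
  also have "U -` aball b \<rho> \<inter> space sphere_measure = aball a \<rho>"
    using U by (auto simp: aball_def nU unitary_def)
  finally show ?thesis ..
qed

text \<open>
  An anisotropic ball of radius \<open>\<rho>\<close> has measure at most of order \<open>\<rho>\<^sup>d\<close>: the part of the cone over it with
  \<open>1 - \<rho> \<le> \<bar>z\<bar> < 1\<close> lies in a box with one complex side of order \<open>\<rho>\<close> and \<open>d - 1\<close> complex sides of
  order \<open>\<surd>\<rho>\<close>, and it makes up at least the fraction \<open>\<rho>\<close> of the cone by homogeneity.
\<close>

lemma measure_aball_le:
  "\<exists>C>0. \<forall>\<zeta> :: 'n::finite cspace. \<forall>\<rho>>0. norm \<zeta> = 1 \<longrightarrow>
    measure sphere_measure (aball \<zeta> \<rho>) \<le> C * \<rho> ^ CARD('n)"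
proof -
  let ?d = "CARD('n)"
  let ?vol = "measure lebesgue (ball (0 :: 'n cspace) 1)"
  have vol: "?vol > 0" by (simp add: content_ball_pos)
  define i0 :: 'n where "i0 = undefined"
  define e :: "'n cspace" where "e = axis i0 1"
  have e: "norm e = 1"
    unfolding e_def by (rule norm_Basis) (auto simp: Basis_vec_def Basis_complex_def)
  have herm_e: "herm e \<eta> = cnj (vec_nth \<eta> i0)" for \<eta>
  proof -
    have "herm e \<eta> = (\<Sum>i\<in>UNIV. if i = i0 then cnj (vec_nth \<eta> i) else 0)"
      unfolding herm_def e_def by (intro sum.cong refl) (simp add: axis_def)
    then show ?thesis by simp
  qed
  have main: "measure sphere_measure (aball e \<rho>) \<le> (16 ^ ?d / ?vol) * \<rho> ^ ?d" if \<rho>: "0 < \<rho>" "\<rho> < 1" for \<rho>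
  proof -
    define s where "s = 1 - \<rho>"
    have s: "0 < s" "s < 1" using \<rho> by (auto simp: s_def)
    define A where "A = {z \<in> ball 0 1. z /\<^sub>R norm z \<in> aball e \<rho>}"
    have A0: "0 \<notin> A" by (auto simp: A_def aball_def)
    have A_borel: "A \<in> sets borel"
    proof -
      have "aball e \<rho> \<in> sets borel"
        using sets_aball [of e \<rho>] by (simp only: sets_sphere_measure) (auto simp: sets_restrict_space_iff)
      then have "(\<lambda>z. z /\<^sub>R norm z) -` aball e \<rho> \<in> sets borel"
        using measurable_sets_borel [OF measurable_radial_projection] by blast
      moreover have "A = ball 0 1 \<inter> (\<lambda>z. z /\<^sub>R norm z) -` aball e \<rho>" by (auto simp: A_def)
      ultimately show ?thesis by simp
    qed
    have A: "A \<in> lmeasurable"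
    proof (rule bounded_set_imp_lmeasurable)
      show "bounded A" by (rule bounded_subset [OF bounded_ball [of 0 1]]) (auto simp: A_def)
    qed (use A_borel in simp)
    define A' where "A' = (\<lambda>z. s *\<^sub>R z + 0) ` A"
    have mA': "measure lebesgue A' = s ^ DIM('n cspace) * measure lebesgue A"
      unfolding A'_def measure_lebesgue_affine using s by simp
    have A'_iff: "z \<in> A' \<longleftrightarrow> z /\<^sub>R s \<in> A" for z
      unfolding A'_def using s by (auto simp: image_iff intro!: bexI [of _ "z /\<^sub>R s"])
    have A'_eq: "z \<in> A' \<longleftrightarrow> norm z < s \<and> z /\<^sub>R norm z \<in> aball e \<rho>" for z
      unfolding A'_iff A_def using s
      by (auto simp: dist_norm field_simps)
    have A'_borel: "A' \<in> sets lebesgue"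
    proof -
      have "A' = ball 0 s \<inter> A" using s by (auto simp: A'_eq A_def)
      then show ?thesis using A_borel by simp
    qed
    have sub: "A' \<subseteq> A" using s by (auto simp: A'_eq A_def)
    define r where "r i = (if i = i0 then 2 * \<rho> else 2 * sqrt \<rho>)" for i
    have r: "0 \<le> r i" for i using \<rho> by (simp add: r_def)
    let ?B = "{z. \<forall>i. \<bar>Re (vec_nth z i - vec_nth e i)\<bar> \<le> r i \<and> \<bar>Im (vec_nth z i - vec_nth e i)\<bar> \<le> r i}"
    have shell: "A - A' \<subseteq> ?B"
    proof
      fix z assume z: "z \<in> A - A'"
      define \<eta> where "\<eta> = z /\<^sub>R norm z"
      have \<eta>: "\<eta> \<in> aball e \<rho>" and nz: "norm z < 1" "s \<le> norm z" and z0: "norm z > 0"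
        using z s by (auto simp: A_def A'_eq \<eta>_def)
      have z_eq: "vec_nth z i = norm z *\<^sub>R vec_nth \<eta> i" for i
        using z0 by (simp add: \<eta>_def)
      have n\<eta>: "norm \<eta> = 1" using \<eta> by (simp add: aball_def)
      have "cnj (1 - vec_nth \<eta> i0) = 1 - herm e \<eta>" by (simp add: herm_e)
      then have \<eta>1: "cmod (1 - vec_nth \<eta> i0) < \<rho>"
        using \<eta> complex_mod_cnj [of "1 - vec_nth \<eta> i0"] by (simp add: aball_def)
      have sum1: "(\<Sum>i\<in>UNIV. (cmod (vec_nth \<eta> i))\<^sup>2) = 1"
        using n\<eta> by (simp add: norm_vec_def L2_set_def)
      have bound: "cmod (vec_nth z i - vec_nth e i) \<le> r i" for i
      proof (cases "i = i0")
        case True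
        have le1: "cmod (vec_nth \<eta> i0) \<le> 1"
          using Finite_Cartesian_Product.norm_nth_le [of \<eta> i0] n\<eta> by simp
        have "vec_nth z i - vec_nth e i = (norm z - 1) *\<^sub>R vec_nth \<eta> i0 + (vec_nth \<eta> i0 - 1)"
          by (simp add: True z_eq e_def axis_def algebra_simps)
        then have "cmod (vec_nth z i - vec_nth e i) \<le> \<bar>norm z - 1\<bar> * cmod (vec_nth \<eta> i0) + cmod (vec_nth \<eta> i0 - 1)"
          by (metis norm_scaleR norm_triangle_ineq)
        also have "\<bar>norm z - 1\<bar> * cmod (vec_nth \<eta> i0) \<le> \<bar>norm z - 1\<bar>"
          using le1 by (simp add: mult_left_le)
        also have "\<bar>norm z - 1\<bar> \<le> \<rho>" using nz by (simp add: s_def)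
        also have "cmod (vec_nth \<eta> i0 - 1) \<le> \<rho>" using \<eta>1 by (simp add: norm_minus_commute)
        finally show ?thesis by (simp add: r_def True)
      next
        case False
        have "cmod (vec_nth z i - vec_nth e i) = norm z * cmod (vec_nth \<eta> i)"
          using False by (simp add: z_eq e_def axis_def)
        also have "\<dots> \<le> cmod (vec_nth \<eta> i)"
          using nz by (intro mult_left_le_one_le) auto
        also have "\<dots> \<le> 2 * sqrt \<rho>"
        proof -
          have "(\<Sum>j\<in>{i, i0}. (cmod (vec_nth \<eta> j))\<^sup>2) \<le> 1"
            unfolding sum1 [symmetric] by (rule sum_mono2) auto
          then have "(cmod (vec_nth \<eta> i))\<^sup>2 \<le> 1 - (cmod (vec_nth \<eta> i0))\<^sup>2"
            using False by simp
          also have "\<dots> = (1 - cmod (vec_nth \<eta> i0)) * (1 + cmod (vec_nth \<eta> i0))"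
            by (simp add: power2_eq_square algebra_simps)
          also have "\<dots> \<le> \<rho> * 2"
          proof (intro mult_mono)
            show "1 - cmod (vec_nth \<eta> i0) \<le> \<rho>"
              using \<eta>1 norm_triangle_ineq2 [of 1 "vec_nth \<eta> i0"] by simp
            show "1 + cmod (vec_nth \<eta> i0) \<le> 2"
              using Finite_Cartesian_Product.norm_nth_le [of \<eta> i0] n\<eta> by simp
          qed (use \<rho> in auto)
          also have "\<dots> \<le> (2 * sqrt \<rho>)\<^sup>2" using \<rho> by (simp add: power_mult_distrib)
          finally show ?thesis by (rule power2_le_imp_le) (use \<rho> in simp)
        qed
        finally show ?thesis using False by (simp add: r_def)
      qed
      have "\<bar>Re (vec_nth z i - vec_nth e i)\<bar> \<le> r i \<and> \<bar>Im (vec_nth z i - vec_nth e i)\<bar> \<le> r i" for i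
        using bound [of i] abs_Re_le_cmod [of "vec_nth z i - vec_nth e i"]
          abs_Im_le_cmod [of "vec_nth z i - vec_nth e i"] by linarith
      then show "z \<in> ?B" by blast
    qed
    \<comment> \<open>The shell \<open>A - A'\<close> makes up the fraction \<open>1 - s\<^bsup>2 d\<^esup> \<ge> \<rho>\<close> of the cone.\<close>
    have "\<rho> * measure lebesgue A \<le> (1 - s ^ DIM('n cspace)) * measure lebesgue A"
    proof -
      have "s ^ DIM('n cspace) \<le> s ^ 1"
        using s DIM_positive [where 'a = "'n cspace"] by (intro power_decreasing) linarith+
      then show ?thesis by (intro mult_right_mono) (auto simp: s_def)
    qed
    also have "\<dots> = measure lebesgue A - measure lebesgue A'"
      by (simp add: mA' algebra_simps)
    also have "\<dots> = measure lebesgue (A - A')"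
      using A A'_borel sub by (intro measurable_measure_Diff [symmetric]) (auto simp: fmeasurableD)
    also have "\<dots> \<le> measure lebesgue ?B"
      using A A'_borel r shell by (intro measure_mono_fmeasurable cart_box_measure) (auto simp: fmeasurableD)
    also have "\<dots> = (\<Prod>i\<in>UNIV. (2 * r i)\<^sup>2)"
      by (rule cart_box_measure) (rule r)
    also have "\<dots> = (2 * r i0)\<^sup>2 * (\<Prod>i\<in>UNIV - {i0}. (2 * r i)\<^sup>2)"
      by (rule prod.remove) auto
    also have "(\<Prod>i\<in>UNIV - {i0}. (2 * r i)\<^sup>2) = (16 * \<rho>) ^ (?d - 1)"
      using \<rho> by (simp add: r_def power_mult_distrib card_Diff_singleton)
    also have "(2 * r i0)\<^sup>2 * (16 * \<rho>) ^ (?d - 1) = \<rho> * (16 * \<rho>) ^ ?d"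
    proof -
      have "?d = Suc (?d - 1)" by simp
      then have "(16 * \<rho>) ^ ?d = 16 * \<rho> * (16 * \<rho>) ^ (?d - 1)" by (metis power_Suc)
      then show ?thesis by (simp add: r_def power2_eq_square)
    qed
    finally have mA: "measure lebesgue A \<le> (16 * \<rho>) ^ ?d"
      using \<rho> by (simp add: mult_le_cancel_left_pos)
    have "emeasure sphere_measure (aball e \<rho>) = emeasure lborel A / emeasure lborel (ball (0 :: 'n cspace) 1)"
      unfolding A_def by (rule emeasure_sphere_measure) (rule sets_aball)
    also have "emeasure lborel A = ennreal (measure lebesgue A)"
      using A_borel A by (rule emeasure_lborel_eq_measure_lebesgue)
    also have "emeasure lborel (ball (0 :: 'n cspace) 1) = ennreal ?vol"
      by (rule emeasure_lborel_eq_measure_lebesgue) auto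
    also have "ennreal (measure lebesgue A) / ennreal ?vol = ennreal (measure lebesgue A / ?vol)"
      using vol by (simp add: divide_ennreal)
    finally have "measure sphere_measure (aball e \<rho>) = measure lebesgue A / ?vol"
      using vol by (simp add: measure_def)
    also have "\<dots> \<le> (16 * \<rho>) ^ ?d / ?vol"
      using mA vol by (simp add: divide_right_mono)
    finally show ?thesis by (simp add: power_mult_distrib)
  qed
  show ?thesis
  proof (intro exI conjI allI impI)
    \<comment> \<open>The constant is at least \<open>1\<close> so that radii \<open>\<rho> \<ge> 1\<close> are covered by the total mass.\<close>
    show "max 1 (16 ^ ?d / ?vol) > 0" by simp
    fix \<zeta> :: "'n cspace" and \<rho> :: real assume \<rho>: "0 < \<rho>" and \<zeta>: "norm \<zeta> = 1"
    show "measure sphere_measure (aball \<zeta> \<rho>) \<le> max 1 (16 ^ ?d / ?vol) * \<rho> ^ ?d"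
    proof (cases "\<rho> < 1")
      case True
      then have "measure sphere_measure (aball \<zeta> \<rho>) \<le> (16 ^ ?d / ?vol) * \<rho> ^ ?d"
        using main \<rho> measure_aball_unitary [OF \<zeta> e] by metis
      also have "\<dots> \<le> max 1 (16 ^ ?d / ?vol) * \<rho> ^ ?d"
        using \<rho> by (intro mult_right_mono) auto
      finally show ?thesis .
    next
      case False
      have "measure sphere_measure (aball \<zeta> \<rho>) \<le> 1 * 1" by simp
      also have "\<dots> \<le> max 1 (16 ^ ?d / ?vol) * \<rho> ^ ?d"
        using False by (intro mult_mono) (auto intro: one_le_power)
      finally show ?thesis .
    qed
  qed
qed

section \<open>The maximal inequality over Koranyi regions\<close>

lemma one_minus_norm_le_herm:
  assumes "norm \<eta> \<le> 1"
  shows "1 - norm z \<le> cmod (1 - herm \<eta> z)"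
proof -
  have "cmod (herm \<eta> z) \<le> norm z"
    using herm_Cauchy_Schwarz [of \<eta> z] mult_right_mono [OF assms, of "norm z"] by simp
  then show ?thesis using norm_triangle_ineq2 [of 1 "herm \<eta> z"] by simp
qed

text \<open>Moving an interior point radially to the sphere at most doubles its anisotropic distance
  from a boundary point.\<close>

lemma herm_direction_le:
  assumes "norm \<eta> = 1" "norm \<zeta> = 1" "z = norm z *\<^sub>R \<zeta>" "norm z \<le> 1"
  shows "cmod (1 - herm \<zeta> \<eta>) \<le> 2 * cmod (1 - herm \<eta> z)"
proof -
  have "herm \<eta> z = of_real (norm z) * herm \<eta> \<zeta>"
    by (subst assms(3)) (simp only: herm_scaleR_right)
  then have "1 - herm \<eta> \<zeta> = (1 - herm \<eta> z) + of_real (norm z - 1) * herm \<eta> \<zeta>"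
    by (simp add: algebra_simps)
  then have "cmod (1 - herm \<eta> \<zeta>) \<le> cmod (1 - herm \<eta> z) + cmod (of_real (norm z - 1) * herm \<eta> \<zeta>)"
    by (simp only: norm_triangle_ineq)
  also have "cmod (of_real (norm z - 1) * herm \<eta> \<zeta>) = (1 - norm z) * cmod (herm \<eta> \<zeta>)"
    unfolding norm_mult norm_of_real using assms(4) by (simp add: abs_of_nonpos)
  also have "\<dots> \<le> (1 - norm z) * 1"
    using herm_Cauchy_Schwarz [of \<eta> \<zeta>] assms by (intro mult_left_mono) simp_all
  also have "\<dots> \<le> cmod (1 - herm \<eta> z)"
    using one_minus_norm_le_herm [of \<eta> z] assms by simp
  finally show ?thesis by (simp add: cmod_one_minus_herm_commute [of \<zeta>])
qed

declare sets_aball [simplified, simp]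

lemma integrable_poly_fun_indicator:
  assumes "poly_fun n f"
  shows "integrable sphere_measure (\<lambda>\<eta>. indicator (aball \<zeta> \<rho>) \<eta> * (cmod (f \<eta>))\<^sup>2)"
proof -
  have "integrable sphere_measure (\<lambda>\<eta>. (cmod (f \<eta>))\<^sup>2 * indicator (aball \<zeta> \<rho>) \<eta>)"
    by (intro integrable_real_mult_indicator sets_aball
          integrable_sphere_cont continuous_intros continuous_on_poly_fun [OF assms])
  then show ?thesis by (simp add: mult.commute)
qed

text \<open>
  The Poisson--Szego kernel at \<open>z\<close> is dominated by a geometrically decaying sum of normalised
  indicators of dyadic anisotropic balls around the direction of \<open>z\<close>, so a large value at \<open>z\<close>
  forces a large mean over one of these balls.
\<close>

lemma exists_heavy_aball:
  fixes z :: "'n::finite cspace"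
  assumes f: "poly_fun n f" and z: "norm z < 1" "norm \<zeta> = 1" "z = norm z *\<^sub>R \<zeta>"
    and c: "1 < c" and \<tau>: "0 < \<tau>" "\<tau> < cmod (f z)"
  shows "\<exists>k. \<tau>\<^sup>2 * (2 ^ k * c * (1 - (norm z)\<^sup>2)) ^ CARD('n) \<le>
    2 * (16 * c) ^ CARD('n) *
      (\<integral>\<eta>. indicator (aball \<zeta> (2 ^ k * c * (1 - (norm z)\<^sup>2))) \<eta> * (cmod (f \<eta>))\<^sup>2 \<partial>sphere_measure)"
proof (rule ccontr)
  let ?d = "CARD('n)"
  define t where "t = 1 - (norm z)\<^sup>2"
  define \<rho> where "\<rho> k = 2 ^ k * c * t" for k :: nat
  define I where "I k = (\<integral>\<eta>. indicator (aball \<zeta> (\<rho> k)) \<eta> * (cmod (f \<eta>))\<^sup>2 \<partial>sphere_measure)" for k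
  assume "\<not> ?thesis"
  then have small: "2 * (16 * c) ^ ?d * I k < \<tau>\<^sup>2 * \<rho> k ^ ?d" for k
    by (simp add: I_def \<rho>_def t_def not_le)
  have t: "0 < t" using z by (simp add: t_def abs_square_less_1)
  have ct: "0 < c * t" using c t by simp
  have t_le: "t \<le> 2 * (1 - norm z)"
  proof -
    have "t = (1 + norm z) * (1 - norm z)" by (simp add: t_def power2_eq_square algebra_simps)
    also have "\<dots> \<le> 2 * (1 - norm z)" using z by (intro mult_right_mono) auto
    finally show ?thesis .
  qed
  obtain K where K: "2 < 2 ^ K * (c * t)"
  proof -
    obtain K where "2 / (c * t) < (2::real) ^ K" using real_arch_pow [of 2 "2 / (c * t)"] by auto
    then show thesis using ct that by (simp add: divide_less_eq mult.commute)
  qed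
  have in_K: "\<eta> \<in> aball \<zeta> (\<rho> K)" if "norm \<eta> = 1" for \<eta>
  proof -
    have "cmod (1 - herm \<zeta> \<eta>) \<le> 1 + cmod (herm \<zeta> \<eta>)"
      using norm_triangle_ineq4 [of 1 "herm \<zeta> \<eta>"] by simp
    also have "\<dots> \<le> 2" using herm_Cauchy_Schwarz [of \<zeta> \<eta>] that z by simp
    finally show ?thesis using K that by (simp add: aball_def \<rho>_def mult.assoc)
  qed
  define P where "P \<eta> = (t / (cmod (1 - herm \<eta> z))\<^sup>2) ^ ?d" for \<eta>
  have kernel: "P \<eta> \<le> (\<Sum>k\<le>K. (16 / (t * 4 ^ k)) ^ ?d * indicator (aball \<zeta> (\<rho> k)) \<eta>)"
    if \<eta>: "norm \<eta> = 1" for \<eta>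
  proof -
    define B where "B = cmod (1 - herm \<eta> z)"
    \<comment> \<open>At \<open>\<eta>\<close> the summand of the smallest ball containing \<open>\<eta>\<close> already dominates: \<open>\<eta>\<close> is outside the ball before it.\<close>
    define k where "k = (LEAST k. \<eta> \<in> aball \<zeta> (\<rho> k))"
    have k: "\<eta> \<in> aball \<zeta> (\<rho> k)"
      unfolding k_def using in_K [OF \<eta>] by (rule LeastI)
    have "k \<le> K"
      unfolding k_def using in_K [OF \<eta>] by (rule Least_le)
    have "1 - norm z \<le> B"
      unfolding B_def using \<eta> by (intro one_minus_norm_le_herm) simp
    then have "2 * (1 - norm z) \<le> 2 * B" by simp
    with t_le have tB: "t \<le> 2 * B" by (rule order_trans)
    have B: "0 < B" using tB t by linarith
    have "t * 2 ^ k \<le> 4 * B"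
    proof (cases k)
      case 0
      then show ?thesis using tB B by simp
    next
      case (Suc j)
      then have "\<eta> \<notin> aball \<zeta> (\<rho> j)"
        unfolding k_def using not_less_Least by (metis lessI)
      then have "\<rho> j \<le> cmod (1 - herm \<zeta> \<eta>)" using \<eta> by (simp add: aball_def)
      also have "\<dots> \<le> 2 * B"
        unfolding B_def using \<eta> z by (intro herm_direction_le) auto
      finally have "2 ^ j * c * t \<le> 2 * B" by (simp add: \<rho>_def)
      then have "2 * (2 ^ j * c * t) \<le> 4 * B" by linarith
      moreover have "t * 2 ^ k \<le> 2 * (2 ^ j * c * t)"
        using c t mult_right_mono [of 1 c "t * 2 ^ j"] by (simp add: Suc mult_ac)
      ultimately show ?thesis by (rule order_trans [rotated])
    qed
    then have "(t * 2 ^ k)\<^sup>2 \<le> (4 * B)\<^sup>2"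
      using t by (intro power_mono) auto
    then have "t * (t * 4 ^ k) \<le> 16 * B\<^sup>2"
      by (simp add: power_mult_distrib power2_eq_square mult_ac flip: power_mult_distrib)
    then have "t / B\<^sup>2 \<le> 16 / (t * 4 ^ k)"
      using B t by (simp add: field_simps)
    then have "P \<eta> \<le> (16 / (t * 4 ^ k)) ^ ?d"
      unfolding P_def B_def [symmetric] using t by (intro power_mono) auto
    also have "\<dots> = (16 / (t * 4 ^ k)) ^ ?d * indicator (aball \<zeta> (\<rho> k)) \<eta>"
      using k by simp
    also have "\<dots> \<le> (\<Sum>k\<le>K. (16 / (t * 4 ^ k)) ^ ?d * indicator (aball \<zeta> (\<rho> k)) \<eta>)"
      using \<open>k \<le> K\<close> t by (intro member_le_sum) auto
    finally show ?thesis .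
  qed
  have nz: "herm \<eta> z \<noteq> 1" if "norm \<eta> = 1" for \<eta>
  proof
    assume "herm \<eta> z = 1"
    then show False
      using one_minus_norm_le_herm [of \<eta> z] that z(1) by simp
  qed
  have "(cmod (f z))\<^sup>2 \<le> (\<integral>\<eta>. (cmod (f \<eta>))\<^sup>2 * P \<eta> \<partial>sphere_measure)"
    unfolding P_def t_def by (rule poisson_szego_bound [OF f z(1)])
  also have "\<dots> \<le> (\<integral>\<eta>. (\<Sum>k\<le>K. (16 / (t * 4 ^ k)) ^ ?d * (indicator (aball \<zeta> (\<rho> k)) \<eta> * (cmod (f \<eta>))\<^sup>2)) \<partial>sphere_measure)"
  proof (rule integral_mono)
    show "integrable sphere_measure (\<lambda>\<eta>. (cmod (f \<eta>))\<^sup>2 * P \<eta>)"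
      unfolding P_def
      by (intro integrable_sphere_cont continuous_intros continuous_on_poly_fun [OF f]) (auto simp: nz)
    show "integrable sphere_measure (\<lambda>\<eta>. \<Sum>k\<le>K. (16 / (t * 4 ^ k)) ^ ?d * (indicator (aball \<zeta> (\<rho> k)) \<eta> * (cmod (f \<eta>))\<^sup>2))"
      by (intro Bochner_Integration.integrable_sum integrable_mult_right integrable_poly_fun_indicator [OF f])
    fix \<eta> :: "'n cspace" assume "\<eta> \<in> space sphere_measure"
    then have "norm \<eta> = 1" by simp
    then have "(cmod (f \<eta>))\<^sup>2 * P \<eta> \<le> (cmod (f \<eta>))\<^sup>2 * (\<Sum>k\<le>K. (16 / (t * 4 ^ k)) ^ ?d * indicator (aball \<zeta> (\<rho> k)) \<eta>)"
      by (intro mult_left_mono kernel) auto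
    then show "(cmod (f \<eta>))\<^sup>2 * P \<eta> \<le> (\<Sum>k\<le>K. (16 / (t * 4 ^ k)) ^ ?d * (indicator (aball \<zeta> (\<rho> k)) \<eta> * (cmod (f \<eta>))\<^sup>2))"
      by (simp add: sum_distrib_left mult_ac)
  qed
  also have "\<dots> = (\<Sum>k\<le>K. (16 / (t * 4 ^ k)) ^ ?d * I k)"
    unfolding I_def
    by (subst Bochner_Integration.integral_sum)
       (auto intro!: integrable_poly_fun_indicator [OF f])
  \<comment> \<open>If no ball is heavy, the \<open>k\<close>-th term is at most \<open>2\<^sup>-\<^sup>k \<tau>\<^sup>2 / 2\<close>.\<close>
  also have "\<dots> \<le> (\<Sum>k\<le>K. (1 / 2) ^ k * (\<tau>\<^sup>2 / 2))"
  proof (rule sum_mono)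
    fix k
    have "(16 / (t * 4 ^ k)) ^ ?d * I k * (2 * (16 * c) ^ ?d) \<le> (16 / (t * 4 ^ k)) ^ ?d * (\<tau>\<^sup>2 * \<rho> k ^ ?d)"
      using small [of k] t
      by (subst mult.assoc, intro mult_left_mono) (auto simp: mult_ac)
    also have "\<dots> = \<tau>\<^sup>2 * ((16 / (t * 4 ^ k)) * \<rho> k) ^ ?d"
      by (simp only: power_mult_distrib mult_ac)
    also have "(16 / (t * 4 ^ k)) * \<rho> k = (16 * c) * (1 / 2) ^ k"
    proof -
      have "(4::real) ^ k = 2 ^ k * 2 ^ k" by (simp flip: power_mult_distrib)
      then show ?thesis using t by (simp add: \<rho>_def field_simps power_one_over)
    qed
    also have "\<tau>\<^sup>2 * (16 * c * (1 / 2) ^ k) ^ ?d = ((1 / 2) ^ k) ^ ?d * (\<tau>\<^sup>2 / 2) * (2 * (16 * c) ^ ?d)"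
      by (simp only: power_mult_distrib) simp
    finally have "(16 / (t * 4 ^ k)) ^ ?d * I k \<le> ((1 / 2) ^ k) ^ ?d * (\<tau>\<^sup>2 / 2)"
      using c by simp
    also have "\<dots> \<le> ((1 / 2) ^ k) ^ 1 * (\<tau>\<^sup>2 / 2)"
      by (intro mult_right_mono power_decreasing) (auto simp: power_le_one Suc_le_eq)
    finally show "(16 / (t * 4 ^ k)) ^ ?d * I k \<le> (1 / 2) ^ k * (\<tau>\<^sup>2 / 2)" by simp
  qed
  also have "\<dots> = (\<Sum>k\<le>K. (1 / 2) ^ k) * (\<tau>\<^sup>2 / 2)"
    by (rule sum_distrib_right [symmetric])
  also have "\<dots> \<le> 2 * (\<tau>\<^sup>2 / 2)"
  proof (rule mult_right_mono)
    have "(\<Sum>k\<le>K. (1 / 2 :: real) ^ k) \<le> (\<Sum>k. (1 / 2) ^ k)"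
      by (intro sum_le_suminf summable_geometric) auto
    then show "(\<Sum>k\<le>K. (1 / 2 :: real) ^ k) \<le> 2" by (simp add: suminf_geometric)
  qed simp
  finally have "(cmod (f z))\<^sup>2 \<le> \<tau>\<^sup>2" by simp
  moreover have "\<tau>\<^sup>2 < (cmod (f z))\<^sup>2"
    using \<tau> by (intro power_strict_mono) auto
  ultimately show False by simp
qed

text \<open>For a fixed interior point \<open>z\<close> the boundary points whose Koranyi region contains \<open>z\<close> form an open
  set, and so does the union over all \<open>z\<close> that satisfy \<open>P\<close>.\<close>

lemma sets_koranyi_shadow:
  "{\<zeta> \<in> sphere 0 1. \<exists>z\<in>koranyi_region c \<zeta>. P z} \<in> sets sphere_measure"
proof -
  have op: "open (\<Union>z\<in>{z \<in> ball 0 1. P z}. {\<zeta>. cmod (1 - herm z \<zeta>) < c / 2 * (1 - (norm z)\<^sup>2)})"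
    by (intro open_UN ballI open_Collect_less continuous_intros)
  have eq: "{\<zeta> \<in> sphere 0 1. \<exists>z\<in>koranyi_region c \<zeta>. P z}
      = {\<zeta> \<in> sphere 0 1. \<zeta> \<in> (\<Union>z\<in>{z \<in> ball 0 1. P z}. {\<zeta>. cmod (1 - herm z \<zeta>) < c / 2 * (1 - (norm z)\<^sup>2)})}"
    by (auto simp: koranyi_region_def)
  show ?thesis
    unfolding eq by (rule sets_sphere_open_Int [OF op])
qed

text \<open>Every \<open>z\<close> with \<open>\<bar>f z\<bar> > \<tau>\<close> selects a heavy ball that contains the set of boundary points seeing \<open>z\<close>.
  The Vitali lemma extracts disjoint balls whose enlargements cover these sets; each has measure at most a constant
  times \<open>\<tau>\<^sup>-\<^sup>2\<close> times the integral of \<open>\<bar>f\<bar>\<^sup>2\<close> over it, and by disjointness these integrals add up to at most the total.\<close>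

lemma finite_maximal_inequality:
  assumes c: "1 < c"
  shows "\<exists>C>0. \<forall>(f :: 'n::finite cspace \<Rightarrow> complex) n \<tau> Z. poly_fun n f \<longrightarrow> 0 < \<tau> \<longrightarrow> finite Z \<longrightarrow>
    (\<forall>z\<in>Z. norm z < 1 \<and> \<tau> < cmod (f z)) \<longrightarrow>
    measure sphere_measure {\<zeta> \<in> sphere 0 1. \<exists>z\<in>koranyi_region c \<zeta>. z \<in> Z} \<le> C / \<tau>\<^sup>2 * sphere_norm2 f"
proof -
  let ?d = "CARD('n)"
  obtain C0 where C0: "C0 > 0"
    "\<And>(\<zeta> :: 'n cspace) \<rho>. \<rho> > 0 \<Longrightarrow> norm \<zeta> = 1 \<Longrightarrow> measure sphere_measure (aball \<zeta> \<rho>) \<le> C0 * \<rho> ^ ?d"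
    using measure_aball_le [where 'n = 'n] by blast
  define C where "C = C0 * 9 ^ ?d * (2 * (16 * c) ^ ?d)"
  show ?thesis
  proof (intro exI [of _ C] conjI allI impI)
    show "C > 0" using C0 c by (simp add: C_def)
    fix f :: "'n cspace \<Rightarrow> complex" and n :: nat and \<tau> :: real and Z :: "'n cspace set"
    assume f: "poly_fun n f" and \<tau>: "0 < \<tau>" and Z: "finite Z" "\<forall>z\<in>Z. norm z < 1 \<and> \<tau> < cmod (f z)"
    define heavy where "heavy z q \<longleftrightarrow> norm (fst q) = 1 \<and> 0 < snd q \<and>
        {\<eta> \<in> sphere 0 1. z \<in> koranyi_region c \<eta>} \<subseteq> aball (fst q) (snd q) \<and>
        \<tau>\<^sup>2 * snd q ^ ?d \<le> 2 * (16 * c) ^ ?d * (\<integral>\<eta>. indicator (aball (fst q) (snd q)) \<eta> * (cmod (f \<eta>))\<^sup>2 \<partial>sphere_measure)"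
      for z :: "'n cspace" and q
    have "\<exists>q. heavy z q" if "z \<in> Z" for z
    proof -
      have z: "norm z < 1" "\<tau> < cmod (f z)" using Z that by auto
      obtain \<zeta> where \<zeta>: "norm \<zeta> = 1" "z = norm z *\<^sub>R \<zeta>" by (rule exists_unit_direction)
      obtain k where k: "\<tau>\<^sup>2 * (2 ^ k * c * (1 - (norm z)\<^sup>2)) ^ ?d \<le> 2 * (16 * c) ^ ?d *
          (\<integral>\<eta>. indicator (aball \<zeta> (2 ^ k * c * (1 - (norm z)\<^sup>2))) \<eta> * (cmod (f \<eta>))\<^sup>2 \<partial>sphere_measure)"
        using exists_heavy_aball [OF f z(1) \<zeta> c \<tau> z(2)] by (elim exE) (rule that)
      have t: "0 < 1 - (norm z)\<^sup>2" using z by (simp add: abs_square_less_1)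
      have "{\<eta> \<in> sphere 0 1. z \<in> koranyi_region c \<eta>} \<subseteq> aball \<zeta> (2 ^ k * c * (1 - (norm z)\<^sup>2))"
      proof
        fix \<eta> assume "\<eta> \<in> {\<eta> \<in> sphere 0 1. z \<in> koranyi_region c \<eta>}"
        then have \<eta>: "norm \<eta> = 1" "cmod (1 - herm z \<eta>) < c / 2 * (1 - (norm z)\<^sup>2)"
          by (auto simp: koranyi_region_def)
        have "cmod (1 - herm \<zeta> \<eta>) \<le> 2 * cmod (1 - herm \<eta> z)"
          by (rule herm_direction_le) (use \<eta> \<zeta> z in auto)
        also have "\<dots> < 1 * (c * (1 - (norm z)\<^sup>2))"
          using \<eta>(2) by (simp add: cmod_one_minus_herm_commute [of \<eta>])
        also have "\<dots> \<le> 2 ^ k * (c * (1 - (norm z)\<^sup>2))"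
          using t c by (intro mult_right_mono) auto
        finally show "\<eta> \<in> aball \<zeta> (2 ^ k * c * (1 - (norm z)\<^sup>2))"
          using \<eta> by (simp add: aball_def mult.assoc)
      qed
      then have "heavy z (\<zeta>, 2 ^ k * c * (1 - (norm z)\<^sup>2))"
        unfolding heavy_def fst_conv snd_conv using \<zeta> c t k by simp
      then show ?thesis by (rule exI)
    qed
    then obtain q where q: "\<And>z. z \<in> Z \<Longrightarrow> heavy z (q z)"
      by metis
    let ?A = "\<lambda>z. aball (fst (q z)) (snd (q z))"
    have "\<exists>I\<subseteq>Z. disjoint_family_on ?A I \<and> (\<Union>z\<in>Z. ?A z) \<subseteq> (\<Union>z\<in>I. aball (fst (q z)) (9 * snd (q z)))"
      by (rule anisotropic_vitali [OF Z(1)]) (use q in \<open>simp add: heavy_def\<close>)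
    then obtain I where I: "I \<subseteq> Z" "disjoint_family_on ?A I"
      "(\<Union>z\<in>Z. ?A z) \<subseteq> (\<Union>z\<in>I. aball (fst (q z)) (9 * snd (q z)))"
      by (elim exE conjE) (rule that)
    have finI: "finite I" using I(1) Z(1) by (rule finite_subset)
    have "{\<zeta> \<in> sphere 0 1. \<exists>z\<in>koranyi_region c \<zeta>. z \<in> Z} \<subseteq> (\<Union>z\<in>Z. ?A z)"
      using q by (fastforce simp: heavy_def)
    then have "measure sphere_measure {\<zeta> \<in> sphere 0 1. \<exists>z\<in>koranyi_region c \<zeta>. z \<in> Z}
        \<le> measure sphere_measure (\<Union>z\<in>I. aball (fst (q z)) (9 * snd (q z)))"
      using I(3) finI by (intro sphere.finite_measure_mono sets.finite_UN) auto
    also have "\<dots> \<le> (\<Sum>z\<in>I. measure sphere_measure (aball (fst (q z)) (9 * snd (q z))))"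
      using finI by (intro measure_UNION_le) auto
    also have "\<dots> \<le> (\<Sum>z\<in>I. C / \<tau>\<^sup>2 * (\<integral>\<eta>. indicator (?A z) \<eta> * (cmod (f \<eta>))\<^sup>2 \<partial>sphere_measure))"
    proof (rule sum_mono)
      fix z assume "z \<in> I"
      then have h: "norm (fst (q z)) = 1" "0 < snd (q z)"
        "\<tau>\<^sup>2 * snd (q z) ^ ?d \<le> 2 * (16 * c) ^ ?d * (\<integral>\<eta>. indicator (?A z) \<eta> * (cmod (f \<eta>))\<^sup>2 \<partial>sphere_measure)"
        using I(1) q by (auto simp: heavy_def)
      have "measure sphere_measure (aball (fst (q z)) (9 * snd (q z))) \<le> C0 * (9 * snd (q z)) ^ ?d"
        using h by (intro C0) auto
      also have "\<dots> = C0 * 9 ^ ?d / \<tau>\<^sup>2 * (\<tau>\<^sup>2 * snd (q z) ^ ?d)"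
        using \<tau> by (simp add: power_mult_distrib)
      also have "\<dots> \<le> C0 * 9 ^ ?d / \<tau>\<^sup>2 * (2 * (16 * c) ^ ?d * (\<integral>\<eta>. indicator (?A z) \<eta> * (cmod (f \<eta>))\<^sup>2 \<partial>sphere_measure))"
        using h C0 by (intro mult_left_mono) auto
      finally show "measure sphere_measure (aball (fst (q z)) (9 * snd (q z)))
          \<le> C / \<tau>\<^sup>2 * (\<integral>\<eta>. indicator (?A z) \<eta> * (cmod (f \<eta>))\<^sup>2 \<partial>sphere_measure)"
        by (simp add: C_def)
    qed
    also have "\<dots> = C / \<tau>\<^sup>2 * (\<integral>\<eta>. (\<Sum>z\<in>I. indicator (?A z) \<eta> * (cmod (f \<eta>))\<^sup>2) \<partial>sphere_measure)"
      by (subst Bochner_Integration.integral_sum)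
         (auto intro!: integrable_poly_fun_indicator [OF f] simp: sum_distrib_left)
    also have "\<dots> \<le> C / \<tau>\<^sup>2 * sphere_norm2 f"
    proof (rule mult_left_mono)
      show "(\<integral>\<eta>. (\<Sum>z\<in>I. indicator (?A z) \<eta> * (cmod (f \<eta>))\<^sup>2) \<partial>sphere_measure) \<le> sphere_norm2 f"
        unfolding sphere_norm2_def
      proof (rule integral_mono)
        show "integrable sphere_measure (\<lambda>\<eta>. \<Sum>z\<in>I. indicator (?A z) \<eta> * (cmod (f \<eta>))\<^sup>2)"
          by (intro Bochner_Integration.integrable_sum integrable_poly_fun_indicator [OF f])
        show "integrable sphere_measure (\<lambda>\<eta>. (cmod (f \<eta>))\<^sup>2)"
          by (intro integrable_sphere_cont continuous_intros continuous_on_poly_fun [OF f])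
        fix \<eta>
        have "(\<Sum>z\<in>I. indicator (?A z) \<eta> :: real) = indicator (\<Union>z\<in>I. ?A z) \<eta>"
          using finI I(2) by (rule indicator_UN_disjoint [symmetric])
        then have "(\<Sum>z\<in>I. indicator (?A z) \<eta> :: real) \<le> 1"
          by (simp add: indicator_def)
        then have "(\<Sum>z\<in>I. indicator (?A z) \<eta>) * (cmod (f \<eta>))\<^sup>2 \<le> 1 * (cmod (f \<eta>))\<^sup>2"
          by (rule mult_right_mono) simp
        then show "(\<Sum>z\<in>I. indicator (?A z) \<eta> * (cmod (f \<eta>))\<^sup>2) \<le> (cmod (f \<eta>))\<^sup>2"
          by (simp add: sum_distrib_right)
      qed
      show "0 \<le> C / \<tau>\<^sup>2" using C0 c by (simp add: C_def)
    qed
    finally show "measure sphere_measure {\<zeta> \<in> sphere 0 1. \<exists>z\<in>koranyi_region c \<zeta>. z \<in> Z} \<le> C / \<tau>\<^sup>2 * sphere_norm2 f" .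
  qed
qed

text \<open>Countably many points are enough to see every value above the threshold, so the general case
  is a monotone limit of the finite one.\<close>

lemma maximal_inequality:
  assumes c: "1 < c"
  shows "\<exists>C>0. \<forall>(f :: 'n::finite cspace \<Rightarrow> complex) n \<tau>. poly_fun n f \<longrightarrow> 0 < \<tau> \<longrightarrow>
    measure sphere_measure {\<zeta> \<in> sphere 0 1. \<exists>z\<in>koranyi_region c \<zeta>. \<tau> < cmod (f z)} \<le> C / \<tau>\<^sup>2 * sphere_norm2 f"
proof -
  obtain C where C: "C > 0" "\<forall>(f :: 'n cspace \<Rightarrow> complex) n \<tau> Z. poly_fun n f \<longrightarrow> 0 < \<tau> \<longrightarrow> finite Z \<longrightarrow>
    (\<forall>z\<in>Z. norm z < 1 \<and> \<tau> < cmod (f z)) \<longrightarrow>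
    measure sphere_measure {\<zeta> \<in> sphere 0 1. \<exists>z\<in>koranyi_region c \<zeta>. z \<in> Z} \<le> C / \<tau>\<^sup>2 * sphere_norm2 f"
    using finite_maximal_inequality [OF c, where 'n = 'n] by (elim exE conjE) (rule that)
  obtain D :: "'n cspace set" where D: "countable D" "\<And>X. open X \<Longrightarrow> X \<noteq> {} \<Longrightarrow> \<exists>d\<in>D. d \<in> X"
    by (rule countable_dense_setE) (rule that)
  show ?thesis
  proof (intro exI [of _ C] conjI allI impI)
    show "C > 0" by (rule C)
    fix f :: "'n cspace \<Rightarrow> complex" and n :: nat and \<tau> :: real
    assume f: "poly_fun n f" and \<tau>: "0 < \<tau>"
    let ?E = "{z\<in>D. norm z < 1 \<and> \<tau> < cmod (f z)}"
    have E: "countable ?E"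
      by (rule countable_subset [OF _ D(1)]) auto
    define h where "h = from_nat_into ?E"
    define O' where "O' Z = {\<zeta> \<in> sphere 0 1. \<exists>z\<in>koranyi_region c \<zeta>. z \<in> Z}" for Z :: "'n cspace set"
    have eq: "{\<zeta> \<in> sphere 0 1. \<exists>z\<in>koranyi_region c \<zeta>. \<tau> < cmod (f z)} = O' ?E"
    proof (intro equalityI subsetI)
      fix \<zeta> assume "\<zeta> \<in> {\<zeta> \<in> sphere 0 1. \<exists>z\<in>koranyi_region c \<zeta>. \<tau> < cmod (f z)}"
      then obtain z where \<zeta>: "\<zeta> \<in> sphere 0 1" and z: "z \<in> koranyi_region c \<zeta>" "\<tau> < cmod (f z)" by auto
      let ?X = "{z. norm z < 1} \<inter> {z. cmod (1 - herm z \<zeta>) < c / 2 * (1 - (norm z)\<^sup>2)} \<inter> {z. \<tau> < cmod (f z)}"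
      have "open ?X"
        by (intro open_Int open_Collect_less continuous_intros continuous_on_poly_fun [OF f])
      moreover have "z \<in> ?X" using z by (simp add: koranyi_region_def)
      ultimately obtain d where "d \<in> D" "d \<in> ?X" using D(2) [of ?X] by blast
      then show "\<zeta> \<in> O' ?E"
        unfolding O'_def using \<zeta> by (intro CollectI conjI bexI [of _ d]) (auto simp: koranyi_region_def)
    qed (auto simp: O'_def)
    show "measure sphere_measure {\<zeta> \<in> sphere 0 1. \<exists>z\<in>koranyi_region c \<zeta>. \<tau> < cmod (f z)} \<le> C / \<tau>\<^sup>2 * sphere_norm2 f"
    proof (cases "?E = {}")
      case True
      have "0 \<le> C / \<tau>\<^sup>2 * sphere_norm2 f"
        using C(1) sphere_norm2_nonneg [of f] by simp
      then show ?thesis unfolding eq True by (simp add: O'_def)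
    next
      case False
      then have h: "range h = ?E" unfolding h_def using E by (rule range_from_nat_into)
      have lim: "(\<lambda>N. measure sphere_measure (O' (h ` {..<N}))) \<longlonglongrightarrow> measure sphere_measure (\<Union>N. O' (h ` {..<N}))"
      proof (rule sphere.finite_Lim_measure_incseq)
        show "range (\<lambda>N. O' (h ` {..<N})) \<subseteq> sets sphere_measure"
          unfolding O'_def by (rule image_subsetI) (rule sets_koranyi_shadow)
        show "incseq (\<lambda>N. O' (h ` {..<N}))"
        proof (rule monoI)
          fix M N :: nat assume "M \<le> N"
          then have "h ` {..<M} \<subseteq> h ` {..<N}" by auto
          then show "O' (h ` {..<M}) \<subseteq> O' (h ` {..<N})" unfolding O'_def by blast
        qed
      qed
      have "(\<Union>N. O' (h ` {..<N})) = O' ?E"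
      proof (intro equalityI subsetI)
        fix \<zeta> assume "\<zeta> \<in> O' ?E"
        then obtain k where "\<zeta> \<in> sphere 0 1" "h k \<in> koranyi_region c \<zeta>"
          unfolding h [symmetric] O'_def by auto
        then have "\<zeta> \<in> O' (h ` {..<Suc k})" by (auto simp: O'_def)
        then show "\<zeta> \<in> (\<Union>N. O' (h ` {..<N}))" by blast
      qed (unfold h [symmetric], auto simp: O'_def)
      moreover have "measure sphere_measure (O' (h ` {..<N})) \<le> C / \<tau>\<^sup>2 * sphere_norm2 f" for N
        unfolding O'_def
      proof (rule C(2) [rule_format, OF f \<tau>])
        fix z assume "z \<in> h ` {..<N}"
        then have "z \<in> range h" by auto
        then show "norm z < 1 \<and> \<tau> < cmod (f z)" unfolding h by simp
      qed simp
      ultimately show ?thesis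
        using lim unfolding eq by (intro LIMSEQ_le_const2) auto
    qed
  qed
qed

section \<open>Homogeneous expansion of bounded holomorphic functions\<close>

lemma has_derivative_slice: "((\<lambda>\<mu>. a + \<mu> *s b) has_derivative (\<lambda>h. h *s (b :: 'n::finite cspace))) (at x)"
proof -
  have "bounded_linear (\<lambda>h. h *s b)"
  proof (rule bounded_linear_intro)
    show "(x + y) *s b = x *s b + y *s b" for x y by (simp add: vector_sadd_rdistrib)
    show "(r *\<^sub>R x) *s b = r *\<^sub>R (x *s b)" for r x
      by (simp add: scaleR_eq_smult scaleR_conv_of_real [of _ "_ :: complex"])
    show "norm (x *s b) \<le> norm x * norm b" for x by (simp add: norm_smult)
  qed
  then have "((\<lambda>h. h *s b) has_derivative (\<lambda>h. h *s b)) (at x)"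
    by (rule bounded_linear_imp_has_derivative)
  from has_derivative_add [OF has_derivative_const this, of a] show ?thesis by simp
qed

lemma continuous_on_smult [continuous_intros]:
  assumes "continuous_on S f" "continuous_on S h"
  shows "continuous_on S (\<lambda>x. f x *s (h x :: 'n::finite cspace))"
  unfolding vector_scalar_mult_def by (intro continuous_intros assms)

lemma holomorphic_slice:
  assumes "holomorphic_several g (ball 0 1)"
  shows "(\<lambda>\<mu>. g (a + \<mu> *s b)) holomorphic_on {\<mu>. norm (a + \<mu> *s b) < 1}"
  unfolding holomorphic_on_def
proof
  fix \<mu> assume "\<mu> \<in> {\<mu>. norm (a + \<mu> *s b) < 1}"
  then have mem: "a + \<mu> *s b \<in> ball 0 1" by simp
  then obtain g' where g': "(g has_derivative g') (at (a + \<mu> *s b) within ball 0 1)"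
    "\<And>c v. g' (c *s v) = c * g' v"
    using assms unfolding holomorphic_several_def by blast
  then have "(g has_derivative g') (at (a + \<mu> *s b))"
    using at_within_open [OF mem open_ball] by simp
  from has_derivative_compose [OF has_derivative_slice this]
  have "((\<lambda>\<mu>. g (a + \<mu> *s b)) has_derivative (\<lambda>h. g' (h *s b))) (at \<mu>)" .
  moreover have "(\<lambda>h. g' (h *s b)) = (*) (g' b)"
    by (simp add: fun_eq_iff g'(2) mult.commute)
  ultimately have "((\<lambda>\<mu>. g (a + \<mu> *s b)) has_field_derivative g' b) (at \<mu>)"
    unfolding has_field_derivative_def by (simp only:)
  then show "(\<lambda>\<mu>. g (a + \<mu> *s b)) field_differentiable (at \<mu> within {\<mu>. norm (a + \<mu> *s b) < 1})"
    unfolding field_differentiable_def by (blast intro: has_field_derivative_at_within)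
qed

lemma open_slice: "open {\<mu>. norm (a + \<mu> *s (b :: 'n::finite cspace)) < 1}"
  by (intro open_Collect_less continuous_intros)

text \<open>The homogeneous component of degree \<open>k\<close> of \<open>g\<close> at \<open>0\<close>, that is, the \<open>k\<close>-th Taylor coefficient of
  \<open>\<mu> \<mapsto> g (\<mu> z)\<close>.  It is defined for all \<open>z\<close>, since this function is holomorphic near \<open>0\<close>.\<close>

definition hcoef :: "('n::finite cspace \<Rightarrow> complex) \<Rightarrow> nat \<Rightarrow> 'n cspace \<Rightarrow> complex" where
  "hcoef g k z = (deriv ^^ k) (\<lambda>\<mu>. g (\<mu> *s z)) 0 / fact k"

locale bounded_holomorphic =
  fixes g :: "'n::finite cspace \<Rightarrow> complex" and M :: real
  assumes hol: "holomorphic_several g (ball 0 1)"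
    and bounded: "\<And>z. norm z < 1 \<Longrightarrow> cmod (g z) \<le> M"
begin

lemma M_nonneg: "0 \<le> M"
  using bounded [of 0] by (simp add: order_trans [OF norm_ge_zero])

lemma continuous: "continuous_on (ball 0 1) g"
  using hol unfolding holomorphic_several_def continuous_on_eq_continuous_within
  by (blast intro: has_derivative_continuous)

lemma holomorphic_radial: "(\<lambda>\<mu>. g (\<mu> *s z)) holomorphic_on {\<mu>. norm (\<mu> *s z) < 1}"
  using holomorphic_slice [OF hol, of 0 z] by simp

lemma open_radial: "open {\<mu>. norm (\<mu> *s (z :: 'n cspace)) < 1}"
  using open_slice [of 0 z] by simp

lemma holomorphic_radial_ball:
  assumes "r * norm z \<le> 1"
  shows "(\<lambda>\<mu>. g (\<mu> *s z)) holomorphic_on ball 0 r"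
proof (rule holomorphic_on_subset [OF holomorphic_radial], rule subsetI)
  fix \<mu> :: complex assume "\<mu> \<in> ball 0 r"
  then have r: "cmod \<mu> < r" by simp
  show "\<mu> \<in> {\<mu>. norm (\<mu> *s z) < 1}"
  proof (cases "norm z = 0")
    case False
    then have "cmod \<mu> * norm z < r * norm z" using r by (intro mult_strict_right_mono) auto
    then show ?thesis using assms by (simp add: norm_smult)
  qed (simp add: norm_smult)
qed

lemma hcoef_sums:
  assumes "norm (c *s z) < 1"
  shows "(\<lambda>k. hcoef g k z * c ^ k) sums g (c *s z)"
proof -
  have "\<exists>r. cmod c < r \<and> r * norm z \<le> 1"
  proof (cases "norm z = 0")
    case True
    then show ?thesis by (intro exI [of _ "cmod c + 1"]) simp
  next
    case False
    then show ?thesis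
      using assms by (intro exI [of _ "1 / norm z"]) (simp add: norm_smult field_simps)
  qed
  then obtain r where r: "cmod c < r" "r * norm z \<le> 1" by blast
  show ?thesis
    using holomorphic_power_series [OF holomorphic_radial_ball [OF r(2)], of c] r(1)
    by (simp add: hcoef_def)
qed

text \<open>Cauchy's inequality on the circle of radius \<open>1 / s\<close> for \<open>s > \<bar>z\<bar>\<close>, in the limit \<open>s \<rightarrow> \<bar>z\<bar>\<close>.\<close>

lemma hcoef_bound: "cmod (hcoef g k z) \<le> M * norm z ^ k"
proof (rule tendsto_lowerbound)
  show "((\<lambda>s. M * s ^ k) \<longlongrightarrow> M * norm z ^ k) (at_right (norm z))"
    by (intro tendsto_intros)
  have "cmod (hcoef g k z) \<le> M * s ^ k" if "norm z < s" for s
  proof -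
    have s: "0 < s" using that by (rule le_less_trans [OF norm_ge_zero])
    have sub: "cmod \<mu> \<le> 1 / s \<Longrightarrow> norm (\<mu> *s z) < 1" for \<mu>
    proof -
      assume "cmod \<mu> \<le> 1 / s"
      then have "cmod \<mu> * norm z \<le> (1 / s) * norm z" by (intro mult_right_mono) auto
      also have "\<dots> < 1" using that s by simp
      finally show ?thesis by (simp add: norm_smult)
    qed
    have "cmod ((deriv ^^ k) (\<lambda>\<mu>. g (\<mu> *s z)) 0) \<le> fact k * M / (1 / s) ^ k"
    proof (rule Cauchy_inequality)
      show "(\<lambda>\<mu>. g (\<mu> *s z)) holomorphic_on ball 0 (1 / s)"
        by (rule holomorphic_on_subset [OF holomorphic_radial]) (use sub in auto)
      show "continuous_on (cball 0 (1 / s)) (\<lambda>\<mu>. g (\<mu> *s z))"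
        by (rule continuous_on_subset [OF holomorphic_on_imp_continuous_on [OF holomorphic_radial]])
           (use sub in auto)
      show "cmod (g (\<mu> *s z)) \<le> M" if "cmod (0 - \<mu>) = 1 / s" for \<mu>
        using that sub [of \<mu>] by (intro bounded) simp
    qed (use s in simp)
    then show ?thesis
      by (simp add: hcoef_def norm_divide divide_le_eq power_one_over mult_ac)
  qed
  then show "\<forall>\<^sub>F s in at_right (norm z). cmod (hcoef g k z) \<le> M * s ^ k"
    by (intro eventually_at_rightI [of _ "norm z + 1"]) auto
qed simp

lemma hcoef_homogeneous: "hcoef g k (c *s z) = c ^ k * hcoef g k z"
proof -
  have "(deriv ^^ k) (\<lambda>w. (\<lambda>\<mu>. g (\<mu> *s z)) (c * w)) 0 = c ^ k * (deriv ^^ k) (\<lambda>\<mu>. g (\<mu> *s z)) (c * 0)"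
  proof (rule higher_deriv_compose_linear [OF holomorphic_radial open_radial open_radial])
    show "0 \<in> {\<mu>. norm (\<mu> *s (c *s z)) < 1}" by simp
    show "c * w \<in> {\<mu>. norm (\<mu> *s z) < 1}" if "w \<in> {\<mu>. norm (\<mu> *s (c *s z)) < 1}" for w
      using that by (simp add: norm_smult norm_mult mult_ac)
  qed
  then show ?thesis
    by (simp add: hcoef_def mult.commute [of c])
qed

lemma hcoef_zero: "hcoef g 0 z = g 0"
  by (simp add: hcoef_def)

text \<open>The coefficient of degree \<open>k\<close> is the limit, uniform on bounded sets, of
  \<open>(g (t z) - \<Sum>j<k. t\<^sup>j F\<^sub>j z) / t\<^sup>k\<close> as \<open>t \<rightarrow> 0\<close>; this transfers holomorphy along complex lines
  inductively from \<open>g\<close> to all coefficients.\<close>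

lemma hcoef_remainder:
  assumes t: "0 < t" "2 * t * s \<le> 1" and z: "norm z \<le> s"
  shows "cmod ((g (of_real t *s z) - (\<Sum>j<k. of_real t ^ j * hcoef g j z)) / of_real t ^ k - hcoef g k z)
    \<le> 2 * M * s ^ Suc k * t"
proof -
  have s0: "0 \<le> s" using z by (rule order_trans [OF norm_ge_zero])
  define c where "c = complex_of_real t"
  have c0: "c \<noteq> 0" and cmc: "cmod c = t" using t by (auto simp: c_def)
  have "t * norm z \<le> t * s" using z t by (intro mult_left_mono) auto
  also have "\<dots> \<le> 1 / 2" using t by simp
  finally have ts: "norm (c *s z) < 1" by (simp add: norm_smult cmc)
  have "(\<lambda>i. hcoef g (i + Suc k) z * c ^ (i + Suc k)) sums (g (c *s z) - (\<Sum>j<Suc k. hcoef g j z * c ^ j))"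
    by (rule sums_split_initial_segment [OF hcoef_sums [OF ts]])
  then have "(\<lambda>i. hcoef g (i + Suc k) z * c ^ (i + Suc k) / c ^ k) sums ((g (c *s z) - (\<Sum>j<Suc k. hcoef g j z * c ^ j)) / c ^ k)"
    by (rule sums_divide)
  moreover have "hcoef g (i + Suc k) z * c ^ (i + Suc k) / c ^ k = hcoef g (i + Suc k) z * c ^ Suc i" for i
    using c0 by (simp add: power_add)
  moreover have "(g (c *s z) - (\<Sum>j<Suc k. hcoef g j z * c ^ j)) / c ^ k
      = (g (c *s z) - (\<Sum>j<k. c ^ j * hcoef g j z)) / c ^ k - hcoef g k z"
    using c0 by (simp add: diff_divide_distrib add_divide_distrib mult.commute)
  ultimately have sums: "(\<lambda>i. hcoef g (i + Suc k) z * c ^ Suc i) sums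
      ((g (c *s z) - (\<Sum>j<k. c ^ j * hcoef g j z)) / c ^ k - hcoef g k z)" by simp
  have term_le: "cmod (hcoef g (i + Suc k) z * c ^ Suc i) \<le> M * s ^ Suc k * t * (1 / 2) ^ i" for i
  proof -
    have "cmod (hcoef g (i + Suc k) z) \<le> M * s ^ (i + Suc k)"
      using M_nonneg z by (intro order_trans [OF hcoef_bound] mult_left_mono power_mono) auto
    then have "cmod (hcoef g (i + Suc k) z * c ^ Suc i) \<le> M * s ^ (i + Suc k) * t ^ Suc i"
      unfolding norm_mult norm_power cmc using t by (intro mult_right_mono) auto
    also have "\<dots> = M * s ^ Suc k * t * (t * s) ^ i"
      by (simp add: power_add power_mult_distrib mult_ac)
    also have "\<dots> \<le> M * s ^ Suc k * t * (1 / 2) ^ i"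
      using t s0 M_nonneg by (intro mult_left_mono power_mono) auto
    finally show ?thesis .
  qed
  have "cmod (\<Sum>i. hcoef g (i + Suc k) z * c ^ Suc i) \<le> (\<Sum>i. M * s ^ Suc k * t * (1 / 2) ^ i)"
    by (rule norm_suminf_le) (use term_le in \<open>auto intro!: summable_mult summable_geometric\<close>)
  also have "\<dots> = M * s ^ Suc k * t * (\<Sum>i. (1 / 2) ^ i)"
    by (rule suminf_mult) (simp add: summable_geometric)
  also have "\<dots> = 2 * M * s ^ Suc k * t"
    by (simp add: suminf_geometric)
  finally show ?thesis
    using sums_unique [OF sums] by (simp add: c_def)
qed

lemma hcoef_holomorphic_line: "(\<lambda>\<mu>. hcoef g k (a + \<mu> *s b)) holomorphic_on UNIV"
proof (induction k rule: less_induct)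
  case (less k)
  have ball: "(\<lambda>\<mu>. hcoef g k (a + \<mu> *s b)) holomorphic_on ball 0 R" for R
  proof -
    define s where "s = norm a + \<bar>R\<bar> * norm b + 1"
    have s: "s > 0" unfolding s_def by (simp add: add_nonneg_pos)
    define t where "t n = inverse (2 * s) * inverse (real (Suc n))" for n
    have t: "0 < t n" "2 * t n * s \<le> 1" for n
    proof -
      show "0 < t n" using s by (simp add: t_def)
      have "2 * t n * s = inverse (real (Suc n))"
        using s by (simp add: t_def del: of_nat_Suc)
      then show "2 * t n * s \<le> 1" by (simp add: inverse_eq_divide)
    qed
    have z: "norm (a + \<mu> *s b) \<le> s" if "\<mu> \<in> ball 0 R" for \<mu>
    proof -
      have "norm (a + \<mu> *s b) \<le> norm a + cmod \<mu> * norm b"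
        using norm_triangle_ineq [of a "\<mu> *s b"] by (simp add: norm_smult)
      also have "cmod \<mu> * norm b \<le> \<bar>R\<bar> * norm b"
        using that by (intro mult_right_mono) auto
      finally show ?thesis by (simp add: s_def)
    qed
    define f where "f n \<mu> = (g (of_real (t n) *s (a + \<mu> *s b)) - (\<Sum>j<k. of_real (t n) ^ j * hcoef g j (a + \<mu> *s b))) / of_real (t n) ^ k" for n \<mu>
    have f_hol: "f n holomorphic_on ball 0 R" for n
    proof -
      have dist: "of_real (t n) *s (a + \<mu> *s b) = of_real (t n) *s a + \<mu> *s (of_real (t n) *s b)" for \<mu>
        by (simp add: vector_add_ldistrib mult.commute)
      have "(\<lambda>\<mu>. g (of_real (t n) *s a + \<mu> *s (of_real (t n) *s b))) holomorphic_on ball 0 R"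
      proof (rule holomorphic_on_subset [OF holomorphic_slice [OF hol]], rule subsetI)
        fix \<mu> assume "\<mu> \<in> ball (0::complex) R"
        then have "t n * norm (a + \<mu> *s b) \<le> t n * s" using z t(1) [of n] by (intro mult_left_mono) auto
        also have "\<dots> < 1" using t(2) [of n] by simp
        finally have "norm (of_real (t n) *s (a + \<mu> *s b)) < 1"
          unfolding norm_smult using t(1) [of n] by simp
        then show "\<mu> \<in> {\<mu>. norm (of_real (t n) *s a + \<mu> *s (of_real (t n) *s b)) < 1}"
          unfolding dist by (rule CollectI)
      qed
      then have "(\<lambda>\<mu>. g (of_real (t n) *s (a + \<mu> *s b))) holomorphic_on ball 0 R"
        unfolding dist .
      moreover have "(\<lambda>\<mu>. hcoef g j (a + \<mu> *s b)) holomorphic_on ball 0 R" if "j < k" for j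
        using less.IH [OF that] by (rule holomorphic_on_subset) simp
      ultimately show ?thesis
        unfolding f_def using t(1) [of n] by (intro holomorphic_intros) auto
    qed
    have unif: "uniform_limit (ball 0 R) f (\<lambda>\<mu>. hcoef g k (a + \<mu> *s b)) sequentially"
    proof (rule uniform_limitI)
      fix e :: real assume e: "e > 0"
      have "(\<lambda>n. 2 * M * s ^ Suc k * t n) \<longlonglongrightarrow> 0"
      proof -
        have "(\<lambda>n. 2 * M * s ^ Suc k * (inverse (2 * s) * inverse (real (Suc n))))
            \<longlonglongrightarrow> 2 * M * s ^ Suc k * (inverse (2 * s) * 0)"
          by (intro tendsto_mult tendsto_const LIMSEQ_inverse_real_of_nat)
        then show ?thesis unfolding t_def by (simp only: mult_zero_right)
      qed
      then have "\<forall>\<^sub>F n in sequentially. 2 * M * s ^ Suc k * t n < e"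
        using e by (rule order_tendstoD)
      then show "\<forall>\<^sub>F n in sequentially. \<forall>\<mu>\<in>ball 0 R. dist (f n \<mu>) (hcoef g k (a + \<mu> *s b)) < e"
      proof eventually_elim
        case (elim n)
        show ?case
        proof
          fix \<mu> assume "\<mu> \<in> ball (0::complex) R"
          then have "dist (f n \<mu>) (hcoef g k (a + \<mu> *s b)) \<le> 2 * M * s ^ Suc k * t n"
            unfolding dist_norm f_def by (intro hcoef_remainder t z)
          then show "dist (f n \<mu>) (hcoef g k (a + \<mu> *s b)) < e" using elim by (rule le_less_trans)
        qed
      qed
    qed
    show ?thesis
    proof (rule holomorphic_uniform_sequence [OF open_ball f_hol])
      fix x assume "x \<in> ball (0::complex) R"
      from open_contains_cball [THEN iffD1, OF open_ball, rule_format, OF this]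
      obtain d where d: "0 < d" "cball x d \<subseteq> ball 0 R"
        by (elim exE conjE) (rule that)
      then show "\<exists>d>0. cball x d \<subseteq> ball 0 R \<and> uniform_limit (cball x d) f (\<lambda>\<mu>. hcoef g k (a + \<mu> *s b)) sequentially"
        by (intro exI [of _ d] conjI d uniform_limit_on_subset [OF unif])
    qed
  qed
  show ?case
    unfolding holomorphic_on_def
  proof
    fix \<mu> :: complex
    have "(\<lambda>\<mu>. hcoef g k (a + \<mu> *s b)) field_differentiable at \<mu>"
      by (rule holomorphic_on_imp_differentiable_at [OF ball [of "cmod \<mu> + 1"]]) auto
    then show "(\<lambda>\<mu>. hcoef g k (a + \<mu> *s b)) field_differentiable (at \<mu> within UNIV)" by simp
  qed
qed

text \<open>An entire function of polynomial growth is a polynomial.\<close>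

lemma hcoef_line_polynomial: "\<exists>p. degree p \<le> k \<and> (\<forall>\<mu>. hcoef g k (a + \<mu> *s b) = poly p \<mu>)"
proof -
  define f where "f \<mu> = hcoef g k (a + \<mu> *s b)" for \<mu>
  have "f \<xi> = (\<Sum>j\<le>k. (deriv ^^ j) f 0 / fact j * \<xi> ^ j)" for \<xi>
  proof (rule Liouville_polynomial)
    show "f holomorphic_on UNIV" unfolding f_def by (rule hcoef_holomorphic_line)
    fix \<mu> :: complex assume \<mu>: "1 \<le> cmod \<mu>"
    have "norm (a + \<mu> *s b) \<le> norm a * 1 + cmod \<mu> * norm b"
      using norm_triangle_ineq [of a "\<mu> *s b"] by (simp add: norm_smult)
    also have "\<dots> \<le> norm a * cmod \<mu> + cmod \<mu> * norm b"
      using \<mu> by (intro add_right_mono mult_left_mono) auto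
    finally have "norm (a + \<mu> *s b) \<le> (norm a + norm b) * cmod \<mu>" by (simp add: algebra_simps)
    then have "cmod (f \<mu>) \<le> M * ((norm a + norm b) * cmod \<mu>) ^ k"
      unfolding f_def using M_nonneg
      by (intro order_trans [OF hcoef_bound] mult_left_mono power_mono) auto
    then show "cmod (f \<mu>) \<le> (M * (norm a + norm b) ^ k) * cmod \<mu> ^ k"
      by (simp add: power_mult_distrib mult.assoc)
  qed
  then have "f \<mu> = poly (\<Sum>j\<le>k. Polynomial.monom ((deriv ^^ j) f 0 / fact j) j) \<mu>" for \<mu>
    by (simp add: poly_sum poly_monom)
  moreover have "degree (\<Sum>j\<le>k. Polynomial.monom ((deriv ^^ j) f 0 / fact j) j) \<le> k"
    by (rule degree_sum_le) (auto intro: order_trans [OF degree_monom_le])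
  ultimately show ?thesis unfolding f_def by blast
qed

end

text \<open>Lagrange interpolation at \<open>0, \<dots>, k\<close>.\<close>

lemma lagrange_basis:
  "\<exists>L :: nat \<Rightarrow> complex poly. \<forall>p. degree p \<le> k \<longrightarrow>
    (\<forall>x. poly p x = (\<Sum>j\<le>k. poly p (of_nat j) * poly (L j) x))"
proof -
  define L :: "nat \<Rightarrow> complex poly" where
    "L j = (\<Prod>i\<in>{..k} - {j}. Polynomial.smult (1 / (of_nat j - of_nat i)) [:- of_nat i, 1:])" for j
  have L: "poly (L j) (of_nat i) = (if i = j then 1 else 0)" if "i \<le> k" "j \<le> k" for i j
  proof (cases "i = j")
    case True
    have "poly (Polynomial.smult (1 / (of_nat j - of_nat l)) [:- of_nat l, 1:]) (of_nat j :: complex) = 1"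
      if "l \<noteq> j" for l
    proof -
      have "poly (Polynomial.smult (1 / (of_nat j - of_nat l)) [:- of_nat l, 1:]) (of_nat j :: complex)
          = 1 / (of_nat j - of_nat l) * (of_nat j - of_nat l)"
        by (simp add: right_diff_distrib diff_divide_distrib)
      then show ?thesis using that by simp
    qed
    then have "poly (L j) (of_nat j) = 1"
      unfolding L_def poly_prod by (intro prod.neutral) simp
    then show ?thesis using True by simp
  next
    case False
    then have "(\<Prod>l\<in>{..k} - {j}. poly (Polynomial.smult (1 / (of_nat j - of_nat l)) [:- of_nat l, 1:]) (of_nat i :: complex)) = 0"
      using that by (intro prod_zero bexI [of _ i]) auto
    then show ?thesis using False by (simp add: L_def poly_prod)
  qed
  have deg: "degree (L j) \<le> k" if "j \<le> k" for j
  proof -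
    have "degree (L j) \<le> (\<Sum>i\<in>{..k} - {j}. 1)"
      unfolding L_def by (intro order_trans [OF degree_prod_sum_le] sum_mono) (auto intro: order_trans [OF degree_smult_le])
    then show ?thesis using that by simp
  qed
  show ?thesis
  proof (intro exI [of _ L] allI impI)
    fix p :: "complex poly" and x assume p: "degree p \<le> k"
    have "p = (\<Sum>j\<le>k. Polynomial.smult (poly p (of_nat j)) (L j))"
    proof (rule poly_eqI_degree [where A = "of_nat ` {..k}"])
      show "poly p x = poly (\<Sum>j\<le>k. Polynomial.smult (poly p (of_nat j)) (L j)) x"
        if "x \<in> of_nat ` {..k}" for x
      proof -
        obtain i where i: "i \<le> k" "x = of_nat i" using \<open>x \<in> of_nat ` {..k}\<close> by auto
        have "poly (\<Sum>j\<le>k. Polynomial.smult (poly p (of_nat j)) (L j)) x = (\<Sum>j\<le>k. if j = i then poly p (of_nat j) else 0)"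
          unfolding poly_sum using i by (intro sum.cong refl) (auto simp: L)
        then show ?thesis using i by simp
      qed
      have card: "card ((of_nat :: nat \<Rightarrow> complex) ` {..k}) = Suc k"
        by (subst card_image) (auto simp: inj_on_def)
      show "degree p < card ((of_nat :: nat \<Rightarrow> complex) ` {..k})" using p by (simp add: card)
      have "degree (\<Sum>j\<le>k. Polynomial.smult (poly p (of_nat j)) (L j)) \<le> k"
        using deg by (intro degree_sum_le) (auto intro: order_trans [OF degree_smult_le])
      then show "degree (\<Sum>j\<le>k. Polynomial.smult (poly p (of_nat j)) (L j)) < card ((of_nat :: nat \<Rightarrow> complex) ` {..k})"
        by (simp add: card)
    qed
    then have "poly p x = poly (\<Sum>j\<le>k. Polynomial.smult (poly p (of_nat j)) (L j)) x" by (rule arg_cong)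
    then show "poly p x = (\<Sum>j\<le>k. poly p (of_nat j) * poly (L j) x)" by (simp add: poly_sum)
  qed
qed

lemma poly_fun_coord_poly: "poly_fun (degree p) (\<lambda>z :: 'n::finite cspace. poly p (vec_nth z i))"
proof -
  have eq: "poly p (vec_nth z i) = (\<Sum>j\<le>degree p. Polynomial.coeff p j * vec_nth z i ^ j)" for z :: "'n cspace"
    by (rule poly_altdef)
  have "poly_fun (degree p) (\<lambda>z :: 'n cspace. vec_nth z i ^ j)" if "j \<le> degree p" for j
    by (rule poly_fun_mono [OF poly_fun_power [OF poly_fun_coord]]) (use that in simp)
  then show ?thesis
    unfolding eq by (intro poly_fun_sum poly_fun_cmult) auto
qed

text \<open>A function that is a polynomial of bounded degree in each coordinate separately is a
  polynomial: interpolate in one coordinate after the other.\<close>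

lemma separately_polynomial_imp_poly_fun:
  fixes f :: "'n::finite cspace \<Rightarrow> complex"
  assumes sep: "\<And>a i. \<exists>p. degree p \<le> k \<and> (\<forall>\<mu>. f (a + \<mu> *s axis i 1) = poly p \<mu>)"
  shows "\<exists>m. poly_fun m f"
proof -
  obtain L :: "nat \<Rightarrow> complex poly" where L: "\<forall>p. degree p \<le> k \<longrightarrow>
      (\<forall>x. poly p x = (\<Sum>j\<le>k. poly p (of_nat j) * poly (L j) x))"
    using lagrange_basis [of k] by (elim exE) (rule that)
  define merge :: "'n set \<Rightarrow> 'n cspace \<Rightarrow> 'n cspace \<Rightarrow> 'n cspace"
    where "merge A z w = vec_lambda (\<lambda>i. if i \<in> A then vec_nth z i else vec_nth w i)" for A z w
  have "\<forall>w. \<exists>m. poly_fun m (\<lambda>z. f (merge A z w))" if "finite A" for A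
    using that
  proof (induction A rule: finite_induct)
    case empty
    have "merge {} z w = w" for z w by (simp add: merge_def)
    then show ?case by (intro allI exI [of _ 0]) (simp add: poly_fun_const)
  next
    case (insert i A)
    show ?case
    proof
      fix w :: "'n cspace"
      define wj :: "nat \<Rightarrow> 'n cspace" where "wj j = vec_lambda (\<lambda>l. if l = i then of_nat j else vec_nth w l)" for j :: nat
      define m where "m j = (SOME m. poly_fun m (\<lambda>z. f (merge A z (wj j))))" for j
      have m: "poly_fun (m j) (\<lambda>z. f (merge A z (wj j)))" for j
        unfolding m_def by (rule someI_ex) (rule spec [OF insert.IH])
      have eq: "f (merge (insert i A) z w) = (\<Sum>j\<le>k. f (merge A z (wj j)) * poly (L j) (vec_nth z i))" for z
      proof -
        define a where "a = vec_lambda (\<lambda>l. if l = i then 0 else vec_nth (merge A z w) l)"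
        obtain p where p: "degree p \<le> k" "\<And>\<mu>. f (a + \<mu> *s axis i 1) = poly p \<mu>"
          using sep [of a i] by (elim exE conjE) (rule that, assumption, rule spec)
        have 1: "merge (insert i A) z w = a + vec_nth z i *s axis i 1"
          using insert.hyps by (auto simp: Finite_Cartesian_Product.vec_eq_iff merge_def a_def axis_def)
        have 2: "merge A z (wj j) = a + of_nat j *s axis i 1" for j
          using insert.hyps by (auto simp: Finite_Cartesian_Product.vec_eq_iff merge_def a_def axis_def wj_def)
        show ?thesis
          unfolding 1 2 p(2) using L p(1) by simp
      qed
      show "\<exists>m. poly_fun m (\<lambda>z. f (merge (insert i A) z w))"
      proof (intro exI)
        show "poly_fun (\<Sum>j\<le>k. m j + degree (L j)) (\<lambda>z. f (merge (insert i A) z w))"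
          unfolding eq
        proof (rule poly_fun_sum)
          fix j assume j: "j \<in> {..k}"
          have "poly_fun (m j + degree (L j)) (\<lambda>z. f (merge A z (wj j)) * poly (L j) (vec_nth z i))"
            by (intro poly_fun_mult m poly_fun_coord_poly)
          moreover have "m j + degree (L j) \<le> (\<Sum>j\<le>k. m j + degree (L j))"
            using j by (intro member_le_sum) auto
          ultimately show "poly_fun (\<Sum>j\<le>k. m j + degree (L j)) (\<lambda>z. f (merge A z (wj j)) * poly (L j) (vec_nth z i))"
            by (rule poly_fun_mono)
        qed
      qed
    qed
  qed
  from spec [OF this [OF finite [of UNIV]]]
  have "\<exists>m. poly_fun m (\<lambda>z. f (merge UNIV z 0))" .
  moreover have "merge UNIV z 0 = z" for z by (simp add: merge_def)
  ultimately show ?thesis by (simp only:)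
qed

lemma homogeneous_orthogonal:
  fixes f h :: "'n::finite cspace \<Rightarrow> complex"
  assumes cont: "continuous_on (sphere 0 1) f" "continuous_on (sphere 0 1) h"
    and hom: "\<And>c z. f (c *s z) = c ^ j * f z" "\<And>c z. h (c *s z) = c ^ k * h z" and "j \<noteq> k"
  shows "(\<integral>\<zeta>. f \<zeta> * cnj (h \<zeta>) \<partial>sphere_measure) = 0"
proof -
  obtain c where c: "cmod c = 1" "c ^ j * cnj (c ^ k) \<noteq> 1"
    using \<open>j \<noteq> k\<close> by (rule exists_separating_phase)
  show ?thesis
    by (rule eigenfunctions_orthogonal [OF unitary_phase [OF c(1)] cont hom c(2)])
qed

context bounded_holomorphic
begin

lemma hcoef_poly_fun: "\<exists>m. poly_fun m (hcoef g k)"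
  using separately_polynomial_imp_poly_fun hcoef_line_polynomial by blast

lemma continuous_hcoef [continuous_intros]: "continuous_on S (hcoef g k)"
  using hcoef_poly_fun [of k] continuous_on_poly_fun by blast

lemma sphere_norm2_hcoef_sum:
  "finite A \<Longrightarrow> sphere_norm2 (\<lambda>\<zeta>. \<Sum>k\<in>A. c k * hcoef g k \<zeta>) = (\<Sum>k\<in>A. (cmod (c k))\<^sup>2 * sphere_norm2 (hcoef g k))"
  by (rule sphere_norm2_orthogonal_sum)
     (auto intro: continuous_hcoef homogeneous_orthogonal hcoef_homogeneous)

lemma hcoef_partial_sum_bound:
  assumes "norm \<zeta> \<le> 1" "0 \<le> r" "r < 1"
  shows "cmod (\<Sum>k<m. of_real r ^ k * hcoef g k \<zeta>) \<le> M / (1 - r)"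
proof -
  have "cmod (\<Sum>k<m. of_real r ^ k * hcoef g k \<zeta>) \<le> (\<Sum>k<m. M * r ^ k)"
  proof (intro order_trans [OF norm_sum] sum_mono)
    fix k
    have "cmod (hcoef g k \<zeta>) \<le> M * 1"
      using M_nonneg assms by (intro order_trans [OF hcoef_bound] mult_left_mono power_le_one) auto
    then have "r ^ k * cmod (hcoef g k \<zeta>) \<le> r ^ k * M"
      using assms by (intro mult_left_mono) auto
    then show "cmod (of_real r ^ k * hcoef g k \<zeta>) \<le> M * r ^ k"
      using assms by (simp add: norm_mult norm_power mult.commute)
  qed
  also have "\<dots> = M * (\<Sum>k<m. r ^ k)" by (simp add: sum_distrib_left)
  also have "\<dots> \<le> M * (\<Sum>k. r ^ k)"
    using assms M_nonneg by (intro mult_left_mono sum_le_suminf summable_geometric) auto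
  also have "\<dots> = M / (1 - r)" using assms by (simp add: suminf_geometric)
  finally show ?thesis .
qed

lemma hcoef_partial_sum_lim:
  assumes "norm \<zeta> \<le> 1" "0 \<le> r" "r < 1"
  shows "(\<lambda>m. \<Sum>k<m. of_real r ^ k * hcoef g k \<zeta>) \<longlonglongrightarrow> g (of_real r *s \<zeta>)"
proof -
  have "r * norm \<zeta> \<le> r * 1" using assms by (intro mult_left_mono) auto
  then have "norm (of_real r *s \<zeta>) < 1" using assms by (simp add: norm_smult)
  from hcoef_sums [OF this] show ?thesis by (simp add: sums_def mult.commute)
qed

text \<open>Orthogonality of the components gives Parseval's identity on the sphere of radius \<open>r < 1\<close>,
  where the expansion converges uniformly; then \<open>r\<close> tends to \<open>1\<close>.\<close>

lemma sphere_norm2_hcoef_le: "(\<Sum>k<n. sphere_norm2 (hcoef g k)) \<le> M\<^sup>2"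
proof (rule tendsto_upperbound)
  show "((\<lambda>r. \<Sum>k<n. (r ^ k)\<^sup>2 * sphere_norm2 (hcoef g k)) \<longlongrightarrow> (\<Sum>k<n. sphere_norm2 (hcoef g k))) (at_left 1)"
    by (rule tendsto_eq_intros refl | simp)+
  have "(\<Sum>k<n. (r ^ k)\<^sup>2 * sphere_norm2 (hcoef g k)) \<le> M\<^sup>2" if r: "0 < r" "r < 1" for r
  proof -
    define S where "S m \<zeta> = (\<Sum>k<m. of_real r ^ k * hcoef g k \<zeta>)" for m and \<zeta> :: "'n cspace"
    have S: "sphere_norm2 (S m) = (\<Sum>k<m. (r ^ k)\<^sup>2 * sphere_norm2 (hcoef g k))" for m
      unfolding S_def [abs_def] by (subst sphere_norm2_hcoef_sum) (use r in \<open>auto simp: norm_power\<close>)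
    have cont: "continuous_on (sphere 0 1) (\<lambda>\<zeta> :: 'n cspace. g (of_real r *s \<zeta>))"
      by (rule continuous_on_compose2 [OF continuous]) (use r in \<open>auto intro!: continuous_intros simp: norm_smult\<close>)
    have "(\<lambda>m. sphere_norm2 (S m)) \<longlonglongrightarrow> sphere_norm2 (\<lambda>\<zeta>. g (of_real r *s \<zeta>))"
      unfolding sphere_norm2_def
    proof (rule integral_dominated_convergence)
      show "(\<lambda>\<zeta> :: 'n cspace. (cmod (g (of_real r *s \<zeta>)))\<^sup>2) \<in> borel_measurable sphere_measure"
        by (intro borel_measurable_sphere_cont continuous_intros cont)
      show "(\<lambda>\<zeta>. (cmod (S m \<zeta>))\<^sup>2) \<in> borel_measurable sphere_measure" for m
        unfolding S_def by (intro borel_measurable_sphere_cont continuous_intros)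
      show "AE \<zeta> in sphere_measure. (\<lambda>m. (cmod (S m \<zeta>))\<^sup>2) \<longlonglongrightarrow> (cmod (g (of_real r *s \<zeta>)))\<^sup>2"
        unfolding S_def using r by (intro AE_I2 tendsto_intros hcoef_partial_sum_lim) auto
      show "AE \<zeta> in sphere_measure. norm ((cmod (S m \<zeta>))\<^sup>2) \<le> (M / (1 - r))\<^sup>2" for m
        unfolding S_def using r
        by (intro AE_I2) (simp add: power_mono hcoef_partial_sum_bound)
    qed simp
    then have lim: "(\<lambda>m. \<Sum>k<m. (r ^ k)\<^sup>2 * sphere_norm2 (hcoef g k)) \<longlonglongrightarrow> sphere_norm2 (\<lambda>\<zeta>. g (of_real r *s \<zeta>))"
      by (simp add: S)
    have "(\<Sum>k<n. (r ^ k)\<^sup>2 * sphere_norm2 (hcoef g k)) \<le> sphere_norm2 (\<lambda>\<zeta>. g (of_real r *s \<zeta>))"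
      by (rule incseq_le [OF _ lim]) (auto intro!: incseq_SucI mult_nonneg_nonneg sphere_norm2_nonneg)
    also have "\<dots> \<le> (\<integral>\<zeta>. M\<^sup>2 \<partial>(sphere_measure :: 'n cspace measure))"
      unfolding sphere_norm2_def
    proof (rule integral_mono)
      show "integrable sphere_measure (\<lambda>\<zeta> :: 'n cspace. (cmod (g (of_real r *s \<zeta>)))\<^sup>2)"
        by (intro integrable_sphere_cont continuous_intros cont)
      show "(cmod (g (of_real r *s \<zeta>)))\<^sup>2 \<le> M\<^sup>2" if "\<zeta> \<in> space sphere_measure" for \<zeta> :: "'n cspace"
        using that r by (intro power_mono bounded) (auto simp: norm_smult)
    qed simp
    also have "\<dots> = M\<^sup>2" using sphere.prob_space [where 'a = "'n cspace"] by simp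
    finally show ?thesis .
  qed
  then show "\<forall>\<^sub>F r in at_left 1. (\<Sum>k<n. (r ^ k)\<^sup>2 * sphere_norm2 (hcoef g k)) \<le> M\<^sup>2"
    by (intro eventually_at_leftI [of 0]) auto
qed simp

end

section \<open>Existence and measurability of boundary values\<close>

text \<open>Radial limits are taken along one fixed sequence of radii, because dominated convergence and
  measurability of limits are statements about sequences.\<close>

definition rad :: "nat \<Rightarrow> real" where
  "rad n = 1 - 1 / (real n + 2)"

lemma rad: "0 < rad n" "rad n < 1"
  by (auto simp: rad_def field_simps)

lemma rad_lim: "rad \<longlonglongrightarrow> 1"
proof -
  have eq: "rad n = 1 - inverse (real (Suc (Suc n)))" for n
    by (simp add: rad_def inverse_eq_divide)
  have "(\<lambda>n. 1 - inverse (real (Suc (Suc n)))) \<longlonglongrightarrow> 1 - 0"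
    by (intro tendsto_diff tendsto_const LIMSEQ_Suc [OF LIMSEQ_inverse_real_of_nat])
  then show ?thesis unfolding eq [symmetric] by simp
qed

lemma koranyi_region_mono: "c \<le> c' \<Longrightarrow> koranyi_region c \<zeta> \<subseteq> koranyi_region c' \<zeta>"
proof
  fix z assume "c \<le> c'" and z: "z \<in> koranyi_region c \<zeta>"
  then have nz: "norm z < 1" by (simp add: koranyi_region_def)
  then have "0 \<le> 1 - (norm z)\<^sup>2" by (simp add: abs_square_le_1)
  then have "c / 2 * (1 - (norm z)\<^sup>2) \<le> c' / 2 * (1 - (norm z)\<^sup>2)"
    using \<open>c \<le> c'\<close> by (intro mult_right_mono) auto
  then show "z \<in> koranyi_region c' \<zeta>"
    using z by (simp add: koranyi_region_def)
qed

lemma radial_in_koranyi_region: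
  assumes "norm \<zeta> = 1" "0 < r" "r < 1" "2 \<le> c"
  shows "r *\<^sub>R \<zeta> \<in> koranyi_region c \<zeta>"
proof -
  have "herm (r *\<^sub>R \<zeta>) \<zeta> = of_real r"
    using assms by (simp add: herm_scaleR_left herm_self)
  then have "cmod (1 - herm (r *\<^sub>R \<zeta>) \<zeta>) = cmod (of_real (1 - r))" by simp
  also have "\<dots> = 1 - r" using assms unfolding norm_of_real by simp
  also have "\<dots> < 1 - r\<^sup>2"
    using assms by (simp add: power2_eq_square)
  finally have "r *\<^sub>R \<zeta> \<in> koranyi_region 2 \<zeta>"
    using assms by (simp add: koranyi_region_def)
  then show ?thesis using koranyi_region_mono [OF assms(4)] by (rule subsetD [rotated])
qed

lemma has_K_limit_radial:
  assumes "norm \<zeta> = 1" "has_K_limit g \<zeta> l"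
  shows "(\<lambda>n. g (rad n *\<^sub>R \<zeta>)) \<longlonglongrightarrow> l"
proof -
  have lim: "(g \<longlongrightarrow> l) (at \<zeta> within koranyi_region 2 \<zeta>)"
    using assms(2) by (simp add: has_K_limit_def)
  have "(\<lambda>n. rad n *\<^sub>R \<zeta>) \<longlonglongrightarrow> 1 *\<^sub>R \<zeta>"
    by (intro tendsto_intros rad_lim)
  then have "filterlim (\<lambda>n. rad n *\<^sub>R \<zeta>) (at \<zeta> within koranyi_region 2 \<zeta>) sequentially"
  proof (intro filterlim_at [THEN iffD2] conjI always_eventually allI)
    fix n
    show "rad n *\<^sub>R \<zeta> \<in> koranyi_region 2 \<zeta>"
      using assms(1) rad by (intro radial_in_koranyi_region) auto
    show "rad n *\<^sub>R \<zeta> \<noteq> \<zeta>"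
    proof
      assume "rad n *\<^sub>R \<zeta> = \<zeta>"
      then have "norm (rad n *\<^sub>R \<zeta>) = norm \<zeta>" by simp
      then show False using assms(1) rad [of n] by simp
    qed
  qed simp
  with lim show ?thesis by (rule filterlim_compose)
qed

definition oscillation_le :: "('n::finite cspace \<Rightarrow> complex) \<Rightarrow> nat \<Rightarrow> nat \<Rightarrow> real \<Rightarrow> 'n cspace \<Rightarrow> bool" where
  "oscillation_le g c n e \<zeta> \<longleftrightarrow>
     (\<forall>z\<in>koranyi_region (real c + 2) \<zeta>. \<forall>z'\<in>koranyi_region (real c + 2) \<zeta>.
       dist z \<zeta> < 1 / (real n + 1) \<longrightarrow> dist z' \<zeta> < 1 / (real n + 1) \<longrightarrow> cmod (g z - g z') \<le> e)"

lemma oscillation_leD: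
  "oscillation_le g c n e \<zeta> \<Longrightarrow> z \<in> koranyi_region (real c + 2) \<zeta> \<Longrightarrow> z' \<in> koranyi_region (real c + 2) \<zeta> \<Longrightarrow>
   dist z \<zeta> < 1 / (real n + 1) \<Longrightarrow> dist z' \<zeta> < 1 / (real n + 1) \<Longrightarrow> cmod (g z - g z') \<le> e"
  unfolding oscillation_le_def by blast

text \<open>The Cauchy form of the existence of a K-limit.  All parameters are natural numbers, so that
  the points where it holds form a countable combination of open sets.\<close>

definition K_cauchy :: "('n::finite cspace \<Rightarrow> complex) \<Rightarrow> 'n cspace \<Rightarrow> bool" where
  "K_cauchy g \<zeta> \<longleftrightarrow> (\<forall>c m::nat. \<exists>n. oscillation_le g c n (1 / (real m + 1)) \<zeta>)"

lemma has_K_limit_imp_K_cauchy: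
  assumes "norm \<zeta> = 1" "has_K_limit g \<zeta> l"
  shows "K_cauchy g \<zeta>"
  unfolding K_cauchy_def
proof (intro allI)
  fix c m :: nat
  have "(g \<longlongrightarrow> l) (at \<zeta> within koranyi_region (real c + 2) \<zeta>)"
    using assms(2) by (simp add: has_K_limit_def)
  from tendstoD [OF this, of "1 / (2 * (real m + 1))"]
  have "\<forall>\<^sub>F z in at \<zeta> within koranyi_region (real c + 2) \<zeta>. dist (g z) l < 1 / (2 * (real m + 1))"
    by simp
  then obtain d where d: "d > 0" "\<And>z. z \<in> koranyi_region (real c + 2) \<zeta> \<Longrightarrow> z \<noteq> \<zeta> \<Longrightarrow> dist z \<zeta> < d \<Longrightarrow>
      dist (g z) l < 1 / (2 * (real m + 1))"
    unfolding eventually_at by (elim exE conjE) (rule that, assumption, simp)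
  obtain n where n: "inverse (real (Suc n)) < d" using reals_Archimedean [OF d(1)] by (elim exE) (rule that)
  have near: "dist (g z) l < 1 / (2 * (real m + 1))"
    if "z \<in> koranyi_region (real c + 2) \<zeta>" "dist z \<zeta> < 1 / (real n + 1)" for z
  proof (rule d(2) [OF that(1)])
    show "z \<noteq> \<zeta>" using that(1) assms(1) by (auto simp: koranyi_region_def)
    show "dist z \<zeta> < d" using that(2) n by (simp add: inverse_eq_divide add.commute)
  qed
  show "\<exists>n. oscillation_le g c n (1 / (real m + 1)) \<zeta>"
    unfolding oscillation_le_def
  proof (intro exI [of _ n] ballI impI)
    fix z z' assume z: "z \<in> koranyi_region (real c + 2) \<zeta>" "z' \<in> koranyi_region (real c + 2) \<zeta>"
      "dist z \<zeta> < 1 / (real n + 1)" "dist z' \<zeta> < 1 / (real n + 1)"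
    have "cmod (g z - g z') \<le> dist (g z) l + dist (g z') l"
      unfolding dist_norm [symmetric] by (rule dist_triangle2)
    also have "\<dots> \<le> 1 / (2 * (real m + 1)) + 1 / (2 * (real m + 1))"
      using near [OF z(1,3)] near [OF z(2,4)] by simp
    also have "\<dots> = 1 / (real m + 1)" by (simp add: field_simps)
    finally show "cmod (g z - g z') \<le> 1 / (real m + 1)" .
  qed
qed

lemma K_cauchy_imp_has_K_limit:
  assumes \<zeta>: "norm \<zeta> = 1" and K: "K_cauchy g \<zeta>"
  shows "\<exists>l. has_K_limit g \<zeta> l"
proof -
  define s where "s n = rad n *\<^sub>R \<zeta>" for n
  have s_in: "s n \<in> koranyi_region (real c + 2) \<zeta>" for n and c :: nat
    unfolding s_def using \<zeta> rad by (intro radial_in_koranyi_region) auto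
  have "s \<longlonglongrightarrow> 1 *\<^sub>R \<zeta>"
    unfolding s_def by (intro tendsto_intros rad_lim)
  then have s_lim: "s \<longlonglongrightarrow> \<zeta>" by simp
  have ev: "\<forall>\<^sub>F k in sequentially. dist (s k) \<zeta> < 1 / (real n + 1)" for n :: nat
    using tendstoD [OF s_lim, of "1 / (real n + 1)"] by simp
  have "Cauchy (\<lambda>k. g (s k))"
  proof (rule CauchyI)
    fix e :: real assume "0 < e"
    then obtain m where m: "inverse (real (Suc m)) < e" by (rule reals_Archimedean [THEN exE]) (rule that)
    obtain n where n: "oscillation_le g 0 n (1 / (real m + 1)) \<zeta>"
      using K [unfolded K_cauchy_def, rule_format, of 0 m] by (elim exE) (rule that)
    obtain N where N: "\<forall>k\<ge>N. dist (s k) \<zeta> < 1 / (real n + 1)"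
      using ev [of n] unfolding eventually_sequentially by (elim exE) (rule that)
    show "\<exists>M. \<forall>j\<ge>M. \<forall>k\<ge>M. cmod (g (s j) - g (s k)) < e"
    proof (intro exI [of _ N] allI impI)
      fix j k assume "N \<le> j" "N \<le> k"
      then have "cmod (g (s j) - g (s k)) \<le> 1 / (real m + 1)"
        using N by (intro oscillation_leD [OF n s_in s_in]) auto
      also have "\<dots> < e" using m by (simp add: inverse_eq_divide add.commute)
      finally show "cmod (g (s j) - g (s k)) < e" .
    qed
  qed
  then obtain l where l: "(\<lambda>k. g (s k)) \<longlonglongrightarrow> l"
    using Cauchy_convergent convergent_def by blast
  have lim: "(g \<longlongrightarrow> l) (at \<zeta> within koranyi_region (real c + 2) \<zeta>)" for c :: nat
  proof (rule tendstoI)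
    fix e :: real assume "0 < e"
    then obtain m where m: "inverse (real (Suc m)) < e" by (rule reals_Archimedean [THEN exE]) (rule that)
    obtain n where n: "oscillation_le g c n (1 / (real m + 1)) \<zeta>"
      using K [unfolded K_cauchy_def, rule_format, of c m] by (elim exE) (rule that)
    have "dist (g z) l < e" if z: "z \<in> koranyi_region (real c + 2) \<zeta>" "dist z \<zeta> < 1 / (real n + 1)" for z
    proof -
      have "(\<lambda>k. dist (g z) (g (s k))) \<longlonglongrightarrow> dist (g z) l"
        by (intro tendsto_intros l)
      moreover have "\<forall>\<^sub>F k in sequentially. dist (g z) (g (s k)) \<le> 1 / (real m + 1)"
        using ev [of n]
      proof eventually_elim
        case (elim k)
        then show ?case using oscillation_leD [OF n z(1) s_in z(2)] by (simp add: dist_norm)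
      qed
      ultimately have "dist (g z) l \<le> 1 / (real m + 1)"
        by (rule tendsto_upperbound) simp
      also have "\<dots> < e" using m by (simp add: inverse_eq_divide add.commute)
      finally show ?thesis .
    qed
    then show "\<forall>\<^sub>F z in at \<zeta> within koranyi_region (real c + 2) \<zeta>. dist (g z) l < e"
      unfolding eventually_at by (intro exI [of _ "1 / (real n + 1)"]) simp
  qed
  have "has_K_limit g \<zeta> l"
    unfolding has_K_limit_def
  proof (intro allI impI)
    fix c :: real assume "1 < c"
    obtain c' :: nat where "c \<le> real c'" using real_arch_simple by blast
    then have "koranyi_region c \<zeta> \<subseteq> koranyi_region (real c' + 2) \<zeta>"
      by (intro koranyi_region_mono) simp
    then show "(g \<longlongrightarrow> l) (at \<zeta> within koranyi_region c \<zeta>)"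
      by (rule tendsto_within_subset [OF lim])
  qed
  then show ?thesis by (rule exI)
qed

lemma sets_K_cauchy: "{\<zeta> \<in> sphere 0 1. K_cauchy g \<zeta>} \<in> sets sphere_measure"
proof -
  define B where "B c m n = {\<zeta> \<in> sphere 0 1. \<zeta> \<in> (\<Union>(z, z')\<in>{(z, z'). norm z < 1 \<and> norm z' < 1 \<and> \<not> cmod (g z - g z') \<le> 1 / (real m + 1)}.
      {\<zeta>. cmod (1 - herm z \<zeta>) < (real c + 2) / 2 * (1 - (norm z)\<^sup>2)} \<inter>
      {\<zeta>. cmod (1 - herm z' \<zeta>) < (real c + 2) / 2 * (1 - (norm z')\<^sup>2)} \<inter>
      {\<zeta>. dist z \<zeta> < 1 / (real n + 1)} \<inter> {\<zeta>. dist z' \<zeta> < 1 / (real n + 1)})}" for c m n :: nat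
  have B: "B c m n \<in> sets sphere_measure" for c m n
    unfolding B_def
    by (intro sets_sphere_open_Int open_UN ballI)
       (auto simp only: split_paired_all prod.case intro!: open_Int open_Collect_less continuous_intros)
  \<comment> \<open>\<open>B c m n\<close> is the relatively open set of points where the oscillation exceeds \<open>1 / (m + 1)\<close>.\<close>
  have eq: "{\<zeta> \<in> sphere 0 1. K_cauchy g \<zeta>} = space sphere_measure \<inter> (\<Inter>c. \<Inter>m. \<Union>n. space sphere_measure - B c m n)"
  proof (rule Set.set_eqI)
    fix \<zeta> :: "'a cspace"
    have "\<zeta> \<in> B c m n \<longleftrightarrow> \<zeta> \<in> sphere 0 1 \<and> \<not> oscillation_le g c n (1 / (real m + 1)) \<zeta>" for c m n
      unfolding B_def oscillation_le_def koranyi_region_def by fastforce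
    then show "\<zeta> \<in> {\<zeta> \<in> sphere 0 1. K_cauchy g \<zeta>} \<longleftrightarrow>
        \<zeta> \<in> space sphere_measure \<inter> (\<Inter>c. \<Inter>m. \<Union>n. space sphere_measure - B c m n)"
      unfolding K_cauchy_def space_sphere_measure by (cases "norm \<zeta> = 1") simp_all
  qed
  have "(\<Inter>c. \<Inter>m. \<Union>n. space sphere_measure - B c m n) \<in> sets sphere_measure"
    by (intro sets.countable_INT sets.countable_UN image_subsetI sets.Diff sets.top B UNIV_not_empty)
  then show ?thesis
    unfolding eq by (intro sets.Int sets.top)
qed

context bounded_holomorphic
begin

definition taylor :: "nat \<Rightarrow> 'n cspace \<Rightarrow> complex" where
  "taylor n z = (\<Sum>k<n. hcoef g k z)"

lemma ex_poly_fun_taylor: "\<exists>m. poly_fun m (taylor n)"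
  unfolding taylor_def [abs_def] by (intro ex_poly_fun_sum hcoef_poly_fun finite_lessThan)

lemma taylor_lim: "norm z < 1 \<Longrightarrow> (\<lambda>n. taylor n z) \<longlonglongrightarrow> g z"
  using hcoef_sums [of 1 z] by (simp add: taylor_def sums_def)

lemma continuous_taylor [continuous_intros]: "continuous_on S (taylor n)"
  unfolding taylor_def [abs_def] by (intro continuous_intros)

lemma summable_sphere_norm2_hcoef: "summable (\<lambda>k. sphere_norm2 (hcoef g k))"
  by (rule bounded_imp_summable [of _ "M\<^sup>2"])
     (use sphere_norm2_hcoef_le [of "Suc _"] in \<open>simp_all add: sphere_norm2_nonneg lessThan_Suc_atMost\<close>)

definition tail :: "nat \<Rightarrow> real" where
  "tail j = (\<Sum>k. sphere_norm2 (hcoef g (k + j)))"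

lemma tail_lim: "tail \<longlonglongrightarrow> 0"
  unfolding tail_def [abs_def] using suminf_exist_split2 [OF summable_sphere_norm2_hcoef] .

lemma sphere_norm2_taylor_diff_le:
  assumes "j \<le> n"
  shows "sphere_norm2 (\<lambda>\<zeta>. taylor n \<zeta> - taylor j \<zeta>) \<le> tail j"
proof -
  have "taylor n \<zeta> - taylor j \<zeta> = (\<Sum>k\<in>{j..<n}. 1 * hcoef g k \<zeta>)" for \<zeta>
    unfolding taylor_def lessThan_atLeast0 using sum_diff_nat_ivl [of 0 j n "\<lambda>k. hcoef g k \<zeta>"] assms by simp
  then have "sphere_norm2 (\<lambda>\<zeta>. taylor n \<zeta> - taylor j \<zeta>) = (\<Sum>k\<in>{j..<n}. (cmod 1)\<^sup>2 * sphere_norm2 (hcoef g k))"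
    by (simp only:) (rule sphere_norm2_hcoef_sum, simp)
  also have "\<dots> = (\<Sum>k<n - j. sphere_norm2 (hcoef g (k + j)))"
    using sum.shift_bounds_nat_ivl [of "\<lambda>k. sphere_norm2 (hcoef g k)" 0 j "n - j"] assms
    by (simp add: lessThan_atLeast0)
  also have "\<dots> \<le> tail j"
    unfolding tail_def
    by (rule sum_le_suminf) (auto intro: summable_ignore_initial_segment summable_sphere_norm2_hcoef sphere_norm2_nonneg)
  finally show ?thesis .
qed

text \<open>The polynomials \<open>taylor n\<close> converge to \<open>g\<close> in the ball and are Cauchy in the norm controlled by
  the maximal inequality.\<close>

lemma maximal_tail:
  assumes c: "1 < c" and e: "0 < e"
  shows "\<exists>C>0. \<forall>j. measure sphere_measure {\<zeta> \<in> sphere 0 1. \<exists>z\<in>koranyi_region c \<zeta>. e < cmod (g z - taylor j z)} \<le> C * tail j"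
proof -
  obtain C where C: "C > 0" "\<forall>(f :: 'n cspace \<Rightarrow> complex) n \<tau>. poly_fun n f \<longrightarrow> 0 < \<tau> \<longrightarrow>
    measure sphere_measure {\<zeta> \<in> sphere 0 1. \<exists>z\<in>koranyi_region c \<zeta>. \<tau> < cmod (f z)} \<le> C / \<tau>\<^sup>2 * sphere_norm2 f"
    using maximal_inequality [OF c, where 'n = 'n] by (elim exE conjE) (rule that)
  show ?thesis
  proof (intro exI [of _ "C / e\<^sup>2"] conjI allI)
    show "0 < C / e\<^sup>2" using C(1) e by simp
    fix j
    \<comment> \<open>The maximal inequality is for polynomials: \<open>g\<close> is replaced by \<open>taylor m\<close> for all large \<open>m\<close>.\<close>
    define B where "B n = {\<zeta> \<in> sphere 0 1. \<exists>z\<in>koranyi_region c \<zeta>. \<forall>m\<ge>n. e < cmod (taylor m z - taylor j z)}" for n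
    have B_sets: "B n \<in> sets sphere_measure" for n
      unfolding B_def by (rule sets_koranyi_shadow)
    have B_le: "measure sphere_measure (B n) \<le> C / e\<^sup>2 * tail j" for n
    proof -
      define m where "m = max n j"
      have "B n \<subseteq> {\<zeta> \<in> sphere 0 1. \<exists>z\<in>koranyi_region c \<zeta>. e < cmod (taylor m z - taylor j z)}"
      proof (unfold B_def, intro Collect_mono impI, elim conjE bexE)
        fix \<zeta> z assume "\<zeta> \<in> sphere 0 1" and z: "z \<in> koranyi_region c \<zeta>" "\<forall>m\<ge>n. e < cmod (taylor m z - taylor j z)"
        moreover have "e < cmod (taylor m z - taylor j z)"
          using z(2) by (simp add: m_def)
        ultimately show "\<zeta> \<in> sphere 0 1 \<and> (\<exists>z\<in>koranyi_region c \<zeta>. e < cmod (taylor m z - taylor j z))"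
          by (intro conjI bexI)
      qed
      then have "measure sphere_measure (B n)
          \<le> measure sphere_measure {\<zeta> \<in> sphere 0 1. \<exists>z\<in>koranyi_region c \<zeta>. e < cmod (taylor m z - taylor j z)}"
        by (intro sphere.finite_measure_mono sets_koranyi_shadow)
      also have "\<dots> \<le> C / e\<^sup>2 * sphere_norm2 (\<lambda>z. taylor m z - taylor j z)"
      proof -
        obtain k where k: "poly_fun k (taylor m)" using ex_poly_fun_taylor [of m] by (elim exE) (rule that)
        obtain k' where k': "poly_fun k' (taylor j)" using ex_poly_fun_taylor [of j] by (elim exE) (rule that)
        have "poly_fun (max k k') (\<lambda>z. taylor m z - taylor j z)"
          by (intro poly_fun_diff poly_fun_mono [OF k] poly_fun_mono [OF k']) auto
        then show ?thesis using e by (rule C(2) [rule_format])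
      qed
      also have "\<dots> \<le> C / e\<^sup>2 * tail j"
        using C(1) by (intro mult_left_mono sphere_norm2_taylor_diff_le) (auto simp: m_def)
      finally show ?thesis .
    qed
    have "(\<lambda>n. measure sphere_measure (B n)) \<longlonglongrightarrow> measure sphere_measure (\<Union>n. B n)"
    proof (rule sphere.finite_Lim_measure_incseq)
      show "range B \<subseteq> sets sphere_measure" using B_sets by (rule image_subsetI)
      show "incseq B"
      proof (rule monoI)
        fix n n' :: nat assume "n \<le> n'"
        then have "\<forall>m\<ge>n'. P m" if "\<forall>m\<ge>n. P m" for P using that by simp
        then show "B n \<subseteq> B n'" unfolding B_def
          by (intro Collect_mono impI) (elim conjE bexE, intro conjI bexI)
      qed
    qed
    then have UN: "measure sphere_measure (\<Union>n. B n) \<le> C / e\<^sup>2 * tail j"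
      by (rule LIMSEQ_le_const2) (use B_le in simp)
    have "{\<zeta> \<in> sphere 0 1. \<exists>z\<in>koranyi_region c \<zeta>. e < cmod (g z - taylor j z)} \<subseteq> (\<Union>n. B n)"
    proof
      fix \<zeta> assume "\<zeta> \<in> {\<zeta> \<in> sphere 0 1. \<exists>z\<in>koranyi_region c \<zeta>. e < cmod (g z - taylor j z)}"
      then obtain z where z: "\<zeta> \<in> sphere 0 1" "z \<in> koranyi_region c \<zeta>" "e < cmod (g z - taylor j z)"
        by (elim CollectE conjE bexE) (rule that)
      have "(\<lambda>m. cmod (taylor m z - taylor j z)) \<longlonglongrightarrow> cmod (g z - taylor j z)"
        using z(2) by (intro tendsto_intros taylor_lim) (simp add: koranyi_region_def)
      then have "\<forall>\<^sub>F m in sequentially. e < cmod (taylor m z - taylor j z)"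
        using z(3) by (rule order_tendstoD(1))
      then obtain n where "\<forall>m\<ge>n. e < cmod (taylor m z - taylor j z)"
        unfolding eventually_sequentially by (elim exE) (rule that)
      then have "\<zeta> \<in> B n" unfolding B_def using z by (intro CollectI conjI bexI [of _ z])
      then show "\<zeta> \<in> (\<Union>n. B n)" by (rule UN_I [OF UNIV_I])
    qed
    then have "measure sphere_measure {\<zeta> \<in> sphere 0 1. \<exists>z\<in>koranyi_region c \<zeta>. e < cmod (g z - taylor j z)}
        \<le> measure sphere_measure (\<Union>n. B n)"
      using B_sets by (intro sphere.finite_measure_mono sets.countable_UN) auto
    also note UN
    finally show "measure sphere_measure {\<zeta> \<in> sphere 0 1. \<exists>z\<in>koranyi_region c \<zeta>. e < cmod (g z - taylor j z)}
        \<le> C / e\<^sup>2 * tail j" .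
  qed
qed

text \<open>Near \<open>\<zeta>\<close> the oscillation of \<open>g\<close> in a Koranyi region is at most the oscillation of the
  continuous function \<open>taylor j\<close> plus \<open>2 \<bar>g - taylor j\<bar>\<close>, and by the maximal inequality the latter is small for some
  \<open>j\<close> outside a null set.\<close>

lemma AE_small_oscillation:
  fixes c m :: nat
  shows "AE \<zeta> in sphere_measure. \<exists>n. oscillation_le g c n (1 / (real m + 1)) \<zeta>"
proof -
  define e where "e = 1 / (4 * (real m + 1))"
  have e: "0 < e" by (simp add: e_def)
  define W where "W j = {\<zeta> \<in> sphere 0 1. \<exists>z\<in>koranyi_region (real c + 2) \<zeta>. e < cmod (g z - taylor j z)}" for j
  have W: "W j \<in> sets sphere_measure" for j
    unfolding W_def by (rule sets_koranyi_shadow)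
  have c2: "1 < real c + 2" by simp
  obtain C where C: "C > 0" "\<forall>j. measure sphere_measure (W j) \<le> C * tail j"
    using maximal_tail [OF c2 e, folded W_def] by (elim exE conjE) (rule that)
  have INT: "(\<Inter>j. W j) \<in> sets sphere_measure"
    using W by (intro sets.countable_INT) auto
  have "measure sphere_measure (\<Inter>j. W j) \<le> 0"
  proof (rule LIMSEQ_le_const)
    show "(\<lambda>j. C * tail j) \<longlonglongrightarrow> 0" using tendsto_mult_left [OF tail_lim, of C] by simp
    show "\<exists>N. \<forall>j\<ge>N. measure sphere_measure (\<Inter>j. W j) \<le> C * tail j"
    proof (intro exI [of _ 0] allI impI)
      fix j
      have "measure sphere_measure (\<Inter>j. W j) \<le> measure sphere_measure (W j)"
        by (intro sphere.finite_measure_mono W INT_lower) simp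
      also have "\<dots> \<le> C * tail j" using C(2) by (rule spec)
      finally show "measure sphere_measure (\<Inter>j. W j) \<le> C * tail j" .
    qed
  qed
  then have "emeasure sphere_measure (\<Inter>j. W j) = 0"
    by (simp add: sphere.emeasure_eq_measure measure_le_0_iff)
  then have "(\<Inter>j. W j) \<in> null_sets sphere_measure" using INT by (rule null_setsI)
  from AE_not_in [OF this] AE_space [of sphere_measure]
  show ?thesis
  proof eventually_elim
    case (elim \<zeta>)
    then obtain j where j: "\<zeta> \<notin> W j" by auto
    have \<zeta>: "norm \<zeta> = 1" using elim(2) by simp
    have near: "cmod (g z - taylor j z) \<le> e" if "z \<in> koranyi_region (real c + 2) \<zeta>" for z
      using j that \<zeta> unfolding W_def by (auto simp: not_less)
    have "isCont (taylor j) \<zeta>"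
      using continuous_taylor [of UNIV j] by (simp add: continuous_on_eq_continuous_at)
    from this [unfolded continuous_at_eps_delta, rule_format, OF e]
    obtain d where d: "d > 0" "\<forall>z. dist z \<zeta> < d \<longrightarrow> dist (taylor j z) (taylor j \<zeta>) < e"
      by (elim exE conjE) (rule that)
    obtain n where n: "inverse (real (Suc n)) < d" using reals_Archimedean [OF d(1)] by (elim exE) (rule that)
    show ?case
      unfolding oscillation_le_def
    proof (intro exI [of _ n] ballI impI)
      fix z z' assume z: "z \<in> koranyi_region (real c + 2) \<zeta>" "z' \<in> koranyi_region (real c + 2) \<zeta>"
        "dist z \<zeta> < 1 / (real n + 1)" "dist z' \<zeta> < 1 / (real n + 1)"
      have dq: "dist (taylor j x) (taylor j \<zeta>) < e" if "dist x \<zeta> < 1 / (real n + 1)" for x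
        using that n d(2) by (simp add: inverse_eq_divide add.commute)
      have eq: "g z - g z' = (g z - taylor j z) + (taylor j z - taylor j \<zeta>) - (taylor j z' - taylor j \<zeta>) - (g z' - taylor j z')"
        by simp
      have "cmod (g z - g z') \<le> cmod (g z - taylor j z) + cmod (taylor j z - taylor j \<zeta>) + cmod (taylor j z' - taylor j \<zeta>) + cmod (g z' - taylor j z')"
        unfolding eq
        using norm_triangle_ineq4 [of "(g z - taylor j z) + (taylor j z - taylor j \<zeta>) - (taylor j z' - taylor j \<zeta>)" "g z' - taylor j z'"]
          norm_triangle_ineq4 [of "(g z - taylor j z) + (taylor j z - taylor j \<zeta>)" "taylor j z' - taylor j \<zeta>"]
          norm_triangle_ineq [of "g z - taylor j z" "taylor j z - taylor j \<zeta>"] by linarith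
      also have "\<dots> \<le> 4 * e"
        using near [OF z(1)] near [OF z(2)] dq [OF z(3)] dq [OF z(4)] unfolding dist_norm by linarith
      also have "4 * e = 1 / (real m + 1)" by (simp add: e_def field_simps)
      finally show "cmod (g z - g z') \<le> 1 / (real m + 1)" .
    qed
  qed
qed

lemma AE_K_cauchy: "AE \<zeta> in sphere_measure. K_cauchy g \<zeta>"
  unfolding K_cauchy_def AE_all_countable using AE_small_oscillation by (intro allI)

lemma AE_has_K_limit: "AE \<zeta> in sphere_measure. has_K_limit g \<zeta> (boundary_value g \<zeta>)"
  using AE_K_cauchy AE_space [of sphere_measure]
proof eventually_elim
  case (elim \<zeta>)
  then have \<zeta>: "norm \<zeta> = 1" by simp
  obtain l where "has_K_limit g \<zeta> l"
    using K_cauchy_imp_has_K_limit [OF \<zeta> elim(1)] by (elim exE) (rule that)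
  then show ?case using has_K_limit_imp_boundary_value [OF \<zeta>] by simp
qed

lemma AE_radial_limit: "AE \<zeta> in sphere_measure. (\<lambda>n. g (rad n *\<^sub>R \<zeta>)) \<longlonglongrightarrow> boundary_value g \<zeta>"
  using AE_has_K_limit AE_space [of sphere_measure]
  by eventually_elim (rule has_K_limit_radial, simp_all)

lemma continuous_dilation: "\<bar>r\<bar> < 1 \<Longrightarrow> continuous_on (sphere 0 1) (\<lambda>\<zeta>. g (r *\<^sub>R \<zeta>))"
  by (rule continuous_on_compose2 [OF continuous]) (auto intro!: continuous_intros)

text \<open>The K-limit exists on a Borel set, outside which \<^const>\<open>boundary_value\<close> takes one constant value.\<close>

lemma boundary_value_measurable: "boundary_value g \<in> borel_measurable sphere_measure"
proof -
  define w where "w \<zeta> = (if K_cauchy g \<zeta> then lim (\<lambda>n. g (rad n *\<^sub>R \<zeta>)) else (THE l. False))" for \<zeta>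
  have meas: "w \<in> borel_measurable sphere_measure"
    unfolding w_def
  proof (intro measurable_If borel_measurable_lim_metric borel_measurable_const)
    show "(\<lambda>\<zeta>. g (rad n *\<^sub>R \<zeta>)) \<in> borel_measurable sphere_measure" for n
      using rad [of n] by (intro borel_measurable_sphere_cont continuous_dilation) simp
    show "{x \<in> space sphere_measure. K_cauchy g x} \<in> sets sphere_measure"
      unfolding space_sphere_measure by (rule sets_K_cauchy)
  qed
  have eq: "w \<zeta> = boundary_value g \<zeta>" if "\<zeta> \<in> space sphere_measure" for \<zeta>
  proof -
    have \<zeta>: "norm \<zeta> = 1" using that by simp
    show ?thesis
    proof (cases "K_cauchy g \<zeta>")
      case True
      then obtain l where l: "has_K_limit g \<zeta> l"
        using K_cauchy_imp_has_K_limit [OF \<zeta>] by blast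
      then have "lim (\<lambda>n. g (rad n *\<^sub>R \<zeta>)) = l"
        using has_K_limit_radial [OF \<zeta>] limI by blast
      then show ?thesis
        using True has_K_limit_imp_boundary_value [OF \<zeta> l] by (simp add: w_def)
    next
      case False
      then have "has_K_limit g \<zeta> l = False" for l
        using has_K_limit_imp_K_cauchy [OF \<zeta>] by blast
      then show ?thesis using False by (simp add: w_def boundary_value_def)
    qed
  qed
  show ?thesis
    using meas measurable_cong [of sphere_measure w "boundary_value g" borel, OF eq] by (simp only:)
qed

end

section \<open>Mean values over the sphere\<close>

lemma abs_rad [simp]: "\<bar>rad n\<bar> < 1"
  using rad [of n] by simp

text \<open>Averaging a power series over the \<open>n\<close>-th roots of unity kills all powers that are not
  multiples of \<open>n\<close>.\<close>

lemma sum_roots_of_unity_power: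
  assumes "0 < k" "k < n"
  shows "(\<Sum>j<n. cis (2 * pi * real j / real n) ^ k) = 0"
proof -
  define \<omega> where "\<omega> = cis (2 * pi * real k / real n)"
  have term_eq: "cis (2 * pi * real j / real n) ^ k = \<omega> ^ j" for j
    unfolding \<omega>_def Complex.DeMoivre by (rule arg_cong [where f = cis]) simp
  have "\<omega> ^ n = cis (2 * pi * real k)"
    unfolding \<omega>_def Complex.DeMoivre using assms by (intro arg_cong [where f = cis]) simp
  also have "\<dots> = cis (2 * pi) ^ k"
    unfolding Complex.DeMoivre by (rule arg_cong [where f = cis]) simp
  also have "\<dots> = 1" by simp
  finally have 1: "\<omega> ^ n = 1" .
  have "\<omega> \<noteq> 1"
  proof
    assume "\<omega> = 1"
    then have "cos (2 * pi * real k / real n) = 1" by (simp add: \<omega>_def complex_eq_iff)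
    then obtain m :: int where "2 * pi * real k / real n = of_int m * 2 * pi"
      unfolding cos_one_2pi_int by (elim exE) (rule that)
    then have "(2 * pi * real k / real n) / (2 * pi) = (of_int m * 2 * pi) / (2 * pi)"
      by (rule arg_cong)
    then have "real k / real n = of_int m" by simp
    moreover have "0 < real k / real n" "real k / real n < 1" using assms by auto
    ultimately have "0 < m" "m < 1" by simp_all
    then show False by linarith
  qed
  then have "(\<Sum>j<n. \<omega> ^ j) = (\<omega> ^ n - 1) / (\<omega> - 1)" by (rule geometric_sum)
  then show ?thesis by (simp add: term_eq 1)
qed

lemma roots_of_unity_average:
  assumes H: "H holomorphic_on ball 0 1" and r: "0 \<le> r" "r < 1"
  shows "(\<lambda>n. (\<Sum>j<Suc n. H (of_real r * cis (2 * pi * real j / real (Suc n)))) / of_nat (Suc n)) \<longlonglongrightarrow> H 0"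
proof -
  define a where "a k = (deriv ^^ k) H 0 / fact k" for k
  have sums: "(\<lambda>k. a k * x ^ k) sums H x" if "cmod x < 1" for x
    using holomorphic_power_series [OF H, of x] that by (simp add: a_def)
  have abs_summable: "summable (\<lambda>k. cmod (a k) * r ^ k)"
  proof -
    define s where "s = (r + 1) / 2"
    have s: "r < s" "s < 1" "0 < s" using r by (auto simp: s_def)
    have "summable (\<lambda>k. a k * of_real s ^ k)"
      using sums [of "of_real s"] s by (intro sums_summable) simp
    then have "summable (\<lambda>k. cmod (a k * of_real r ^ k))"
      by (rule powser_insidea) (use r s in simp)
    then show ?thesis using r by (simp add: norm_mult norm_power)
  qed
  define \<tau> where "\<tau> n = (\<Sum>k. cmod (a (k + n)) * r ^ (k + n))" for n
  have \<tau>: "\<tau> \<longlonglongrightarrow> 0"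
    unfolding \<tau>_def [abs_def] using suminf_exist_split2 [OF abs_summable] .
  have a0: "a 0 = H 0" by (simp add: a_def)
  have rem: "cmod (H x - (\<Sum>k<n. a k * x ^ k)) \<le> \<tau> n" if x: "cmod x = r" for x n
  proof -
    have "cmod x < 1" using x r by simp
    then have "(\<lambda>k. a (k + n) * x ^ (k + n)) sums (H x - (\<Sum>k<n. a k * x ^ k))"
      by (intro sums_split_initial_segment sums)
    then have "H x - (\<Sum>k<n. a k * x ^ k) = (\<Sum>k. a (k + n) * x ^ (k + n))" by (rule sums_unique)
    also have "cmod \<dots> \<le> \<tau> n"
      unfolding \<tau>_def
      by (rule norm_suminf_le)
         (use x summable_ignore_initial_segment [OF abs_summable, of n] in \<open>simp_all add: norm_mult norm_power\<close>)
    finally show ?thesis .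
  qed
  define x where "x n j = of_real r * cis (2 * pi * real j / real n)" for n j :: nat
  have x: "cmod (x n j) = r" for n j using r by (simp add: x_def norm_mult)
  have avg: "(\<Sum>j<Suc n. \<Sum>k<Suc n. a k * x (Suc n) j ^ k) = of_nat (Suc n) * H 0" for n
  proof -
    have "(\<Sum>j<Suc n. \<Sum>k<Suc n. a k * x (Suc n) j ^ k) = (\<Sum>k<Suc n. \<Sum>j<Suc n. a k * x (Suc n) j ^ k)"
      by (rule sum.swap)
    also have "\<dots> = (\<Sum>k<Suc n. if k = 0 then of_nat (Suc n) * H 0 else 0)"
    proof (intro sum.cong refl)
      fix k assume k: "k \<in> {..<Suc n}"
      have "(\<Sum>j<Suc n. a k * x (Suc n) j ^ k)
          = a k * of_real r ^ k * (\<Sum>j<Suc n. cis (2 * pi * real j / real (Suc n)) ^ k)"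
        unfolding x_def power_mult_distrib sum_distrib_left by (simp only: mult.assoc)
      then show "(\<Sum>j<Suc n. a k * x (Suc n) j ^ k) = (if k = 0 then of_nat (Suc n) * H 0 else 0)"
        using sum_roots_of_unity_power [of k "Suc n"] k a0 by (cases "k = 0") auto
    qed
    also have "\<dots> = of_nat (Suc n) * H 0"
      by (subst sum.delta) auto
    finally show ?thesis .
  qed
  have bound: "cmod ((\<Sum>j<Suc n. H (x (Suc n) j)) / of_nat (Suc n) - H 0) \<le> \<tau> (Suc n)" for n
  proof -
    have "(\<Sum>j<Suc n. H (x (Suc n) j)) / of_nat (Suc n) - H 0
        = (\<Sum>j<Suc n. H (x (Suc n) j) - (\<Sum>k<Suc n. a k * x (Suc n) j ^ k)) / of_nat (Suc n)"
      unfolding sum_subtractf avg diff_divide_distrib by (simp del: of_nat_Suc)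
    also have "cmod \<dots> = cmod (\<Sum>j<Suc n. H (x (Suc n) j) - (\<Sum>k<Suc n. a k * x (Suc n) j ^ k)) / real (Suc n)"
      by (simp only: norm_divide norm_of_nat)
    also have "\<dots> \<le> (\<Sum>j<Suc n. \<tau> (Suc n)) / real (Suc n)"
      by (intro divide_right_mono order_trans [OF norm_sum] sum_mono rem x) simp
    also have "\<dots> = \<tau> (Suc n)" by (simp del: of_nat_Suc)
    finally show ?thesis .
  qed
  have "(\<lambda>n. (\<Sum>j<Suc n. H (x (Suc n) j)) / of_nat (Suc n) - H 0) \<longlonglongrightarrow> 0"
    by (rule Lim_null_comparison [OF _ LIMSEQ_Suc [OF \<tau>]]) (use bound in \<open>intro always_eventually allI\<close>)
  then show ?thesis unfolding x_def by (rule LIM_zero_cancel)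
qed

text \<open>Rotation invariance replaces \<open>u\<close> by its averages over roots of unity, which converge to
  \<open>u 0\<close> when \<open>u\<close> is holomorphic, or the real part of a holomorphic function, on complex lines.\<close>

lemma sphere_mean_value:
  fixes u :: "'n::finite cspace \<Rightarrow> complex"
  assumes cont: "continuous_on (ball 0 1) u" and r: "0 \<le> r" "r < 1"
    and avg: "\<And>\<zeta>. norm \<zeta> = 1 \<Longrightarrow> (\<lambda>n. (\<Sum>j<Suc n. u ((of_real r * cis (2 * pi * real j / real (Suc n))) *s \<zeta>)) / of_nat (Suc n)) \<longlonglongrightarrow> u 0"
  shows "(\<integral>\<zeta>. u (r *\<^sub>R \<zeta>) \<partial>sphere_measure) = u 0"
proof -
  have contd: "continuous_on (sphere 0 1) (\<lambda>\<zeta>. u (c *s \<zeta>))" if "cmod c < 1" for c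
    by (rule continuous_on_compose2 [OF cont]) (use that in \<open>auto intro!: continuous_intros simp: norm_smult\<close>)
  define c where "c n j = of_real r * cis (2 * pi * real j / real (Suc n))" for n j :: nat
  have c: "cmod (c n j) = r" for n j using r by (simp add: c_def norm_mult)
  have compact: "compact (u ` cball 0 r)"
    by (intro compact_continuous_image continuous_on_subset [OF cont]) (use r in auto)
  then obtain B where B: "\<And>z. z \<in> cball 0 r \<Longrightarrow> cmod (u z) \<le> B"
    by (metis bounded_iff compact_imp_bounded imageI)
  have rot: "(\<integral>\<zeta>. u (c n j *s \<zeta>) \<partial>sphere_measure) = (\<integral>\<zeta>. u (r *\<^sub>R \<zeta>) \<partial>sphere_measure)" for n j
  proof -
    have "(\<integral>\<zeta>. u (of_real r *s (cis (2 * pi * real j / real (Suc n)) *s \<zeta>)) \<partial>sphere_measure)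
        = (\<integral>\<zeta>. u (of_real r *s \<zeta>) \<partial>sphere_measure)"
      by (rule integral_sphere_unitary [OF unitary_phase])
         (use r in \<open>simp_all add: borel_measurable_sphere_cont contd\<close>)
    then show ?thesis by (simp add: c_def scaleR_eq_smult)
  qed
  define A where "A n \<zeta> = (\<Sum>j<Suc n. u (c n j *s \<zeta>)) / of_nat (Suc n)" for n \<zeta>
  have intA: "(\<integral>\<zeta>. A n \<zeta> \<partial>sphere_measure) = (\<integral>\<zeta>. u (r *\<^sub>R \<zeta>) \<partial>sphere_measure)" for n
  proof -
    have "(\<integral>\<zeta>. (\<Sum>j<Suc n. u (c n j *s \<zeta>)) \<partial>sphere_measure) = (\<Sum>j<Suc n. (\<integral>\<zeta>. u (c n j *s \<zeta>) \<partial>sphere_measure))"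
      by (rule Bochner_Integration.integral_sum) (use c r in \<open>simp add: integrable_sphere_cont contd\<close>)
    also have "\<dots> = of_nat (Suc n) * (\<integral>\<zeta>. u (r *\<^sub>R \<zeta>) \<partial>sphere_measure)"
      unfolding rot by simp
    finally show ?thesis
      unfolding A_def by (simp del: of_nat_Suc sum.lessThan_Suc)
  qed
  have "(\<lambda>n. \<integral>\<zeta>. A n \<zeta> \<partial>sphere_measure) \<longlonglongrightarrow> (\<integral>\<zeta>. u 0 \<partial>(sphere_measure :: 'n cspace measure))"
  proof (rule integral_dominated_convergence)
    show "A n \<in> borel_measurable sphere_measure" for n
      unfolding A_def by (intro borel_measurable_sphere_cont continuous_intros contd)
         (use c r in \<open>auto simp del: of_nat_Suc\<close>)
    show "AE \<zeta> in sphere_measure. (\<lambda>n. A n \<zeta>) \<longlonglongrightarrow> u 0"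
      unfolding A_def c_def by (intro AE_I2 avg) simp
    show "AE \<zeta> in sphere_measure. norm (A n \<zeta>) \<le> B" for n
    proof (intro AE_I2)
      fix \<zeta> :: "'n cspace" assume "\<zeta> \<in> space sphere_measure"
      then have "norm \<zeta> = 1" by simp
      then have "cmod (u (c n j *s \<zeta>)) \<le> B" for j
        using c by (intro B) (simp add: norm_smult)
      then have "cmod (\<Sum>j<Suc n. u (c n j *s \<zeta>)) \<le> (\<Sum>j<Suc n. B)"
        by (intro order_trans [OF norm_sum] sum_mono)
      then have "cmod (\<Sum>j<Suc n. u (c n j *s \<zeta>)) / real (Suc n) \<le> (\<Sum>j<Suc n. B) / real (Suc n)"
        by (rule divide_right_mono) simp
      also have "\<dots> = B" by (simp del: of_nat_Suc)
      finally show "norm (A n \<zeta>) \<le> B" unfolding A_def by (simp only: norm_divide norm_of_nat)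
    qed
  qed simp_all
  then have "(\<lambda>n. \<integral>\<zeta>. u (r *\<^sub>R \<zeta>) \<partial>sphere_measure) \<longlonglongrightarrow> u 0"
    unfolding intA using sphere.prob_space [where 'a = "'n cspace"] by simp
  then show ?thesis using LIMSEQ_unique tendsto_const by blast
qed

context bounded_holomorphic
begin

lemma holomorphic_poly_slice:
  assumes "poly_fun m p"
  shows "(\<lambda>\<mu>. p (\<mu> *s z)) holomorphic_on S"
proof -
  obtain c where c: "\<And>z. p z = (\<Sum>\<alpha> | mi_abs \<alpha> \<le> m. c \<alpha> * monomial \<alpha> z)"
    using assms by (elim poly_funE) (rule that)
  show ?thesis unfolding c monomial_scale by (intro holomorphic_intros)
qed

lemma integral_poly_dilation:
  assumes p: "poly_fun m p" and r: "0 \<le> r" "r < 1"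
  shows "(\<integral>\<zeta>. p (r *\<^sub>R \<zeta>) * g (r *\<^sub>R \<zeta>) \<partial>sphere_measure) = p 0 * g 0"
proof (rule sphere_mean_value [where u = "\<lambda>z. p z * g z", OF _ r])
  show "continuous_on (ball 0 1) (\<lambda>z. p z * g z)"
    by (intro continuous_intros continuous continuous_on_poly_fun [OF p])
  fix \<zeta> :: "'n cspace" assume \<zeta>: "norm \<zeta> = 1"
  have "(\<lambda>\<mu>. p (\<mu> *s \<zeta>) * g (\<mu> *s \<zeta>)) holomorphic_on ball 0 1"
    by (intro holomorphic_intros holomorphic_poly_slice [OF p] holomorphic_radial_ball) (simp add: \<zeta>)
  from roots_of_unity_average [OF this r]
  show "(\<lambda>n. (\<Sum>j<Suc n. p ((of_real r * cis (2 * pi * real j / real (Suc n))) *s \<zeta>) *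
      g ((of_real r * cis (2 * pi * real j / real (Suc n))) *s \<zeta>)) / of_nat (Suc n)) \<longlonglongrightarrow> p 0 * g 0"
    by simp
qed

lemma AE_boundary_value_le: "AE \<zeta> in sphere_measure. cmod (boundary_value g \<zeta>) \<le> M"
  using AE_radial_limit AE_space [of sphere_measure]
proof eventually_elim
  case (elim \<zeta>)
  then have "(\<lambda>n. cmod (g (rad n *\<^sub>R \<zeta>))) \<longlonglongrightarrow> cmod (boundary_value g \<zeta>)"
    by (intro tendsto_intros)
  then show ?case
    by (rule LIMSEQ_le_const2) (use elim(2) in \<open>auto intro!: bounded exI [of _ 0]\<close>)
qed

lemma integral_poly_boundary_value:
  assumes p: "poly_fun m p"
  shows "(\<integral>\<zeta>. p \<zeta> * boundary_value g \<zeta> \<partial>sphere_measure) = p 0 * g 0"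
proof -
  obtain B where B: "\<And>z. z \<in> cball 0 1 \<Longrightarrow> cmod (p z) \<le> B"
    using continuous_on_compact_bound [OF compact_cball continuous_on_poly_fun [OF p]] by blast
  have "(\<lambda>n. \<integral>\<zeta>. p (rad n *\<^sub>R \<zeta>) * g (rad n *\<^sub>R \<zeta>) \<partial>sphere_measure)
      \<longlonglongrightarrow> (\<integral>\<zeta>. p \<zeta> * boundary_value g \<zeta> \<partial>sphere_measure)"
  proof (rule integral_dominated_convergence)
    show "(\<lambda>\<zeta>. p \<zeta> * boundary_value g \<zeta>) \<in> borel_measurable sphere_measure"
      by (intro borel_measurable_times boundary_value_measurable borel_measurable_sphere_cont continuous_on_poly_fun [OF p])
    show "(\<lambda>\<zeta>. p (rad n *\<^sub>R \<zeta>) * g (rad n *\<^sub>R \<zeta>)) \<in> borel_measurable sphere_measure" for n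
    proof (intro borel_measurable_sphere_cont continuous_intros continuous_dilation)
      show "continuous_on (sphere 0 1) (\<lambda>\<zeta>. p (rad n *\<^sub>R \<zeta>))"
        by (rule continuous_on_compose2 [OF continuous_on_poly_fun [OF p, of UNIV]]) (auto intro: continuous_intros)
    qed (use rad [of n] in simp)
    show "AE \<zeta> in sphere_measure. (\<lambda>n. p (rad n *\<^sub>R \<zeta>) * g (rad n *\<^sub>R \<zeta>)) \<longlonglongrightarrow> p \<zeta> * boundary_value g \<zeta>"
      using AE_radial_limit
    proof eventually_elim
      case (elim \<zeta>)
      have "(\<lambda>n. rad n *\<^sub>R \<zeta>) \<longlonglongrightarrow> 1 *\<^sub>R \<zeta>" by (intro tendsto_intros rad_lim)
      then have "(\<lambda>n. p (rad n *\<^sub>R \<zeta>)) \<longlonglongrightarrow> p \<zeta>"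
        by (intro continuous_on_tendsto_compose [OF continuous_on_poly_fun [OF p, of UNIV]]) auto
      then show ?case using elim by (intro tendsto_mult)
    qed
    show "AE \<zeta> in sphere_measure. norm (p (rad n *\<^sub>R \<zeta>) * g (rad n *\<^sub>R \<zeta>)) \<le> B * M" for n
    proof (intro AE_I2)
      fix \<zeta> :: "'n cspace" assume "\<zeta> \<in> space sphere_measure"
      then have "norm (rad n *\<^sub>R \<zeta>) < 1" using rad [of n] by simp
      then show "norm (p (rad n *\<^sub>R \<zeta>) * g (rad n *\<^sub>R \<zeta>)) \<le> B * M"
        unfolding norm_mult by (intro mult_mono B bounded) (use order_trans [OF norm_ge_zero B [of 0]] in auto)
    qed
  qed simp
  moreover have "(\<integral>\<zeta>. p (rad n *\<^sub>R \<zeta>) * g (rad n *\<^sub>R \<zeta>) \<partial>sphere_measure) = p 0 * g 0" for n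
    using rad [of n] by (intro integral_poly_dilation [OF p]) auto
  ultimately have "(\<lambda>n::nat. p 0 * g 0) \<longlonglongrightarrow> (\<integral>\<zeta>. p \<zeta> * boundary_value g \<zeta> \<partial>sphere_measure)"
    by simp
  then show ?thesis by (rule LIMSEQ_unique [OF _ tendsto_const])
qed

lemma integrable_poly_weight:
  assumes p: "poly_fun m p"
  shows "integrable sphere_measure (\<lambda>\<zeta>. (cmod (p \<zeta>))\<^sup>2 * (cmod (boundary_value g \<zeta>))\<^sup>2)"
proof -
  obtain B where B: "\<And>z. z \<in> sphere 0 1 \<Longrightarrow> cmod (p z) \<le> B"
    using continuous_on_compact_bound [OF compact_sphere continuous_on_poly_fun [OF p]] by blast
  show ?thesis
  proof (rule sphere.integrable_const_bound)
    show "AE \<zeta> in sphere_measure. norm ((cmod (p \<zeta>))\<^sup>2 * (cmod (boundary_value g \<zeta>))\<^sup>2) \<le> B\<^sup>2 * M\<^sup>2"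
      using AE_boundary_value_le AE_space [of sphere_measure]
    proof eventually_elim
      case (elim \<zeta>)
      then have "(cmod (p \<zeta>))\<^sup>2 * (cmod (boundary_value g \<zeta>))\<^sup>2 \<le> B\<^sup>2 * M\<^sup>2"
        by (intro mult_mono power_mono B) auto
      then show ?case by simp
    qed
    show "(\<lambda>\<zeta>. (cmod (p \<zeta>))\<^sup>2 * (cmod (boundary_value g \<zeta>))\<^sup>2) \<in> borel_measurable sphere_measure"
      using boundary_value_measurable borel_measurable_sphere_cont [OF continuous_on_poly_fun [OF p]]
      by measurable
  qed
qed

text \<open>The lower bound in Szego's theorem: \<open>p 0 * g 0\<close> is the mean of \<open>p\<close> times the boundary values of
  \<open>g\<close>, and the square of a mean is at most the mean square.\<close>

lemma szego_lower_bound: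
  assumes p: "poly_fun m p"
  shows "(cmod (p 0))\<^sup>2 * (cmod (g 0))\<^sup>2 \<le> (\<integral>\<zeta>. (cmod (p \<zeta>))\<^sup>2 * (cmod (boundary_value g \<zeta>))\<^sup>2 \<partial>sphere_measure)"
proof -
  define X where "X \<zeta> = cmod (p \<zeta> * boundary_value g \<zeta>)" for \<zeta>
  have meas: "X \<in> borel_measurable sphere_measure"
    unfolding X_def
    using boundary_value_measurable borel_measurable_sphere_cont [OF continuous_on_poly_fun [OF p]]
    by measurable
  have X2: "(X \<zeta>)\<^sup>2 = (cmod (p \<zeta>))\<^sup>2 * (cmod (boundary_value g \<zeta>))\<^sup>2" for \<zeta>
    by (simp add: X_def norm_mult power_mult_distrib)
  have int2: "integrable sphere_measure (\<lambda>\<zeta>. (X \<zeta>)\<^sup>2)"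
    unfolding X2 by (rule integrable_poly_weight [OF p])
  have int1: "integrable sphere_measure X"
    by (rule sphere.square_integrable_imp_integrable [OF meas int2])
  have "cmod (p 0 * g 0) = cmod (\<integral>\<zeta>. p \<zeta> * boundary_value g \<zeta> \<partial>sphere_measure)"
    by (simp add: integral_poly_boundary_value [OF p])
  also have "\<dots> \<le> (\<integral>\<zeta>. X \<zeta> \<partial>sphere_measure)"
    unfolding X_def by (rule integral_norm_bound)
  finally have "(cmod (p 0 * g 0))\<^sup>2 \<le> (\<integral>\<zeta>. X \<zeta> \<partial>sphere_measure)\<^sup>2"
    by (rule power_mono) simp
  also have "\<dots> \<le> (\<integral>\<zeta>. (X \<zeta>)\<^sup>2 \<partial>sphere_measure)"
    using sphere.variance_eq [OF int1 int2] sphere.variance_positive [of X] by linarith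
  finally show ?thesis by (simp add: X2 norm_mult power_mult_distrib)
qed

end

section \<open>Zero-free functions\<close>

locale invertible_holomorphic = bounded_holomorphic g M for g :: "'n::finite cspace \<Rightarrow> complex" and M +
  fixes M' :: real
  assumes nonzero: "\<And>z. norm z < 1 \<Longrightarrow> g z \<noteq> 0"
    and G_hol: "holomorphic_several (\<lambda>z. 1 / g z) (ball 0 1)"
    and G_bounded: "\<And>z. norm z < 1 \<Longrightarrow> cmod (1 / g z) \<le> M'"
begin

lemma M'_pos: "0 < M'"
proof -
  have "0 < cmod (1 / g 0)" using nonzero [of 0] by simp
  also have "\<dots> \<le> M'" by (rule G_bounded) simp
  finally show ?thesis .
qed

lemma lower_bound: "norm z < 1 \<Longrightarrow> 1 / M' \<le> cmod (g z)"
  using G_bounded [of z] nonzero [of z] M'_pos by (simp add: norm_divide field_simps)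

lemma AE_boundary_value_ge: "AE \<zeta> in sphere_measure. 1 / M' \<le> cmod (boundary_value g \<zeta>)"
  using AE_radial_limit AE_space [of sphere_measure]
proof eventually_elim
  case (elim \<zeta>)
  then have "(\<lambda>n. cmod (g (rad n *\<^sub>R \<zeta>))) \<longlonglongrightarrow> cmod (boundary_value g \<zeta>)"
    by (intro tendsto_intros)
  then show ?case
    by (rule LIMSEQ_le_const) (use elim(2) in \<open>auto intro!: lower_bound exI [of _ 0]\<close>)
qed

text \<open>\<open>ln \<bar>g\<bar>\<close> is the real part of a holomorphic function on every complex line through \<open>0\<close>.\<close>

lemma integral_ln_dilation:
  assumes r: "0 \<le> r" "r < 1"
  shows "(\<integral>\<zeta>. ln (cmod (g (r *\<^sub>R \<zeta>))) \<partial>sphere_measure) = ln (cmod (g 0))"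
proof -
  have "(\<integral>\<zeta>. complex_of_real (ln (cmod (g (r *\<^sub>R \<zeta>)))) \<partial>sphere_measure) = of_real (ln (cmod (g 0)))"
  proof (rule sphere_mean_value [where u = "\<lambda>z. complex_of_real (ln (cmod (g z)))", OF _ r])
    show "continuous_on (ball 0 1) (\<lambda>z. complex_of_real (ln (cmod (g z))))"
      using nonzero by (intro continuous_intros continuous) auto
    fix \<zeta> :: "'n cspace" assume \<zeta>: "norm \<zeta> = 1"
    have lt: "cmod \<mu> < 1 \<Longrightarrow> norm (\<mu> *s \<zeta>) < 1" for \<mu> by (simp add: norm_smult \<zeta>)
    obtain H where H: "H holomorphic_on ball 0 1" "\<And>\<mu>. \<mu> \<in> ball 0 1 \<Longrightarrow> exp (H \<mu>) = g (\<mu> *s \<zeta>)"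
    proof (rule holomorphic_logarithm_exists [of "ball 0 1" "\<lambda>\<mu>. g (\<mu> *s \<zeta>)" 0])
      show "(\<lambda>\<mu>. g (\<mu> *s \<zeta>)) holomorphic_on ball 0 1"
        by (rule holomorphic_radial_ball) (simp add: \<zeta>)
      show "g (\<mu> *s \<zeta>) \<noteq> 0" if "\<mu> \<in> ball 0 1" for \<mu>
        using that by (intro nonzero lt) simp
    qed auto
    have Re: "ln (cmod (g (\<mu> *s \<zeta>))) = Re (H \<mu>)" if "cmod \<mu> < 1" for \<mu>
      using H(2) [of \<mu>] that by (metis ln_exp mem_ball_0 norm_exp_eq_Re)
    define x where "x n j = of_real r * cis (2 * pi * real j / real (Suc n))" for n j :: nat
    have x: "cmod (x n j) < 1" for n j using r by (simp add: x_def norm_mult)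
    have "(\<lambda>n. (\<Sum>j<Suc n. H (x n j)) / of_nat (Suc n)) \<longlonglongrightarrow> H 0"
      unfolding x_def by (rule roots_of_unity_average [OF H(1) r])
    then have "(\<lambda>n. complex_of_real (Re ((\<Sum>j<Suc n. H (x n j)) / of_nat (Suc n)))) \<longlonglongrightarrow> of_real (Re (H 0))"
      by (intro tendsto_intros)
    moreover have "complex_of_real (Re ((\<Sum>j<Suc n. H (x n j)) / of_nat (Suc n)))
        = (\<Sum>j<Suc n. complex_of_real (ln (cmod (g (x n j *s \<zeta>))))) / of_nat (Suc n)" for n
    proof -
      have "Re ((\<Sum>j<Suc n. H (x n j)) / of_nat (Suc n)) = (\<Sum>j<Suc n. Re (H (x n j))) / real (Suc n)"
        by (simp only: Re_divide_of_nat Re_sum)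
      then show ?thesis
        by (simp only: Re [OF x] of_real_divide of_real_sum of_real_of_nat_eq)
    qed
    moreover have "Re (H 0) = ln (cmod (g 0))" using Re [of 0] by simp
    ultimately show "(\<lambda>n. (\<Sum>j<Suc n. complex_of_real (ln (cmod (g ((of_real r * cis (2 * pi * real j / real (Suc n))) *s \<zeta>))))) / of_nat (Suc n))
        \<longlonglongrightarrow> of_real (ln (cmod (g 0)))"
      unfolding x_def by (simp only:)
  qed
  then show ?thesis
    unfolding integral_complex_of_real using of_real_eq_iff by (rule iffD1 [rotated])
qed

text \<open>The bounds on \<open>g\<close> and \<open>1 / g\<close> give a constant that dominates \<open>ln \<bar>g\<bar>\<close> on the ball.\<close>

lemma integral_ln_weight:
  "(\<integral>\<zeta>. ln ((cmod (boundary_value g \<zeta>))\<^sup>2) \<partial>sphere_measure) = ln ((cmod (g 0))\<^sup>2)"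
proof -
  have g0: "0 < cmod (g 0)" using nonzero [of 0] by simp
  have "(\<lambda>n. \<integral>\<zeta>. ln (cmod (g (rad n *\<^sub>R \<zeta>))) \<partial>sphere_measure)
      \<longlonglongrightarrow> (\<integral>\<zeta>. ln (cmod (boundary_value g \<zeta>)) \<partial>sphere_measure)"
  proof (rule integral_dominated_convergence)
    show "(\<lambda>\<zeta>. ln (cmod (boundary_value g \<zeta>))) \<in> borel_measurable sphere_measure"
      using boundary_value_measurable by measurable
    show "(\<lambda>\<zeta>. ln (cmod (g (rad n *\<^sub>R \<zeta>)))) \<in> borel_measurable sphere_measure" for n
      using borel_measurable_sphere_cont [OF continuous_dilation [OF abs_rad]] by measurable
    show "AE \<zeta> in sphere_measure. (\<lambda>n. ln (cmod (g (rad n *\<^sub>R \<zeta>)))) \<longlonglongrightarrow> ln (cmod (boundary_value g \<zeta>))"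
      using AE_radial_limit AE_boundary_value_ge
    proof eventually_elim
      case (elim \<zeta>)
      have "0 < 1 / M'" using M'_pos by simp
      then have "cmod (boundary_value g \<zeta>) \<noteq> 0" using elim(2) by linarith
      then show ?case using elim(1) by (intro tendsto_intros) simp
    qed
    show "AE \<zeta> in sphere_measure. norm (ln (cmod (g (rad n *\<^sub>R \<zeta>)))) \<le> \<bar>ln M\<bar> + \<bar>ln (1 / M')\<bar>" for n
    proof (intro AE_I2)
      fix \<zeta> :: "'n cspace" assume "\<zeta> \<in> space sphere_measure"
      then have z: "norm (rad n *\<^sub>R \<zeta>) < 1" using rad [of n] by simp
      have pos: "0 < 1 / M'" using M'_pos by simp
      have "ln (1 / M') \<le> ln (cmod (g (rad n *\<^sub>R \<zeta>)))"
        using pos lower_bound [OF z] by (intro ln_mono) linarith+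
      moreover have "ln (cmod (g (rad n *\<^sub>R \<zeta>))) \<le> ln M"
        using pos lower_bound [OF z] bounded [OF z] by (intro ln_mono) linarith+
      ultimately show "norm (ln (cmod (g (rad n *\<^sub>R \<zeta>)))) \<le> \<bar>ln M\<bar> + \<bar>ln (1 / M')\<bar>"
        unfolding real_norm_def by linarith
    qed
  qed simp
  moreover have "(\<integral>\<zeta>. ln (cmod (g (rad n *\<^sub>R \<zeta>))) \<partial>sphere_measure) = ln (cmod (g 0))" for n
    using rad [of n] by (intro integral_ln_dilation) auto
  ultimately have "(\<lambda>n::nat. ln (cmod (g 0))) \<longlonglongrightarrow> (\<integral>\<zeta>. ln (cmod (boundary_value g \<zeta>)) \<partial>sphere_measure)"
    by simp
  then have main: "(\<integral>\<zeta>. ln (cmod (boundary_value g \<zeta>)) \<partial>sphere_measure) = ln (cmod (g 0))"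
    by (rule LIMSEQ_unique [OF _ tendsto_const])
  have "(\<integral>\<zeta>. ln ((cmod (boundary_value g \<zeta>))\<^sup>2) \<partial>sphere_measure) = (\<integral>\<zeta>. 2 * ln (cmod (boundary_value g \<zeta>)) \<partial>sphere_measure)"
  proof (rule integral_cong_AE)
    show "AE \<zeta> in sphere_measure. ln ((cmod (boundary_value g \<zeta>))\<^sup>2) = 2 * ln (cmod (boundary_value g \<zeta>))"
      using AE_boundary_value_ge
    proof eventually_elim
      case (elim \<zeta>)
      have "0 < 1 / M'" using M'_pos by simp
      then have "0 < cmod (boundary_value g \<zeta>)" using elim by linarith
      then show ?case by (simp add: ln_realpow)
    qed
  qed (use boundary_value_measurable in measurable)
  also have "\<dots> = 2 * ln (cmod (g 0))" by (simp add: main)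
  finally show ?thesis using g0 by (simp add: ln_realpow)
qed

text \<open>The upper bound in Szego's theorem.  A Taylor polynomial \<open>p\<close> of a dilation of \<open>1 / g\<close> has
  \<open>p 0 = 1 / g 0\<close>; letting first the degree tend to infinity and then the dilation to the identity, its norm in the weighted
  space tends to the integral of \<open>\<bar>1 / g\<bar>\<^sup>2 \<bar>g\<bar>\<^sup>2 = 1\<close>.\<close>

lemma szego_upper_bound:
  assumes L: "\<And>p m. poly_fun m p \<Longrightarrow>
    L * (cmod (p 0))\<^sup>2 \<le> (\<integral>\<zeta>. (cmod (p \<zeta>))\<^sup>2 * (cmod (boundary_value g \<zeta>))\<^sup>2 \<partial>sphere_measure)"
  shows "L \<le> (cmod (g 0))\<^sup>2"
proof -
  define h where "h = (\<lambda>z. 1 / g z)"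
  interpret h: bounded_holomorphic h M'
    unfolding h_def by unfold_locales (fact G_hol, fact G_bounded)
  let ?w = "\<lambda>\<zeta>. (cmod (boundary_value g \<zeta>))\<^sup>2"
  have w_meas: "?w \<in> borel_measurable sphere_measure"
    using boundary_value_measurable by measurable
  have step: "L * (cmod (h 0))\<^sup>2 \<le> (\<integral>\<zeta>. (cmod (h (r *\<^sub>R \<zeta>)))\<^sup>2 * ?w \<zeta> \<partial>sphere_measure)"
    if r: "0 < r" "r < 1" for r
  proof -
    define S where "S n \<zeta> = (\<Sum>k<n. of_real r ^ k * hcoef h k \<zeta>)" for n \<zeta>
    have S_poly: "\<exists>m. poly_fun m (S n)" for n
      unfolding S_def [abs_def]
    proof (rule ex_poly_fun_sum)
      show "\<exists>m. poly_fun m (\<lambda>\<zeta>. of_real r ^ k * hcoef h k \<zeta>)" for k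
        using h.hcoef_poly_fun [of k] poly_fun_cmult by blast
    qed simp
    have S0: "S (Suc n) 0 = h 0" for n
    proof -
      have "hcoef h k 0 = 0" if "0 < k" for k
        using h.hcoef_bound [of k 0] that by (simp add: zero_power)
      then have "S (Suc n) 0 = (\<Sum>k<Suc n. if k = 0 then h 0 else 0)"
        unfolding S_def by (intro sum.cong refl) (auto simp: h.hcoef_zero)
      then show ?thesis by (simp only: sum.delta finite_lessThan) simp
    qed
    have "(\<lambda>n. \<integral>\<zeta>. (cmod (S (Suc n) \<zeta>))\<^sup>2 * ?w \<zeta> \<partial>sphere_measure) \<longlonglongrightarrow> (\<integral>\<zeta>. (cmod (h (r *\<^sub>R \<zeta>)))\<^sup>2 * ?w \<zeta> \<partial>sphere_measure)"
    proof (rule integral_dominated_convergence)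
      have "\<bar>r\<bar> < 1" using r by simp
      from borel_measurable_sphere_cont [OF h.continuous_dilation [OF this]]
      show "(\<lambda>\<zeta>. (cmod (h (r *\<^sub>R \<zeta>)))\<^sup>2 * ?w \<zeta>) \<in> borel_measurable sphere_measure"
        using boundary_value_measurable by measurable
      show "(\<lambda>\<zeta>. (cmod (S (Suc n) \<zeta>))\<^sup>2 * ?w \<zeta>) \<in> borel_measurable sphere_measure" for n
        unfolding S_def
        by (intro borel_measurable_times w_meas borel_measurable_sphere_cont continuous_intros h.continuous_hcoef)
      show "AE \<zeta> in sphere_measure. (\<lambda>n. (cmod (S (Suc n) \<zeta>))\<^sup>2 * ?w \<zeta>) \<longlonglongrightarrow> (cmod (h (r *\<^sub>R \<zeta>)))\<^sup>2 * ?w \<zeta>"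
      proof (intro AE_I2 tendsto_mult tendsto_power tendsto_norm tendsto_const)
        fix \<zeta> :: "'n cspace" assume "\<zeta> \<in> space sphere_measure"
        then have "(\<lambda>n. S n \<zeta>) \<longlonglongrightarrow> h (r *\<^sub>R \<zeta>)"
          unfolding S_def scaleR_eq_smult using r by (intro h.hcoef_partial_sum_lim) auto
        then show "(\<lambda>n. S (Suc n) \<zeta>) \<longlonglongrightarrow> h (r *\<^sub>R \<zeta>)" by (rule LIMSEQ_Suc)
      qed
      show "AE \<zeta> in sphere_measure. norm ((cmod (S (Suc n) \<zeta>))\<^sup>2 * ?w \<zeta>) \<le> (M' / (1 - r))\<^sup>2 * M\<^sup>2" for n
        using AE_boundary_value_le AE_space [of sphere_measure]
      proof eventually_elim
        case (elim \<zeta>)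
        have "cmod (S (Suc n) \<zeta>) \<le> M' / (1 - r)"
          unfolding S_def using elim(2) r by (intro h.hcoef_partial_sum_bound) auto
        then have "(cmod (S (Suc n) \<zeta>))\<^sup>2 * ?w \<zeta> \<le> (M' / (1 - r))\<^sup>2 * M\<^sup>2"
          using elim(1) by (intro mult_mono power_mono) auto
        then show ?case by simp
      qed
    qed simp
    then show ?thesis
    proof (rule LIMSEQ_le_const, intro exI [of _ 0] allI impI)
      fix n
      obtain m where "poly_fun m (S (Suc n))" using S_poly [of "Suc n"] by (elim exE) (rule that)
      from L [OF this] show "L * (cmod (h 0))\<^sup>2 \<le> (\<integral>\<zeta>. (cmod (S (Suc n) \<zeta>))\<^sup>2 * ?w \<zeta> \<partial>sphere_measure)"
        by (simp only: S0)
    qed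
  qed
  have "(\<lambda>n. \<integral>\<zeta>. (cmod (h (rad n *\<^sub>R \<zeta>)))\<^sup>2 * ?w \<zeta> \<partial>sphere_measure) \<longlonglongrightarrow> (\<integral>\<zeta>. 1 \<partial>(sphere_measure :: 'n cspace measure))"
  proof (rule integral_dominated_convergence)
    show "(\<lambda>\<zeta>. (cmod (h (rad n *\<^sub>R \<zeta>)))\<^sup>2 * ?w \<zeta>) \<in> borel_measurable sphere_measure" for n
      using borel_measurable_sphere_cont [OF h.continuous_dilation [OF abs_rad]] boundary_value_measurable
      by measurable
    show "AE \<zeta> in sphere_measure. (\<lambda>n. (cmod (h (rad n *\<^sub>R \<zeta>)))\<^sup>2 * ?w \<zeta>) \<longlonglongrightarrow> 1"
      using AE_radial_limit AE_boundary_value_ge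
    proof eventually_elim
      case (elim \<zeta>)
      have "0 < 1 / M'" using M'_pos by simp
      then have nz: "boundary_value g \<zeta> \<noteq> 0" using elim(2) by auto
      then have "(\<lambda>n. (cmod (h (rad n *\<^sub>R \<zeta>)))\<^sup>2 * ?w \<zeta>) \<longlonglongrightarrow> (cmod (1 / boundary_value g \<zeta>))\<^sup>2 * ?w \<zeta>"
        unfolding h_def using elim(1) by (intro tendsto_intros)
      moreover have "(cmod (1 / boundary_value g \<zeta>))\<^sup>2 * ?w \<zeta> = 1"
        using nz by (simp add: norm_divide power_divide)
      ultimately show ?case by simp
    qed
    show "AE \<zeta> in sphere_measure. norm ((cmod (h (rad n *\<^sub>R \<zeta>)))\<^sup>2 * ?w \<zeta>) \<le> M'\<^sup>2 * M\<^sup>2" for n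
      using AE_boundary_value_le AE_space [of sphere_measure]
    proof eventually_elim
      case (elim \<zeta>)
      have "norm (rad n *\<^sub>R \<zeta>) < 1" using elim(2) rad [of n] by simp
      then have "(cmod (h (rad n *\<^sub>R \<zeta>)))\<^sup>2 * ?w \<zeta> \<le> M'\<^sup>2 * M\<^sup>2"
        using elim(1) by (intro mult_mono power_mono h.bounded) auto
      then show ?case by simp
    qed
  qed simp_all
  then have "L * (cmod (h 0))\<^sup>2 \<le> (\<integral>\<zeta>. 1 \<partial>(sphere_measure :: 'n cspace measure))"
    by (rule LIMSEQ_le_const) (use rad in \<open>intro exI [of _ 0] allI impI step\<close>)
  then have "L * (cmod (h 0))\<^sup>2 \<le> 1"
    using sphere.prob_space [where 'a = "'n cspace"] by simp
  then show ?thesis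
    using nonzero [of 0] by (simp add: h_def norm_divide power_divide divide_le_eq)
qed

end

section \<open>Verblunsky coefficients as partial correlations\<close>

text \<open>The second condition says that the monomials are linearly independent in \<open>L\<^sup>2(\<mu>)\<close>, so that all
  their Gram matrices are invertible.\<close>

locale definite_sphere_measure = finite_measure \<mu> for \<mu> :: "'n::{finite,linorder} cspace measure" +
  assumes sets_mu: "sets \<mu> = sets (sphere_measure :: 'n cspace measure)"
    and definite: "\<And>(A :: 'n multi_index set) c \<alpha>. finite A \<Longrightarrow> \<alpha> \<in> A \<Longrightarrow> c \<alpha> \<noteq> 0 \<Longrightarrow>
      0 < (\<integral>\<zeta>. (cmod (\<Sum>\<alpha>\<in>A. c \<alpha> * monomial \<alpha> \<zeta>))\<^sup>2 \<partial>\<mu>)"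
begin

lemma integrable_cont:
  fixes f :: "'n cspace \<Rightarrow> 'b::{banach, second_countable_topology}"
  assumes "continuous_on (sphere 0 1) f"
  shows "integrable \<mu> f"
  by (rule integrable_continuous_on_sphere [OF finite_measure_axioms sets_mu assms])

definition ip :: "('n cspace \<Rightarrow> complex) \<Rightarrow> ('n cspace \<Rightarrow> complex) \<Rightarrow> complex" where
  "ip f h = (\<integral>\<zeta>. f \<zeta> * cnj (h \<zeta>) \<partial>\<mu>)"

definition N2 :: "('n cspace \<Rightarrow> complex) \<Rightarrow> real" where
  "N2 f = (\<integral>\<zeta>. (cmod (f \<zeta>))\<^sup>2 \<partial>\<mu>)"

abbreviation cont :: "('n cspace \<Rightarrow> complex) \<Rightarrow> bool" where
  "cont f \<equiv> continuous_on (sphere 0 1) f"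

lemma moment_eq_ip: "moment \<mu> \<alpha> \<beta> = ip (monomial \<alpha>) (monomial \<beta>)"
  by (simp add: moment_def ip_def)

lemma cnj_ip: "cnj (ip f h) = ip h f"
  unfolding ip_def
  by (subst Bochner_Integration.integral_cnj [symmetric]) (simp add: mult.commute)

lemma ip_self: "ip f f = of_real (N2 f)"
  unfolding ip_def N2_def complex_norm_square [symmetric] by (rule integral_complex_of_real)

lemma N2_nonneg: "0 \<le> N2 f"
  by (simp add: N2_def)

lemma ip_diff_left: "cont f \<Longrightarrow> cont f' \<Longrightarrow> cont h \<Longrightarrow> ip (\<lambda>z. f z - f' z) h = ip f h - ip f' h"
  unfolding ip_def left_diff_distrib
  by (intro Bochner_Integration.integral_diff integrable_cont continuous_intros)

lemma ip_cmult_left: "ip (\<lambda>z. a * f z) h = a * ip f h"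
  unfolding ip_def mult.assoc by simp

lemma ip_sum_left:
  "(\<And>i. i \<in> I \<Longrightarrow> cont (f i)) \<Longrightarrow> cont h \<Longrightarrow> ip (\<lambda>z. \<Sum>i\<in>I. f i z) h = (\<Sum>i\<in>I. ip (f i) h)"
  unfolding ip_def sum_distrib_right
  by (intro Bochner_Integration.integral_sum integrable_cont continuous_intros)

lemma ip_diff_right: "cont f \<Longrightarrow> cont f' \<Longrightarrow> cont h \<Longrightarrow> ip h (\<lambda>z. f z - f' z) = ip h f - ip h f'"
  using ip_diff_left [of f f' h] by (metis cnj_ip complex_cnj_diff)

lemma ip_cmult_right: "ip h (\<lambda>z. a * f z) = cnj a * ip h f"
  using ip_cmult_left [of a f h] by (metis cnj_ip complex_cnj_mult)

lemma ip_sum_right: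
  assumes "\<And>i. i \<in> I \<Longrightarrow> cont (f i)" "cont h"
  shows "ip h (\<lambda>z. \<Sum>i\<in>I. f i z) = (\<Sum>i\<in>I. ip h (f i))"
proof -
  have "ip h (\<lambda>z. \<Sum>i\<in>I. f i z) = cnj (ip (\<lambda>z. \<Sum>i\<in>I. f i z) h)" by (rule cnj_ip [symmetric])
  also have "\<dots> = (\<Sum>i\<in>I. cnj (ip (f i) h))" using assms by (simp add: ip_sum_left)
  finally show ?thesis by (simp add: cnj_ip)
qed

text \<open>\<open>r\<close> is the component of \<open>\<zeta>\<^sup>\<alpha>\<close> orthogonal to the monomials with exponents in \<open>S\<close>.\<close>

definition residual :: "'n multi_index set \<Rightarrow> 'n multi_index \<Rightarrow> ('n cspace \<Rightarrow> complex) \<Rightarrow> bool" where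
  "residual S \<alpha> r \<longleftrightarrow> (\<exists>c. r = (\<lambda>z. monomial \<alpha> z - (\<Sum>\<delta>\<in>S. c \<delta> * monomial \<delta> z))) \<and>
     (\<forall>\<delta>\<in>S. ip r (monomial \<delta>) = 0)"

lemma residual_cont: "residual S \<alpha> r \<Longrightarrow> cont r"
  by (auto simp: residual_def intro!: continuous_intros)

lemma residual_orth_combination:
  assumes "residual S \<alpha> r"
  shows "ip r (\<lambda>z. \<Sum>\<delta>\<in>S. c \<delta> * monomial \<delta> z) = 0"
  using assms
  by (subst ip_sum_right)
     (auto simp: ip_cmult_right residual_def intro!: continuous_intros residual_cont [OF assms])

lemma residual_ip:
  assumes r: "residual S \<alpha> r" and r': "residual S \<beta> r'"
  shows "ip r r' = ip r (monomial \<beta>)"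
proof -
  obtain c where c: "r' = (\<lambda>z. monomial \<beta> z - (\<Sum>\<delta>\<in>S. c \<delta> * monomial \<delta> z))"
    using r' by (auto simp: residual_def)
  have "ip r r' = ip r (monomial \<beta>) - ip r (\<lambda>z. \<Sum>\<delta>\<in>S. c \<delta> * monomial \<delta> z)"
    unfolding c by (intro ip_diff_right residual_cont [OF r] continuous_monomial continuous_intros)
  then show ?thesis by (simp add: residual_orth_combination [OF r])
qed

text \<open>Pythagoras: the residual is orthogonal to the difference of the two combinations.\<close>

lemma residual_minimal:
  assumes r: "residual S \<alpha> r"
  shows "N2 r \<le> N2 (\<lambda>z. monomial \<alpha> z - (\<Sum>\<delta>\<in>S. d \<delta> * monomial \<delta> z))"
proof -
  obtain c where c: "r = (\<lambda>z. monomial \<alpha> z - (\<Sum>\<delta>\<in>S. c \<delta> * monomial \<delta> z))"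
    using r by (auto simp: residual_def)
  define s where "s = (\<lambda>z. \<Sum>\<delta>\<in>S. (d \<delta> - c \<delta>) * monomial \<delta> z)"
  have s: "cont s" unfolding s_def by (intro continuous_intros)
  have rs: "ip r s = 0" unfolding s_def by (rule residual_orth_combination [OF r])
  then have sr: "ip s r = 0" by (metis cnj_ip complex_cnj_zero)
  have eq: "(\<lambda>z. monomial \<alpha> z - (\<Sum>\<delta>\<in>S. d \<delta> * monomial \<delta> z)) = (\<lambda>z. r z - s z)"
    by (simp add: c s_def fun_eq_iff left_diff_distrib sum_subtractf)
  have "complex_of_real (N2 (\<lambda>z. r z - s z)) = ip r r - ip r s - (ip s r - ip s s)"
  proof -
    have rs_cont: "cont (\<lambda>z. r z - s z)" by (intro continuous_intros residual_cont [OF r] s)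
    show ?thesis
      unfolding ip_self [symmetric] ip_diff_left [OF residual_cont [OF r] s rs_cont]
        ip_diff_right [OF residual_cont [OF r] s residual_cont [OF r]]
        ip_diff_right [OF residual_cont [OF r] s s] ..
  qed
  also have "\<dots> = of_real (N2 r + N2 s)" by (simp add: rs sr ip_self)
  finally have "N2 (\<lambda>z. r z - s z) = N2 r + N2 s" using of_real_eq_iff by (rule iffD1 [rotated])
  then show ?thesis unfolding eq using N2_nonneg [of s] by simp
qed

lemma residual_N2_unique:
  assumes "residual S \<alpha> r" "residual S \<alpha> r'"
  shows "N2 r = N2 r'"
proof -
  obtain c where c: "r = (\<lambda>z. monomial \<alpha> z - (\<Sum>\<delta>\<in>S. c \<delta> * monomial \<delta> z))"
    using assms(1) by (auto simp: residual_def)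
  obtain c' where c': "r' = (\<lambda>z. monomial \<alpha> z - (\<Sum>\<delta>\<in>S. c' \<delta> * monomial \<delta> z))"
    using assms(2) by (auto simp: residual_def)
  show ?thesis
    using residual_minimal [OF assms(1), of c'] residual_minimal [OF assms(2), of c]
    unfolding c [symmetric] c' [symmetric] by simp
qed

lemma residual_N2_pos:
  assumes r: "residual S \<alpha> r" and "finite S" "\<alpha> \<notin> S"
  shows "0 < N2 r"
proof -
  obtain c where c: "r = (\<lambda>z. monomial \<alpha> z - (\<Sum>\<delta>\<in>S. c \<delta> * monomial \<delta> z))"
    using r by (auto simp: residual_def)
  define c' where "c' \<delta> = (if \<delta> = \<alpha> then 1 else - c \<delta>)" for \<delta>
  have "(\<Sum>\<delta>\<in>insert \<alpha> S. c' \<delta> * monomial \<delta> z) = r z" for z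
  proof -
    have "(\<Sum>\<delta>\<in>S. c' \<delta> * monomial \<delta> z) = (\<Sum>\<delta>\<in>S. - (c \<delta> * monomial \<delta> z))"
      using assms(3) by (intro sum.cong refl) (auto simp: c'_def)
    then show ?thesis
      using assms(2,3) by (simp add: c c'_def sum_negf)
  qed
  moreover have "0 < (\<integral>\<zeta>. (cmod (\<Sum>\<delta>\<in>insert \<alpha> S. c' \<delta> * monomial \<delta> \<zeta>))\<^sup>2 \<partial>\<mu>)"
    by (rule definite [of _ \<alpha>]) (use assms(2) in \<open>simp_all add: c'_def\<close>)
  ultimately show ?thesis by (simp add: N2_def)
qed

text \<open>One step of Gram--Schmidt: enlarging \<open>S\<close> by \<open>\<beta>\<close> subtracts the projection onto the residual
  of \<open>\<beta>\<close>.\<close>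

lemma residual_insert:
  assumes r: "residual S \<alpha> r" and r': "residual S \<beta> r'" and S: "finite S" "\<beta> \<notin> S"
  defines "c \<equiv> ip r r' / of_real (N2 r')"
  shows "residual (insert \<beta> S) \<alpha> (\<lambda>z. r z - c * r' z)"
    and "N2 (\<lambda>z. r z - c * r' z) = N2 r - (cmod (ip r r'))\<^sup>2 / N2 r'"
proof -
  have pos: "0 < N2 r'" by (rule residual_N2_pos [OF r' S])
  note cont = residual_cont [OF r] residual_cont [OF r']
  obtain a where a: "r = (\<lambda>z. monomial \<alpha> z - (\<Sum>\<delta>\<in>S. a \<delta> * monomial \<delta> z))"
    using r by (auto simp: residual_def)
  obtain b where b: "r' = (\<lambda>z. monomial \<beta> z - (\<Sum>\<delta>\<in>S. b \<delta> * monomial \<delta> z))"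
    using r' by (auto simp: residual_def)
  have orth: "ip (\<lambda>z. r z - c * r' z) h = ip r h - c * ip r' h" if "cont h" for h
    using that by (subst ip_diff_left) (auto intro!: cont continuous_intros simp: ip_cmult_left)
  show "residual (insert \<beta> S) \<alpha> (\<lambda>z. r z - c * r' z)"
    unfolding residual_def
  proof (intro conjI exI ballI)
    show "(\<lambda>z. r z - c * r' z) = (\<lambda>z. monomial \<alpha> z -
        (\<Sum>\<delta>\<in>insert \<beta> S. (if \<delta> = \<beta> then c else a \<delta> - c * b \<delta>) * monomial \<delta> z))"
    proof
      fix z
      have "(\<Sum>\<delta>\<in>S. (if \<delta> = \<beta> then c else a \<delta> - c * b \<delta>) * monomial \<delta> z)
          = (\<Sum>\<delta>\<in>S. a \<delta> * monomial \<delta> z) - c * (\<Sum>\<delta>\<in>S. b \<delta> * monomial \<delta> z)"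
        unfolding sum_distrib_left sum_subtractf [symmetric]
        using S(2) by (intro sum.cong refl) (auto simp: algebra_simps)
      then show "r z - c * r' z = monomial \<alpha> z -
          (\<Sum>\<delta>\<in>insert \<beta> S. (if \<delta> = \<beta> then c else a \<delta> - c * b \<delta>) * monomial \<delta> z)"
        using S by (simp add: a b algebra_simps)
    qed
    fix \<delta> assume "\<delta> \<in> insert \<beta> S"
    then consider "\<delta> = \<beta>" | "\<delta> \<in> S" by auto
    then show "ip (\<lambda>z. r z - c * r' z) (monomial \<delta>) = 0"
    proof cases
      case 1
      have "ip r' (monomial \<beta>) = of_real (N2 r')"
        using residual_ip [OF r' r'] by (simp add: ip_self)
      moreover have "ip r (monomial \<beta>) = ip r r'"
        using residual_ip [OF r r'] by simp
      ultimately have "ip r (monomial \<beta>) - c * ip r' (monomial \<beta>) = 0"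
        using pos by (simp add: c_def)
      then show ?thesis unfolding 1 orth [OF continuous_monomial] .
    next
      case 2
      then have "ip r (monomial \<delta>) = 0" "ip r' (monomial \<delta>) = 0"
        using r r' unfolding residual_def by blast+
      then show ?thesis unfolding orth [OF continuous_monomial] by simp
    qed
  qed
  have cc: "cont (\<lambda>z. r z - c * r' z)" by (intro continuous_intros cont)
  have "complex_of_real (N2 (\<lambda>z. r z - c * r' z)) = ip r (\<lambda>z. r z - c * r' z) - c * ip r' (\<lambda>z. r z - c * r' z)"
    unfolding ip_self [symmetric] by (rule orth [OF cc])
  also have "ip h (\<lambda>z. r z - c * r' z) = ip h r - cnj c * ip h r'" if "cont h" for h
    using that by (subst ip_diff_right) (auto intro!: cont continuous_intros simp: ip_cmult_right)
  from this [OF cont(1)] this [OF cont(2)]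
  have "ip r (\<lambda>z. r z - c * r' z) - c * ip r' (\<lambda>z. r z - c * r' z)
      = ip r r - cnj c * ip r r' - c * (ip r' r - cnj c * ip r' r')" by simp
  also have "\<dots> = of_real (N2 r - (cmod (ip r r'))\<^sup>2 / N2 r')"
  proof -
    have "ip r' r = cnj (ip r r')" by (simp add: cnj_ip)
    moreover have "complex_of_real ((cmod (ip r r'))\<^sup>2) = ip r r' * cnj (ip r r')"
      by (rule complex_norm_square)
    ultimately show ?thesis
      using pos by (simp add: c_def ip_self field_simps del: of_real_power)
  qed
  finally show "N2 (\<lambda>z. r z - c * r' z) = N2 r - (cmod (ip r r'))\<^sup>2 / N2 r'"
    using of_real_eq_iff by (rule iffD1 [rotated])
qed

text \<open>The Gram matrix is invertible: a vector in its kernel holds the conjugated coefficients of a combination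
  of monomials that is orthogonal to each of these monomials, hence to itself.\<close>

lemma solve_normal_equations:
  fixes xs :: "'n multi_index list"
  defines "m \<equiv> length xs"
  defines "M \<equiv> Matrix.mat m m (\<lambda>(i, j). moment \<mu> (xs ! i) (xs ! j))"
  assumes "distinct xs"
  shows "\<exists>x. the (mat_inverse M) *\<^sub>v Matrix.vec m (\<lambda>i. moment \<mu> (xs ! i) \<beta>) = Matrix.vec m x \<and>
    (\<forall>i<m. (\<Sum>j<m. moment \<mu> (xs ! i) (xs ! j) * x j) = moment \<mu> (xs ! i) \<beta>)"
proof -
  have M: "M \<in> carrier_mat m m" by (simp add: M_def)
  have "Determinant.det M \<noteq> 0"
  proof
    assume "Determinant.det M = 0"
    then obtain v where v: "v \<in> carrier_vec m" "v \<noteq> 0\<^sub>v m" "M *\<^sub>v v = 0\<^sub>v m"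
      using det_0_iff_vec_prod_zero_field [OF M] by blast
    obtain i0 where i0: "i0 < m" "vec_index v i0 \<noteq> 0"
      using v(1,2) by (auto simp: vec_eq_iff)
    define idx where "idx \<delta> = (THE i. i < m \<and> xs ! i = \<delta>)" for \<delta>
    have idx: "idx (xs ! i) = i" if "i < m" for i
      unfolding idx_def using that assms(3) by (intro the_equality) (auto simp: m_def nth_eq_iff_index_eq)
    define y where "y = (\<lambda>z. \<Sum>\<delta>\<in>set xs. cnj (vec_index v (idx \<delta>)) * monomial \<delta> z)"
    have bij: "bij_betw (\<lambda>i. xs ! i) {..<m} (set xs)"
      unfolding m_def using assms(3) by (rule bij_betw_nth) auto
    have y: "y z = (\<Sum>j<m. cnj (vec_index v j) * monomial (xs ! j) z)" for z
      unfolding y_def using idx by (subst sum.reindex_bij_betw [OF bij, symmetric]) (auto intro!: sum.cong)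
    have cont_y: "cont y" unfolding y_def by (intro continuous_intros)
    have orth: "ip (monomial (xs ! i)) y = 0" if "i < m" for i
    proof -
      have "ip (monomial (xs ! i)) y = (\<Sum>j<m. ip (monomial (xs ! i)) (\<lambda>z. cnj (vec_index v j) * monomial (xs ! j) z))"
        unfolding y [abs_def] by (rule ip_sum_right) (intro continuous_intros continuous_monomial)+
      also have "\<dots> = (\<Sum>j<m. moment \<mu> (xs ! i) (xs ! j) * vec_index v j)"
        by (simp add: ip_cmult_right moment_eq_ip mult.commute)
      also have "\<dots> = vec_index (M *\<^sub>v v) i"
        using that v(1) by (simp add: M_def scalar_prod_def lessThan_atLeast0)
      also have "\<dots> = 0" using v(3) that by simp
      finally show ?thesis .
    qed
    have "ip y y = (\<Sum>j<m. ip (\<lambda>z. cnj (vec_index v j) * monomial (xs ! j) z) y)"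
      by (subst (1) y [abs_def]) (rule ip_sum_left, (intro continuous_intros continuous_monomial cont_y)+)
    also have "\<dots> = 0" by (simp add: ip_cmult_left orth)
    finally have "N2 y = 0" by (simp add: ip_self)
    moreover have "0 < N2 y"
      unfolding N2_def y_def
      by (rule definite [of _ "xs ! i0"]) (use i0 idx in \<open>simp_all add: m_def\<close>)
    ultimately show False by simp
  qed
  then have unit: "M \<in> Units (ring_mat TYPE(complex) m ())"
    by (rule det_non_zero_imp_unit [OF M])
  have "mat_inverse M \<noteq> None"
  proof
    assume "mat_inverse M = None"
    then have "M \<notin> Units (ring_mat TYPE(complex) m ())" by (rule mat_inverse(1) [OF M])
    with unit show False by simp
  qed
  then obtain B where B: "mat_inverse M = Some B" by auto
  have MB: "M * B = 1\<^sub>m m" "B \<in> carrier_mat m m"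
    using mat_inverse(2) [OF M B] by auto
  define b where "b = Matrix.vec m (\<lambda>i. moment \<mu> (xs ! i) \<beta>)"
  have b: "b \<in> carrier_vec m" by (simp add: b_def)
  define x where "x j = vec_index (B *\<^sub>v b) j" for j
  have Bb: "B *\<^sub>v b = Matrix.vec m x"
    using MB(2) by (intro eq_vecI) (auto simp: x_def)
  have "M *\<^sub>v (B *\<^sub>v b) = b"
    using M MB b by (simp flip: assoc_mult_mat_vec)
  then have Mx: "M *\<^sub>v Matrix.vec m x = b" by (simp only: Bb)
  show ?thesis
  proof (intro exI allI impI conjI)
    show "the (mat_inverse M) *\<^sub>v Matrix.vec m (\<lambda>i. moment \<mu> (xs ! i) \<beta>) = Matrix.vec m x"
      unfolding B option.sel b_def [symmetric] by (rule Bb)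
    fix i assume i: "i < m"
    have "vec_index (M *\<^sub>v Matrix.vec m x) i = (\<Sum>j<m. moment \<mu> (xs ! i) (xs ! j) * x j)"
      using i by (simp add: M_def scalar_prod_def lessThan_atLeast0)
    then show "(\<Sum>j<m. moment \<mu> (xs ! i) (xs ! j) * x j) = moment \<mu> (xs ! i) \<beta>"
      using i by (simp add: Mx b_def)
  qed
qed

text \<open>The expression \<open>K(\<alpha>, \<beta>) - u M\<^sup>-\<^sup>1 v\<close> is the inner product of \<open>\<zeta>\<^sup>\<alpha>\<close> with the residual of \<open>\<zeta>\<^sup>\<beta>\<close>, because
  \<open>M\<^sup>-\<^sup>1 v\<close> solves the normal equations of the projection.  The coefficients are conjugated since \<open>ip\<close> is antilinear in
  its second argument.\<close>

lemma residual_from_inverse: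
  fixes xs :: "'n multi_index list"
  defines "m \<equiv> length xs"
  defines "M \<equiv> Matrix.mat m m (\<lambda>(i, j). moment \<mu> (xs ! i) (xs ! j))"
  assumes xs: "distinct xs"
  shows "\<exists>r. residual (set xs) \<beta> r \<and> (\<forall>\<alpha>. moment \<mu> \<alpha> \<beta> -
    Matrix.vec m (\<lambda>j. moment \<mu> \<alpha> (xs ! j)) \<bullet> (the (mat_inverse M) *\<^sub>v Matrix.vec m (\<lambda>i. moment \<mu> (xs ! i) \<beta>))
    = ip (monomial \<alpha>) r)"
proof -
  define sol where "sol = the (mat_inverse M) *\<^sub>v Matrix.vec m (\<lambda>i. moment \<mu> (xs ! i) \<beta>)"
  obtain x where x: "sol = Matrix.vec m x"
    "\<And>i. i < m \<Longrightarrow> (\<Sum>j<m. moment \<mu> (xs ! i) (xs ! j) * x j) = moment \<mu> (xs ! i) \<beta>"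
    using solve_normal_equations [OF xs, of \<beta>] unfolding sol_def M_def m_def by blast
  define idx where "idx \<delta> = (THE i. i < m \<and> xs ! i = \<delta>)" for \<delta>
  have idx: "idx (xs ! i) = i" if "i < m" for i
    unfolding idx_def using that xs by (intro the_equality) (auto simp: m_def nth_eq_iff_index_eq)
  have bij: "bij_betw (\<lambda>i. xs ! i) {..<m} (set xs)"
    unfolding m_def using xs by (rule bij_betw_nth) auto
  define r where "r = (\<lambda>z. monomial \<beta> z - (\<Sum>\<delta>\<in>set xs. cnj (x (idx \<delta>)) * monomial \<delta> z))"
  have r: "r = (\<lambda>z. monomial \<beta> z - (\<Sum>j<m. cnj (x j) * monomial (xs ! j) z))"
    unfolding r_def using idx by (subst sum.reindex_bij_betw [OF bij, symmetric]) (auto intro!: sum.cong)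
  have ipr: "ip (monomial \<alpha>) r = moment \<mu> \<alpha> \<beta> - (\<Sum>j<m. moment \<mu> \<alpha> (xs ! j) * x j)" for \<alpha>
  proof -
    have "ip (monomial \<alpha>) r = ip (monomial \<alpha>) (monomial \<beta>) - ip (monomial \<alpha>) (\<lambda>z. \<Sum>j<m. cnj (x j) * monomial (xs ! j) z)"
      unfolding r by (intro ip_diff_right continuous_monomial continuous_intros)
    also have "ip (monomial \<alpha>) (\<lambda>z. \<Sum>j<m. cnj (x j) * monomial (xs ! j) z)
        = (\<Sum>j<m. ip (monomial \<alpha>) (\<lambda>z. cnj (x j) * monomial (xs ! j) z))"
      by (rule ip_sum_right) (intro continuous_monomial continuous_intros)+
    finally show ?thesis by (simp add: ip_cmult_right moment_eq_ip mult.commute)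
  qed
  show ?thesis
  proof (intro exI conjI allI)
    show "residual (set xs) \<beta> r"
      unfolding residual_def
    proof (intro conjI ballI)
      show "\<exists>c. r = (\<lambda>z. monomial \<beta> z - (\<Sum>\<delta>\<in>set xs. c \<delta> * monomial \<delta> z))"
        unfolding r_def by (rule exI) (rule refl)
      fix \<delta> assume "\<delta> \<in> set xs"
      then obtain i where i: "i < m" "\<delta> = xs ! i" by (auto simp: in_set_conv_nth m_def)
      have "ip (monomial \<delta>) r = 0" using x(2) [OF i(1)] by (simp add: ipr i(2))
      then show "ip r (monomial \<delta>) = 0" by (metis cnj_ip complex_cnj_zero)
    qed
    fix \<alpha>
    have "Matrix.vec m (\<lambda>j. moment \<mu> \<alpha> (xs ! j)) \<bullet> sol = (\<Sum>j<m. moment \<mu> \<alpha> (xs ! j) * x j)"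
      unfolding x(1) by (simp add: scalar_prod_def lessThan_atLeast0)
    then show "moment \<mu> \<alpha> \<beta> -
        Matrix.vec m (\<lambda>j. moment \<mu> \<alpha> (xs ! j)) \<bullet> (the (mat_inverse M) *\<^sub>v Matrix.vec m (\<lambda>i. moment \<mu> (xs ! i) \<beta>))
        = ip (monomial \<alpha>) r"
      unfolding sol_def [symmetric] by (simp add: ipr)
  qed
qed

lemma distinct_shortlex_between: "distinct (shortlex_between \<alpha> \<beta>)"
proof -
  have neq: "shortlex_between \<alpha> \<beta> ! i \<noteq> shortlex_between \<alpha> \<beta> ! j"
    if "i < j" "j < length (shortlex_between \<alpha> \<beta>)" for i j
    using sorted_wrt_nth_less [OF shortlex_between(1) that] by (auto simp: shortlex_irrefl)
  show ?thesis
    unfolding distinct_conv_nth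
  proof (intro allI impI)
    fix i j assume "i < length (shortlex_between \<alpha> \<beta>)" "j < length (shortlex_between \<alpha> \<beta>)" "i \<noteq> j"
    then show "shortlex_between \<alpha> \<beta> ! i \<noteq> shortlex_between \<alpha> \<beta> ! j"
      using neq [of i j] neq [of j i] by (cases i j rule: linorder_cases) auto
  qed
qed

text \<open>The Verblunsky coefficient is the correlation coefficient of the two residuals.\<close>

lemma verblunsky_above_residuals:
  fixes \<alpha> \<beta> :: "'n multi_index"
  defines "S \<equiv> {\<delta>. \<alpha> \<prec>\<^sub>s \<delta> \<and> \<delta> \<prec>\<^sub>s \<beta>}"
  shows "\<exists>r r'. residual S \<alpha> r \<and> residual S \<beta> r' \<and>
    (cmod (verblunsky_above (moment \<mu>) \<alpha> \<beta>))\<^sup>2 = (cmod (ip r r'))\<^sup>2 / (N2 r * N2 r')"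
proof -
  define xs where "xs = shortlex_between \<alpha> \<beta>"
  define m where "m = length xs"
  define Minv where "Minv = the (mat_inverse (Matrix.mat m m (\<lambda>(i, j). moment \<mu> (xs ! i) (xs ! j))))"
  have S: "set xs = S" unfolding xs_def S_def by (rule shortlex_between(2))
  have dist: "distinct xs" unfolding xs_def by (rule distinct_shortlex_between)
  define u where "u = Matrix.vec m (\<lambda>j. moment \<mu> \<alpha> (xs ! j))"
  define v where "v = Matrix.vec m (\<lambda>i. moment \<mu> (xs ! i) \<beta>)"
  have cnj_moment: "cnj (moment \<mu> \<gamma> \<delta>) = moment \<mu> \<delta> \<gamma>" for \<gamma> \<delta>
    by (simp add: moment_eq_ip cnj_ip)
  have cu: "conjugate u = Matrix.vec m (\<lambda>i. moment \<mu> (xs ! i) \<alpha>)"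
    by (intro eq_vecI) (auto simp: u_def cnj_moment conjugate_complex_def)
  have cv: "conjugate v = Matrix.vec m (\<lambda>j. moment \<mu> \<beta> (xs ! j))"
    by (intro eq_vecI) (auto simp: v_def cnj_moment conjugate_complex_def)
  obtain r where r: "residual S \<alpha> r"
    "moment \<mu> \<alpha> \<alpha> - u \<bullet> (Minv *\<^sub>v conjugate u) = ip (monomial \<alpha>) r"
    using residual_from_inverse [OF dist, of \<alpha>] unfolding S m_def [symmetric] Minv_def [symmetric] cu
    by (auto simp: u_def)
  obtain r' where r': "residual S \<beta> r'"
    "moment \<mu> \<alpha> \<beta> - u \<bullet> (Minv *\<^sub>v v) = ip (monomial \<alpha>) r'"
    "moment \<mu> \<beta> \<beta> - conjugate v \<bullet> (Minv *\<^sub>v v) = ip (monomial \<beta>) r'"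
    using residual_from_inverse [OF dist, of \<beta>] unfolding S m_def [symmetric] Minv_def [symmetric] cv
    by (auto simp: u_def v_def)
  have sym: "ip (monomial \<gamma>) s = cnj (ip s (monomial \<gamma>))" for \<gamma> s by (rule cnj_ip [symmetric])
  have 1: "ip (monomial \<alpha>) r = of_real (N2 r)"
    unfolding sym residual_ip [OF r(1) r(1), symmetric] ip_self by simp
  have 2: "ip (monomial \<beta>) r' = of_real (N2 r')"
    unfolding sym residual_ip [OF r'(1) r'(1), symmetric] ip_self by simp
  have 3: "ip (monomial \<alpha>) r' = ip r r'"
    unfolding sym residual_ip [OF r'(1) r(1), symmetric] by (rule cnj_ip)
  have "verblunsky_above (moment \<mu>) \<alpha> \<beta> =
      (moment \<mu> \<alpha> \<beta> - u \<bullet> (Minv *\<^sub>v v)) /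
         (csqrt (moment \<mu> \<alpha> \<alpha> - u \<bullet> (Minv *\<^sub>v conjugate u)) *
          csqrt (moment \<mu> \<beta> \<beta> - conjugate v \<bullet> (Minv *\<^sub>v v)))"
    unfolding verblunsky_above_def Let_def xs_def [symmetric] m_def [symmetric] Minv_def [symmetric]
      u_def [symmetric] v_def [symmetric] ..
  also have "\<dots> = ip r r' / (of_real (sqrt (N2 r)) * of_real (sqrt (N2 r')))"
    unfolding r(2) r'(2,3) 1 2 3 using N2_nonneg [of r] N2_nonneg [of r'] by simp
  finally have "(cmod (verblunsky_above (moment \<mu>) \<alpha> \<beta>))\<^sup>2 = (cmod (ip r r'))\<^sup>2 / (N2 r * N2 r')"
    using N2_nonneg [of r] N2_nonneg [of r']
    by (simp add: norm_divide norm_mult power_divide power_mult_distrib)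
  then show ?thesis using r(1) r'(1) by blast
qed

lemma zero_shortlex: "0 \<prec>\<^sub>s \<alpha> \<longleftrightarrow> \<alpha> \<noteq> (0 :: 'n multi_index)"
proof
  assume "\<alpha> \<noteq> 0"
  then obtain i where i: "vec_nth \<alpha> i \<noteq> 0" by (auto simp: Finite_Cartesian_Product.vec_eq_iff)
  have "vec_nth \<alpha> i \<le> mi_abs \<alpha>" by (rule vec_nth_le_mi_abs)
  then show "0 \<prec>\<^sub>s \<alpha>" using i by (simp add: shortlex_def)
qed (auto simp: shortlex_irrefl)

lemma shortlex_enum_0: "shortlex_enum 0 = (0 :: 'n multi_index)"
proof (rule ccontr)
  assume "shortlex_enum 0 \<noteq> (0 :: 'n multi_index)"
  then have "(0 :: 'n multi_index) \<in> {\<delta>. \<delta> \<prec>\<^sub>s shortlex_enum 0}" by (simp add: zero_shortlex)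
  moreover have "card {\<delta> :: 'n multi_index. \<delta> \<prec>\<^sub>s shortlex_enum 0} = 0" by (rule card_below_shortlex_enum)
  ultimately show False
    using finite_shortlex_below [of "shortlex_enum 0 :: 'n multi_index"] by auto
qed

definition initial :: "nat \<Rightarrow> 'n multi_index set" where
  "initial n = {\<delta>. 0 \<prec>\<^sub>s \<delta> \<and> \<delta> \<prec>\<^sub>s shortlex_enum n}"

lemma finite_initial: "finite (initial n)"
  unfolding initial_def by (rule finite_subset [OF _ finite_shortlex_below]) auto

lemma initial_Suc: "0 < n \<Longrightarrow> initial (Suc n) = insert (shortlex_enum n) (initial n)"
proof -
  assume n: "0 < n"
  have "\<delta> \<prec>\<^sub>s shortlex_enum (Suc n) \<longleftrightarrow> \<delta> = shortlex_enum n \<or> \<delta> \<prec>\<^sub>s shortlex_enum n" for \<delta> :: "'n multi_index"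
  proof -
    obtain k where k: "\<delta> = shortlex_enum k" using bij_shortlex_enum [where 'a = 'n] by (metis bij_pointE)
    have "(shortlex_enum k = (shortlex_enum n :: 'n multi_index)) = (k = n)"
      using bij_shortlex_enum [where 'a = 'n] by (auto simp: bij_def inj_eq)
    then show ?thesis by (auto simp: k shortlex_enum_less_iff)
  qed
  moreover have "0 \<prec>\<^sub>s (shortlex_enum n :: 'n multi_index)"
    using shortlex_enum_less_iff [where 'a = 'n, of 0 n] n by (simp add: shortlex_enum_0)
  ultimately show ?thesis by (auto simp: initial_def)
qed

text \<open>The partial products telescope: multiplying by \<open>1 - \<bar>\<gamma>\<bar>\<^sup>2\<close> is the effect of one
  Gram--Schmidt step on the squared distance of the constant \<open>1\<close> from the span of the monomials.\<close>

lemma verblunsky_product: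
  assumes mass: "measure \<mu> (space \<mu>) = 1"
  shows "\<exists>r. residual (initial (Suc n)) 0 r \<and>
    (\<Prod>k<Suc n. 1 - (cmod (verblunsky \<mu> 0 (shortlex_enum k)))\<^sup>2) = N2 r"
proof (induction n)
  case 0
  have "initial (Suc 0) = {}"
  proof -
    have "\<not> (0 \<prec>\<^sub>s \<delta> \<and> \<delta> \<prec>\<^sub>s shortlex_enum (Suc 0))" for \<delta> :: "'n multi_index"
    proof -
      obtain k where k: "\<delta> = shortlex_enum k" using bij_shortlex_enum [where 'a = 'n] by (metis bij_pointE)
      show ?thesis
        using shortlex_enum_less_iff [where 'a = 'n, of 0 k] by (auto simp: k shortlex_enum_less_iff shortlex_enum_0)
    qed
    then show ?thesis by (auto simp: initial_def)
  qed
  moreover have "residual {} 0 (\<lambda>z. 1)"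
    by (auto simp: residual_def)
  moreover have "N2 (\<lambda>z. 1) = 1" using mass by (simp add: N2_def)
  ultimately show ?case
    by (intro exI [of _ "\<lambda>z. 1"]) (simp add: shortlex_enum_0 verblunsky_def)
next
  case (Suc n)
  let ?e = "shortlex_enum (Suc n) :: 'n multi_index"
  obtain r where r: "residual (initial (Suc n)) 0 r"
    "(\<Prod>k<Suc n. 1 - (cmod (verblunsky \<mu> 0 (shortlex_enum k)))\<^sup>2) = N2 r"
    using Suc.IH by (elim exE conjE) (rule that)
  have less: "0 \<prec>\<^sub>s ?e"
    using shortlex_enum_less_iff [where 'a = 'n, of 0 "Suc n"] by (simp add: shortlex_enum_0)
  then have neq: "(0 :: 'n multi_index) \<noteq> ?e" by (auto simp: shortlex_irrefl)
  obtain s s' where s: "residual (initial (Suc n)) 0 s" "residual (initial (Suc n)) ?e s'"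
    "(cmod (verblunsky_above (moment \<mu>) 0 ?e))\<^sup>2 = (cmod (ip s s'))\<^sup>2 / (N2 s * N2 s')"
    using verblunsky_above_residuals [of 0 ?e, folded initial_def] by (elim exE conjE) (rule that)
  have notin: "?e \<notin> initial (Suc n)" "0 \<notin> initial (Suc n)"
    by (auto simp: initial_def shortlex_irrefl)
  have pos: "0 < N2 s" by (rule residual_N2_pos [OF s(1) finite_initial notin(2)])
  have rs: "N2 r = N2 s" by (rule residual_N2_unique [OF r(1) s(1)])
  define t where "t = (\<lambda>z. s z - ip s s' / of_real (N2 s') * s' z)"
  have t: "residual (initial (Suc (Suc n))) 0 t" "N2 t = N2 s - (cmod (ip s s'))\<^sup>2 / N2 s'"
    unfolding t_def initial_Suc [OF zero_less_Suc]
    by (rule residual_insert [OF s(1,2) finite_initial notin(1)])+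
  have "(\<Prod>k<Suc (Suc n). 1 - (cmod (verblunsky \<mu> 0 (shortlex_enum k)))\<^sup>2)
      = N2 s * (1 - (cmod (verblunsky \<mu> 0 ?e))\<^sup>2)"
    by (subst prod.lessThan_Suc) (simp only: r(2) rs)
  also have "verblunsky \<mu> 0 ?e = verblunsky_above (moment \<mu>) 0 ?e"
    using less neq by (simp add: verblunsky_def)
  also have "N2 s * (1 - (cmod (verblunsky_above (moment \<mu>) 0 ?e))\<^sup>2) = N2 t"
    unfolding s(3) t(2) using pos by (simp add: right_diff_distrib)
  finally show ?case using t(1) by (intro exI conjI)
qed

end

section \<open>Removing the point masses\<close>

lemma nn_integral_mono_measure:
  assumes "sets M = sets N" and le: "\<And>A. A \<in> sets M \<Longrightarrow> emeasure M A \<le> emeasure N A"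
  shows "(\<integral>\<^sup>+x. f x \<partial>M) \<le> (\<integral>\<^sup>+x. f x \<partial>N)"
proof -
  have sp: "space M = space N" using assms(1) by (rule sets_eq_imp_space_eq)
  have "integral\<^sup>S M h \<le> integral\<^sup>S N h" if h: "simple_function M h" for h
    unfolding simple_integral_def sp [symmetric]
    by (intro sum_mono mult_left_mono le simple_functionD [OF h]) auto
  moreover have "simple_function N h" if "simple_function M h" for h
    using that unfolding simple_function_def sp [symmetric] assms(1) .
  ultimately show ?thesis
    unfolding nn_integral_def sp [symmetric]
    by (intro SUP_mono) (auto simp: sp)
qed

lemma borel_measurable_indicator_compl:
  assumes "countable D" and sets_mu: "sets \<mu> = sets (sphere_measure :: 'a::euclidean_space measure)"
  shows "(\<lambda>\<zeta>. indicator (- D) \<zeta> :: real) \<in> borel_measurable \<mu>"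
proof -
  have "D \<in> sets borel" by (rule sets.countable [OF _ assms(1)]) simp
  then have "- D \<in> sets borel" by (rule borel_comp)
  then have "(indicator (- D) :: 'a \<Rightarrow> real) \<in> borel_measurable borel" by simp
  then have "(indicator (- D) :: 'a \<Rightarrow> real) \<in> borel_measurable sphere_measure"
    by (rule borel_measurable_sphere_restrict)
  then show ?thesis unfolding measurable_cong_sets [OF sets_mu refl] .
qed

text \<open>The polynomial \<open>((1 + \<langle>z, \<xi>\<rangle>) / 2)\<^sup>n\<close> peaks at \<open>\<xi>\<close>, and its value at \<open>0\<close> is \<open>2\<^sup>-\<^sup>n\<close>.\<close>

lemma peak_function:
  fixes \<zeta> \<xi> :: "'n::finite cspace"
  assumes "norm \<zeta> = 1" "norm \<xi> = 1"
  shows "cmod ((1 + herm \<zeta> \<xi>) / 2) \<le> 1" "\<zeta> \<noteq> \<xi> \<Longrightarrow> cmod ((1 + herm \<zeta> \<xi>) / 2) < 1"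
proof -
  define a where "a = herm \<zeta> \<xi>"
  have a: "cmod a \<le> 1" using herm_Cauchy_Schwarz [of \<zeta> \<xi>] assms by (simp add: a_def)
  have "cmod (1 + a) \<le> 2" using norm_triangle_ineq [of 1 a] a by simp
  then show "cmod ((1 + herm \<zeta> \<xi>) / 2) \<le> 1" by (simp add: a_def norm_divide)
  assume "\<zeta> \<noteq> \<xi>"
  then have "0 < (norm (\<zeta> - \<xi>))\<^sup>2" by simp
  also have "(norm (\<zeta> - \<xi>))\<^sup>2 = 2 - 2 * Re a"
    unfolding power2_norm_eq_inner inner_diff_left inner_diff_right
    using assms by (simp add: inner_commute [of \<xi>] inner_eq_Re_herm [of \<zeta> \<xi>] a_def flip: power2_norm_eq_inner)
  finally have Re: "Re a < 1" by simp
  have "(cmod (1 + a))\<^sup>2 = 1 + 2 * Re a + (cmod a)\<^sup>2"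
    unfolding cmod_power2 by (simp add: power2_eq_square algebra_simps)
  also have "\<dots> < 4" using Re a abs_square_le_1 [of "cmod a"] by simp
  finally have "(cmod (1 + a))\<^sup>2 < 2\<^sup>2" by simp
  then have "cmod (1 + a) < 2" by (rule power_less_imp_less_base) simp
  then show "cmod ((1 + herm \<zeta> \<xi>) / 2) < 1" by (simp add: a_def norm_divide)
qed

text \<open>One more point \<open>\<xi>\<close> is removed by multiplying \<open>p\<close> by \<open>1 - f\<^sup>n\<close> with the peak function \<open>f\<close> at \<open>\<xi>\<close>: in the
  limit the product vanishes at \<open>\<xi>\<close> and agrees with \<open>p\<close> at the origin and on the rest of the sphere.\<close>

lemma remove_finitely_many_points:
  fixes \<mu> :: "'n::finite cspace measure"
  assumes fin: "finite_measure \<mu>" and sets_mu: "sets \<mu> = sets sphere_measure"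
    and L: "\<And>p m. poly_fun m p \<Longrightarrow> L * (cmod (p 0))\<^sup>2 \<le> (\<integral>\<zeta>. (cmod (p \<zeta>))\<^sup>2 \<partial>\<mu>)"
    and "finite F" "F \<subseteq> sphere 0 1" "poly_fun m p"
  shows "L * (cmod (p 0))\<^sup>2 \<le> (\<integral>\<zeta>. indicator (- F) \<zeta> * (cmod (p \<zeta>))\<^sup>2 \<partial>\<mu>)"
  using assms(4-6)
proof (induction F arbitrary: m p rule: finite_induct)
  case empty
  then show ?case using L by simp
next
  case (insert \<xi> F)
  interpret \<mu>: finite_measure \<mu> by (rule fin)
  have space_mu: "space \<mu> = sphere 0 1" using sets_eq_imp_space_eq [OF sets_mu] by simp
  have \<xi>: "norm \<xi> = 1" using insert.prems(1) by simp
  note p = insert.prems(2)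
  define f where "f z = (1 + herm z \<xi>) / 2" for z
  have f_poly: "poly_fun 1 f"
  proof -
    have "poly_fun 1 (\<lambda>z. 1 / 2 + (1 / 2) * herm z \<xi>)"
      by (intro poly_fun_add poly_fun_const poly_fun_cmult poly_fun_herm)
    moreover have "f = (\<lambda>z. 1 / 2 + (1 / 2) * herm z \<xi>)" by (simp add: f_def fun_eq_iff add_divide_distrib)
    ultimately show ?thesis by simp
  qed
  define P where "P n z = p z * (1 - f z ^ n)" for n z
  have P_poly: "poly_fun (m + n * 1) (P n)" for n
    unfolding P_def by (intro poly_fun_mult p poly_fun_diff poly_fun_const poly_fun_power f_poly)
  have P0: "P n 0 = p 0 * (1 - (1 / 2) ^ n)" for n
    by (simp add: P_def f_def)
  obtain B where B: "\<And>z. z \<in> sphere 0 1 \<Longrightarrow> cmod (p z) \<le> B"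
    using continuous_on_compact_bound [OF compact_sphere continuous_on_poly_fun [OF p]] by blast
  have meas_cont: "h \<in> borel_measurable \<mu>" if "continuous_on (sphere 0 1) h" for h :: "'n cspace \<Rightarrow> real"
    unfolding measurable_cong_sets [OF sets_mu refl] by (rule borel_measurable_sphere_cont [OF that])
  have "(\<lambda>n. \<integral>\<zeta>. indicator (- F) \<zeta> * (cmod (P n \<zeta>))\<^sup>2 \<partial>\<mu>)
      \<longlonglongrightarrow> (\<integral>\<zeta>. indicator (- insert \<xi> F) \<zeta> * (cmod (p \<zeta>))\<^sup>2 \<partial>\<mu>)"
  proof (rule integral_dominated_convergence)
    show "(\<lambda>\<zeta>. indicator (- insert \<xi> F) \<zeta> * (cmod (p \<zeta>))\<^sup>2) \<in> borel_measurable \<mu>"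
      using insert.hyps
      by (intro borel_measurable_times borel_measurable_indicator_compl [OF _ sets_mu] meas_cont
          continuous_intros continuous_on_poly_fun [OF p]) (simp add: countable_finite)
    show "(\<lambda>\<zeta>. indicator (- F) \<zeta> * (cmod (P n \<zeta>))\<^sup>2) \<in> borel_measurable \<mu>" for n
      using insert.hyps
      by (intro borel_measurable_times borel_measurable_indicator_compl [OF _ sets_mu] meas_cont
          continuous_intros continuous_on_poly_fun [OF P_poly]) (simp add: countable_finite)
    show "AE \<zeta> in \<mu>. (\<lambda>n. indicator (- F) \<zeta> * (cmod (P n \<zeta>))\<^sup>2) \<longlonglongrightarrow> indicator (- insert \<xi> F) \<zeta> * (cmod (p \<zeta>))\<^sup>2"
    proof (intro AE_I2)
      fix \<zeta> assume "\<zeta> \<in> space \<mu>"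
      then have \<zeta>: "norm \<zeta> = 1" by (simp add: space_mu)
      show "(\<lambda>n. indicator (- F) \<zeta> * (cmod (P n \<zeta>))\<^sup>2) \<longlonglongrightarrow> indicator (- insert \<xi> F) \<zeta> * (cmod (p \<zeta>))\<^sup>2"
      proof (cases "\<zeta> = \<xi>")
        case True
        have "f \<xi> = 1" using \<xi> by (simp add: f_def herm_self)
        then have "P n \<zeta> = 0" for n by (simp add: P_def True)
        then show ?thesis by (simp add: True)
      next
        case False
        have "cmod (f \<zeta>) < 1" unfolding f_def by (rule peak_function(2) [OF \<zeta> \<xi> False])
        then have lim: "(\<lambda>n. f \<zeta> ^ n) \<longlonglongrightarrow> 0" by (rule LIMSEQ_power_zero)
        have "(\<lambda>n. indicator (- F) \<zeta> * (cmod (P n \<zeta>))\<^sup>2) \<longlonglongrightarrow> indicator (- F) \<zeta> * (cmod (p \<zeta> * (1 - 0)))\<^sup>2"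
          unfolding P_def
          by (intro tendsto_mult tendsto_const tendsto_power tendsto_norm tendsto_diff lim)
        then show ?thesis using False by (simp add: indicator_def)
      qed
    qed
    show "AE \<zeta> in \<mu>. norm (indicator (- F) \<zeta> * (cmod (P n \<zeta>))\<^sup>2) \<le> (B * 2)\<^sup>2" for n
    proof (intro AE_I2)
      fix \<zeta> assume "\<zeta> \<in> space \<mu>"
      then have \<zeta>: "norm \<zeta> = 1" by (simp add: space_mu)
      have "cmod (f \<zeta>) \<le> 1" unfolding f_def by (rule peak_function(1) [OF \<zeta> \<xi>])
      then have "cmod (f \<zeta> ^ n) \<le> 1" by (simp add: norm_power power_le_one)
      then have "cmod (1 - f \<zeta> ^ n) \<le> 2" using norm_triangle_ineq4 [of 1 "f \<zeta> ^ n"] by simp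
      then have "cmod (P n \<zeta>) \<le> B * 2"
        unfolding P_def norm_mult using B [of \<zeta>] \<zeta> order_trans [OF norm_ge_zero B [of \<zeta>]]
        by (intro mult_mono) auto
      then have "(cmod (P n \<zeta>))\<^sup>2 \<le> (B * 2)\<^sup>2" by (rule power_mono) simp
      then show "norm (indicator (- F) \<zeta> * (cmod (P n \<zeta>))\<^sup>2) \<le> (B * 2)\<^sup>2"
        by (cases "\<zeta> \<in> F") simp_all
    qed
  qed simp
  note limR = this
  have limL: "(\<lambda>n. L * (cmod (P n 0))\<^sup>2) \<longlonglongrightarrow> L * (cmod (p 0 * (1 - 0)))\<^sup>2"
    unfolding P0 by (intro tendsto_intros LIMSEQ_power_zero) simp
  have "L * (cmod (p 0 * (1 - 0)))\<^sup>2 \<le> (\<integral>\<zeta>. indicator (- insert \<xi> F) \<zeta> * (cmod (p \<zeta>))\<^sup>2 \<partial>\<mu>)"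
  proof (rule LIMSEQ_le [OF limL limR], intro exI [of _ 0] allI impI)
    fix n
    show "L * (cmod (P n 0))\<^sup>2 \<le> (\<integral>\<zeta>. indicator (- F) \<zeta> * (cmod (P n \<zeta>))\<^sup>2 \<partial>\<mu>)"
      using insert.IH [OF _ P_poly [of n]] insert.prems(1) by simp
  qed
  then show ?case by simp
qed

lemma remove_countably_many_points:
  fixes \<mu> :: "'n::finite cspace measure"
  assumes fin: "finite_measure \<mu>" and sets_mu: "sets \<mu> = sets sphere_measure"
    and L: "\<And>p m. poly_fun m p \<Longrightarrow> L * (cmod (p 0))\<^sup>2 \<le> (\<integral>\<zeta>. (cmod (p \<zeta>))\<^sup>2 \<partial>\<mu>)"
    and D: "countable D" "D \<subseteq> sphere 0 1" and p: "poly_fun m p"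
  shows "L * (cmod (p 0))\<^sup>2 \<le> (\<integral>\<zeta>. indicator (- D) \<zeta> * (cmod (p \<zeta>))\<^sup>2 \<partial>\<mu>)"
proof (cases "D = {}")
  case True
  then show ?thesis using L [OF p] by simp
next
  case False
  interpret \<mu>: finite_measure \<mu> by (rule fin)
  have space_mu: "space \<mu> = sphere 0 1" using sets_eq_imp_space_eq [OF sets_mu] by simp
  define F where "F n = from_nat_into D ` {..<n}" for n :: nat
  have F_sub: "F n \<subseteq> D" for n unfolding F_def using from_nat_into [OF False] by auto
  have in_F: "\<exists>N. \<forall>n\<ge>N. \<zeta> \<in> F n" if "\<zeta> \<in> D" for \<zeta>
  proof -
    have "\<zeta> \<in> range (from_nat_into D)" using that range_from_nat_into [OF False D(1)] by simp
    then obtain k where "\<zeta> = from_nat_into D k" by auto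
    then have "\<forall>n\<ge>Suc k. \<zeta> \<in> F n" by (auto simp: F_def)
    then show ?thesis by (rule exI)
  qed
  obtain B where B: "\<And>z. z \<in> sphere 0 1 \<Longrightarrow> cmod (p z) \<le> B"
    using continuous_on_compact_bound [OF compact_sphere continuous_on_poly_fun [OF p]] by blast
  have meas_p: "(\<lambda>\<zeta>. (cmod (p \<zeta>))\<^sup>2) \<in> borel_measurable \<mu>"
    unfolding measurable_cong_sets [OF sets_mu refl]
    by (intro borel_measurable_sphere_cont continuous_intros continuous_on_poly_fun [OF p])
  have "(\<lambda>n. \<integral>\<zeta>. indicator (- F n) \<zeta> * (cmod (p \<zeta>))\<^sup>2 \<partial>\<mu>) \<longlonglongrightarrow> (\<integral>\<zeta>. indicator (- D) \<zeta> * (cmod (p \<zeta>))\<^sup>2 \<partial>\<mu>)"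
  proof (rule integral_dominated_convergence)
    show "(\<lambda>\<zeta>. indicator (- D) \<zeta> * (cmod (p \<zeta>))\<^sup>2) \<in> borel_measurable \<mu>"
      by (intro borel_measurable_times borel_measurable_indicator_compl [OF D(1) sets_mu] meas_p)
    show "(\<lambda>\<zeta>. indicator (- F n) \<zeta> * (cmod (p \<zeta>))\<^sup>2) \<in> borel_measurable \<mu>" for n
      by (intro borel_measurable_times borel_measurable_indicator_compl [OF _ sets_mu] meas_p)
         (simp add: F_def countable_finite)
    show "AE \<zeta> in \<mu>. (\<lambda>n. indicator (- F n) \<zeta> * (cmod (p \<zeta>))\<^sup>2) \<longlonglongrightarrow> indicator (- D) \<zeta> * (cmod (p \<zeta>))\<^sup>2"
    proof (intro AE_I2)
      fix \<zeta>
      have "\<forall>\<^sub>F n in sequentially. indicator (- F n) \<zeta> * (cmod (p \<zeta>))\<^sup>2 = indicator (- D) \<zeta> * (cmod (p \<zeta>))\<^sup>2"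
      proof (cases "\<zeta> \<in> D")
        case True
        then obtain N where N: "\<forall>n\<ge>N. \<zeta> \<in> F n" using in_F by (elim exE [OF in_F]) (rule that)
        then show ?thesis
          unfolding eventually_sequentially using True by (intro exI [of _ N]) simp
      next
        case False
        then have "\<zeta> \<notin> F n" for n using F_sub by blast
        then show ?thesis using False by simp
      qed
      then show "(\<lambda>n. indicator (- F n) \<zeta> * (cmod (p \<zeta>))\<^sup>2) \<longlonglongrightarrow> indicator (- D) \<zeta> * (cmod (p \<zeta>))\<^sup>2"
        by (rule tendsto_eventually)
    qed
    show "AE \<zeta> in \<mu>. norm (indicator (- F n) \<zeta> * (cmod (p \<zeta>))\<^sup>2) \<le> B\<^sup>2" for n
    proof (intro AE_I2)
      fix \<zeta> assume "\<zeta> \<in> space \<mu>"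
      then have "(cmod (p \<zeta>))\<^sup>2 \<le> B\<^sup>2" by (intro power_mono B) (simp_all add: space_mu)
      then show "norm (indicator (- F n) \<zeta> * (cmod (p \<zeta>))\<^sup>2) \<le> B\<^sup>2"
        by (cases "\<zeta> \<in> F n") simp_all
    qed
  qed simp
  then show ?thesis
  proof (rule LIMSEQ_le_const, intro exI [of _ 0] allI impI)
    fix n
    have "F n \<subseteq> sphere 0 1" using F_sub D(2) by (rule subset_trans)
    moreover have "finite (F n)" by (simp add: F_def)
    ultimately show "L * (cmod (p 0))\<^sup>2 \<le> (\<integral>\<zeta>. indicator (- F n) \<zeta> * (cmod (p \<zeta>))\<^sup>2 \<partial>\<mu>)"
      by (intro remove_finitely_many_points [OF fin sets_mu L _ _ p])
  qed
qed

section \<open>The limit of the partial products\<close>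

context definite_sphere_measure
begin

lemma residual_zero_poly_fun:
  assumes "residual (initial n) 0 r"
  shows "(\<exists>m. poly_fun m r) \<and> r 0 = 1"
proof -
  obtain c where c: "r = (\<lambda>z. monomial 0 z - (\<Sum>\<delta>\<in>initial n. c \<delta> * monomial \<delta> z))"
    using assms by (auto simp: residual_def)
  have le: "mi_abs \<delta> \<le> (\<Sum>\<delta>\<in>initial n. mi_abs \<delta>)" if "\<delta> \<in> initial n" for \<delta>
    using that finite_initial by (intro member_le_sum) auto
  have "poly_fun (\<Sum>\<delta>\<in>initial n. mi_abs \<delta>) r"
    unfolding c
  proof (rule poly_fun_diff)
    show "poly_fun (\<Sum>\<delta>\<in>initial n. mi_abs \<delta>) (monomial 0)"
      by (rule poly_fun_monomial) (simp add: mi_abs_def)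
    show "poly_fun (\<Sum>\<delta>\<in>initial n. mi_abs \<delta>) (\<lambda>z. \<Sum>\<delta>\<in>initial n. c \<delta> * monomial \<delta> z)"
      by (intro poly_fun_sum poly_fun_cmult poly_fun_monomial le)
  qed
  moreover have "r 0 = 1"
  proof -
    have "(\<Sum>\<delta>\<in>initial n. c \<delta> * monomial \<delta> 0) = 0"
    proof (intro sum.neutral ballI)
      fix \<delta> assume "\<delta> \<in> initial n"
      then have "0 \<prec>\<^sub>s \<delta>" by (simp add: initial_def)
      then have "\<delta> \<noteq> 0" using shortlex_irrefl by blast
      then show "c \<delta> * monomial \<delta> 0 = 0" by (simp add: monomial_at_zero)
    qed
    then show ?thesis by (simp add: c)
  qed
  ultimately show ?thesis by blast
qed

lemma residual_minimal_subset:
  assumes r: "residual S \<alpha> r" and "finite S" "T \<subseteq> S"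
  shows "N2 r \<le> N2 (\<lambda>z. monomial \<alpha> z - (\<Sum>\<delta>\<in>T. d \<delta> * monomial \<delta> z))"
proof -
  have "(\<Sum>\<delta>\<in>S. (if \<delta> \<in> T then d \<delta> else 0) * monomial \<delta> z) = (\<Sum>\<delta>\<in>T. d \<delta> * monomial \<delta> z)" for z
    using assms(2,3) by (intro sum.mono_neutral_cong_right) auto
  then show ?thesis
    using residual_minimal [OF r, of "\<lambda>\<delta>. if \<delta> \<in> T then d \<delta> else 0"] by simp
qed

text \<open>A polynomial with \<open>p 0 = 1\<close> is \<open>1\<close> minus a combination of nonconstant monomials, all of which occur
  below some position of the shortlex enumeration.\<close>

lemma residual_initial_bound:
  assumes p: "poly_fun m p" "p 0 = 1"
  shows "\<exists>n. \<forall>r. residual (initial (Suc n)) 0 r \<longrightarrow> N2 r \<le> N2 p"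
proof -
  obtain c where c: "\<And>z. p z = (\<Sum>\<alpha> | mi_abs \<alpha> \<le> m. c \<alpha> * monomial \<alpha> z)"
    using p(1) by (elim poly_funE) (rule that)
  let ?T = "{\<alpha> :: 'n multi_index. mi_abs \<alpha> \<le> m} - {0}"
  have split: "p z = c 0 * monomial 0 z + (\<Sum>\<alpha>\<in>?T. c \<alpha> * monomial \<alpha> z)" for z
    unfolding c by (rule sum.remove) auto
  have "(\<Sum>\<alpha>\<in>?T. c \<alpha> * monomial \<alpha> 0) = 0"
    by (intro sum.neutral ballI) (auto simp: monomial_at_zero)
  then have c0: "c 0 = 1" using split [of 0] p(2) by simp
  have eq: "p = (\<lambda>z. monomial 0 z - (\<Sum>\<alpha>\<in>?T. (- c \<alpha>) * monomial \<alpha> z))"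
    by (rule ext) (simp add: split c0 sum_negf)
  define n where "n = (\<Sum>\<alpha>\<in>?T. inv_into UNIV shortlex_enum \<alpha>)"
  have surj: "surj (shortlex_enum :: nat \<Rightarrow> 'n multi_index)"
    using bij_shortlex_enum by (rule bij_is_surj)
  have T: "?T \<subseteq> initial (Suc n)"
  proof
    fix \<alpha> assume \<alpha>: "\<alpha> \<in> ?T"
    then have "inv_into UNIV shortlex_enum \<alpha> \<le> n"
      unfolding n_def by (intro member_le_sum) auto
    then have "shortlex_enum (inv_into UNIV shortlex_enum \<alpha>) \<prec>\<^sub>s (shortlex_enum (Suc n) :: 'n multi_index)"
      by (simp add: shortlex_enum_less_iff)
    then show "\<alpha> \<in> initial (Suc n)"
      using \<alpha> by (simp add: surj_f_inv_f [OF surj] initial_def zero_shortlex)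
  qed
  show ?thesis
  proof (intro exI allI impI)
    fix r assume "residual (initial (Suc n)) 0 r"
    then show "N2 r \<le> N2 p"
      unfolding eq by (rule residual_minimal_subset [OF _ finite_initial T])
  qed
qed

text \<open>The partial products decrease to the infimum of \<open>\<integral>\<bar>p\<bar>\<^sup>2 d\<mu>\<close> over all polynomials with
  \<open>p 0 = 1\<close>; the last two hypotheses characterise this infimum as \<open>l\<close>.\<close>

lemma verblunsky_product_limit:
  assumes mass: "measure \<mu> (space \<mu>) = 1"
    and lower: "\<And>p m. poly_fun m p \<Longrightarrow> p 0 = 1 \<Longrightarrow> l \<le> N2 p"
    and upper: "\<And>L. (\<And>p m. poly_fun m p \<Longrightarrow> L * (cmod (p 0))\<^sup>2 \<le> N2 p) \<Longrightarrow> L \<le> l"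
  shows "(\<lambda>n. \<Prod>k<n. 1 - (cmod (verblunsky \<mu> 0 (shortlex_enum k)))\<^sup>2) \<longlonglongrightarrow> l"
proof -
  define P where "P n = (\<Prod>k<n. 1 - (cmod (verblunsky \<mu> 0 (shortlex_enum k)))\<^sup>2)" for n
  have P: "\<exists>r. residual (initial (Suc n)) 0 r \<and> P (Suc n) = N2 r" for n
    unfolding P_def by (rule verblunsky_product [OF mass])
  have low: "l \<le> P (Suc n)" for n
  proof -
    obtain r where r: "residual (initial (Suc n)) 0 r" "P (Suc n) = N2 r" using P [of n] by blast
    then show ?thesis using residual_zero_poly_fun [OF r(1)] lower by auto
  qed
  have "decseq (\<lambda>n. P (Suc n))"
  proof (rule decseq_SucI)
    fix n
    obtain r where r: "residual (initial (Suc n)) 0 r" "P (Suc n) = N2 r" using P [of n] by blast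
    obtain r' where r': "residual (initial (Suc (Suc n))) 0 r'" "P (Suc (Suc n)) = N2 r'" using P [of "Suc n"] by blast
    obtain c where c: "r = (\<lambda>z. monomial 0 z - (\<Sum>\<delta>\<in>initial (Suc n). c \<delta> * monomial \<delta> z))"
      using r(1) by (auto simp: residual_def)
    have "N2 r' \<le> N2 r"
      unfolding c by (rule residual_minimal_subset [OF r'(1) finite_initial]) (simp add: initial_Suc subset_insertI)
    then show "P (Suc (Suc n)) \<le> P (Suc n)" by (simp only: r(2) r'(2))
  qed
  then obtain L where lim: "(\<lambda>n. P (Suc n)) \<longlonglongrightarrow> L" and ge: "\<forall>n. L \<le> P (Suc n)"
    by (rule decseq_convergent [of "\<lambda>n. P (Suc n)" l]) (use low in simp)
  have "l \<le> L" by (rule LIMSEQ_le_const [OF lim]) (use low in blast)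
  moreover have "L \<le> l"
  proof (rule upper)
    fix p :: "'n cspace \<Rightarrow> complex" and m assume p: "poly_fun m p"
    show "L * (cmod (p 0))\<^sup>2 \<le> N2 p"
    proof (cases "p 0 = 0")
      case True
      then show ?thesis by (simp add: N2_nonneg)
    next
      case False
      define q where "q = (\<lambda>z. (1 / p 0) * p z)"
      have "poly_fun m q" unfolding q_def by (rule poly_fun_cmult [OF p])
      moreover have "q 0 = 1" using False by (simp add: q_def)
      ultimately obtain n where n: "\<forall>r. residual (initial (Suc n)) 0 r \<longrightarrow> N2 r \<le> N2 q"
        using residual_initial_bound by blast
      obtain r where r: "residual (initial (Suc n)) 0 r" "P (Suc n) = N2 r" using P [of n] by blast
      have "L \<le> N2 r" using ge r(2) by metis
      also have "\<dots> \<le> N2 q" using n r(1) by simp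
      also have "\<dots> = N2 p / (cmod (p 0))\<^sup>2"
        by (simp add: N2_def q_def norm_mult norm_divide power_divide)
      finally show ?thesis using False by (simp add: pos_le_divide_eq)
    qed
  qed
  ultimately have "L = l" by simp
  then show ?thesis using lim unfolding P_def [symmetric] by (simp add: filterlim_sequentially_Suc)
qed

end

theorem theorem7p1:
  fixes g :: "'n::{finite,linorder} cspace \<Rightarrow> complex"
    and w :: "'n cspace \<Rightarrow> real"
    and \<mu>s \<mu> :: "'n cspace measure"
  assumes g: "g \<in> H_inf" "H_inf_norm g \<le> 1"
    and inv_g: "\<And>z. z \<in> ball 0 1 \<Longrightarrow> g z \<noteq> 0" "(\<lambda>z. 1 / g z) \<in> H_inf"
    and w: "w = (\<lambda>\<zeta>. (cmod (boundary_value g \<zeta>))\<^sup>2)"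
    and \<mu>s: "discrete_sphere_measure \<mu>s"
    and \<mu>: "sets \<mu> = sets (sphere_measure :: 'n cspace measure)"
      "\<And>A. A \<in> sets \<mu> \<Longrightarrow>
        emeasure \<mu> A = emeasure (density sphere_measure (\<lambda>\<zeta>. ennreal (w \<zeta>))) A + emeasure \<mu>s A"
    and "prob_space \<mu>"
  shows "has_shortlex_prod (\<lambda>\<alpha>. 1 - (cmod (verblunsky \<mu> 0 \<alpha>))\<^sup>2)
           (exp (\<integral>\<zeta>. ln (w \<zeta>) \<partial>sphere_measure))"
proof -
  interpret \<mu>: prob_space \<mu> by fact
  have g_bound: "cmod (g z) \<le> 1" if "norm z < 1" for z
  proof -
    have "bounded (g ` ball 0 1)" using g(1) by (simp add: H_inf_def)
    then have "bdd_above ((\<lambda>z. cmod (g z)) ` ball 0 1)"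
      by (auto simp: bounded_iff bdd_above_def)
    then have "cmod (g z) \<le> H_inf_norm g"
      unfolding H_inf_norm_def using that by (intro cSUP_upper) auto
    then show ?thesis using g(2) by linarith
  qed
  obtain M' where M': "\<And>z. norm z < 1 \<Longrightarrow> cmod (1 / g z) \<le> M'"
  proof -
    have "bounded ((\<lambda>z. 1 / g z) ` ball 0 1)" using inv_g(2) by (simp add: H_inf_def)
    then obtain M' where "\<forall>x\<in>(\<lambda>z. 1 / g z) ` ball 0 1. cmod x \<le> M'"
      unfolding bounded_iff by (elim exE) (rule that)
    then show thesis by (intro that [of M']) simp
  qed
  interpret g: invertible_holomorphic g 1 M'
    by unfold_locales (use g(1) inv_g g_bound M' in \<open>auto simp: H_inf_def\<close>)
  have w_meas: "w \<in> borel_measurable sphere_measure"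
    unfolding w using g.boundary_value_measurable by measurable
  have w_nonneg: "0 \<le> w \<zeta>" for \<zeta> by (simp add: w)
  have nn_weight: "(\<integral>\<^sup>+\<zeta>. ennreal ((cmod (p \<zeta>))\<^sup>2) \<partial>density sphere_measure (\<lambda>\<zeta>. ennreal (w \<zeta>)))
      = ennreal (\<integral>\<zeta>. (cmod (p \<zeta>))\<^sup>2 * w \<zeta> \<partial>sphere_measure)" if p: "poly_fun m p" for p :: "'n cspace \<Rightarrow> complex" and m
  proof -
    have "(\<lambda>\<zeta>. (cmod (p \<zeta>))\<^sup>2) \<in> borel_measurable sphere_measure"
      by (intro borel_measurable_sphere_cont continuous_intros continuous_on_poly_fun [OF p])
    then have "(\<integral>\<^sup>+\<zeta>. ennreal ((cmod (p \<zeta>))\<^sup>2) \<partial>density sphere_measure (\<lambda>\<zeta>. ennreal (w \<zeta>)))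
        = (\<integral>\<^sup>+\<zeta>. ennreal (w \<zeta>) * ennreal ((cmod (p \<zeta>))\<^sup>2) \<partial>sphere_measure)"
      using w_meas by (subst nn_integral_density) auto
    also have "\<dots> = (\<integral>\<^sup>+\<zeta>. ennreal ((cmod (p \<zeta>))\<^sup>2 * w \<zeta>) \<partial>sphere_measure)"
      using w_nonneg by (intro nn_integral_cong) (simp add: ennreal_mult mult.commute)
    also have "\<dots> = ennreal (\<integral>\<zeta>. (cmod (p \<zeta>))\<^sup>2 * w \<zeta> \<partial>sphere_measure)"
      using g.integrable_poly_weight [OF p] w_nonneg by (intro nn_integral_eq_integral) (auto simp: w)
    finally show ?thesis .
  qed
  have int_mu: "integrable \<mu> (\<lambda>\<zeta>. (cmod (p \<zeta>))\<^sup>2)" if p: "poly_fun m p" for p :: "'n cspace \<Rightarrow> complex" and m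
    by (intro integrable_continuous_on_sphere [OF \<mu>.finite_measure_axioms \<mu>(1)]
        continuous_intros continuous_on_poly_fun [OF p])
  have weight_le: "(\<integral>\<zeta>. (cmod (p \<zeta>))\<^sup>2 * w \<zeta> \<partial>sphere_measure) \<le> (\<integral>\<zeta>. (cmod (p \<zeta>))\<^sup>2 \<partial>\<mu>)"
    if p: "poly_fun m p" for p :: "'n cspace \<Rightarrow> complex" and m
  proof -
    have "ennreal (\<integral>\<zeta>. (cmod (p \<zeta>))\<^sup>2 * w \<zeta> \<partial>sphere_measure)
        \<le> (\<integral>\<^sup>+\<zeta>. ennreal ((cmod (p \<zeta>))\<^sup>2) \<partial>\<mu>)"
      unfolding nn_weight [OF p, symmetric]
      by (rule nn_integral_mono_measure) (use \<mu> in auto)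
    also have "\<dots> = ennreal (\<integral>\<zeta>. (cmod (p \<zeta>))\<^sup>2 \<partial>\<mu>)"
      by (intro nn_integral_eq_integral int_mu [OF p]) simp
    finally show ?thesis by (subst (asm) ennreal_le_iff) simp_all
  qed
  \<comment> \<open>A nonzero polynomial has positive norm for \<open>\<sigma>\<close>, and the weight is bounded below by \<open>(1 / M')\<^sup>2\<close>.\<close>
  interpret \<mu>: definite_sphere_measure \<mu>
  proof
    show "sets \<mu> = sets (sphere_measure :: 'n cspace measure)" by (rule \<mu>(1))
    fix A :: "'n multi_index set" and c :: "'n multi_index \<Rightarrow> complex" and \<alpha>
    assume A: "finite A" "\<alpha> \<in> A" "c \<alpha> \<noteq> 0"
    define p where "p = (\<lambda>\<zeta>. \<Sum>\<alpha>\<in>A. c \<alpha> * monomial \<alpha> \<zeta>)"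
    have p: "poly_fun (\<Sum>\<alpha>\<in>A. mi_abs \<alpha>) p"
      unfolding p_def using A(1) by (intro poly_fun_sum poly_fun_cmult poly_fun_monomial member_le_sum) auto
    have "0 < (cmod (c \<alpha>))\<^sup>2 * monomial_mass \<alpha>"
      using A(3) monomial_mass_pos [of \<alpha>] by simp
    also have "\<dots> \<le> (\<Sum>\<alpha>\<in>A. (cmod (c \<alpha>))\<^sup>2 * monomial_mass \<alpha>)"
      using A by (intro member_le_sum) auto
    also have "\<dots> = sphere_norm2 p" unfolding p_def by (rule sphere_norm2_sum_monomials [OF A(1), symmetric])
    finally have "0 < sphere_norm2 p * (1 / M')\<^sup>2" using g.M'_pos by simp
    also have "\<dots> = (\<integral>\<zeta>. (cmod (p \<zeta>))\<^sup>2 * (1 / M')\<^sup>2 \<partial>sphere_measure)"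
      by (simp add: sphere_norm2_def)
    also have "\<dots> \<le> (\<integral>\<zeta>. (cmod (p \<zeta>))\<^sup>2 * w \<zeta> \<partial>sphere_measure)"
    proof (rule integral_mono_AE)
      show "integrable sphere_measure (\<lambda>\<zeta>. (cmod (p \<zeta>))\<^sup>2 * (1 / M')\<^sup>2)"
        by (intro integrable_sphere_cont continuous_intros continuous_on_poly_fun [OF p])
      show "integrable sphere_measure (\<lambda>\<zeta>. (cmod (p \<zeta>))\<^sup>2 * w \<zeta>)"
        unfolding w by (rule g.integrable_poly_weight [OF p])
      show "AE \<zeta> in sphere_measure. (cmod (p \<zeta>))\<^sup>2 * (1 / M')\<^sup>2 \<le> (cmod (p \<zeta>))\<^sup>2 * w \<zeta>"
        using g.AE_boundary_value_ge
      proof eventually_elim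
        case (elim \<zeta>)
        then show ?case unfolding w using g.M'_pos by (intro mult_left_mono power_mono) auto
      qed
    qed
    also have "\<dots> \<le> (\<integral>\<zeta>. (cmod (p \<zeta>))\<^sup>2 \<partial>\<mu>)" by (rule weight_le [OF p])
    finally show "0 < (\<integral>\<zeta>. (cmod (\<Sum>\<alpha>\<in>A. c \<alpha> * monomial \<alpha> \<zeta>))\<^sup>2 \<partial>\<mu>)" by (simp add: p_def)
  qed
  obtain I :: "nat set" and \<rho> :: "nat \<Rightarrow> real" and a where
    a: "\<forall>k\<in>I. \<rho> k > 0 \<and> a k \<in> sphere 0 1"
      "\<forall>A\<in>sets \<mu>s. emeasure \<mu>s A = (\<Sum>k. if k \<in> I then ennreal (\<rho> k) * indicator A (a k) else 0)"
    and sets_s: "sets \<mu>s = sets (restrict_space borel (sphere 0 1))"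
    using \<mu>s unfolding discrete_sphere_measure_def by (elim exE conjE) (rule that)
  \<comment> \<open>Off the atoms \<open>\<mu>\<close> is the absolutely continuous part, so the integral over \<open>- D\<close> is at most that against the weight.\<close>
  define D where "D = a ` I"
  have D: "countable D" "D \<subseteq> sphere 0 1" using a(1) by (auto simp: D_def)
  have D_sets: "A - D \<in> sets \<mu>" if "A \<in> sets \<mu>" for A
  proof -
    have "D \<in> sets borel" by (rule sets.countable [OF _ D(1)]) simp
    then have "D \<inter> sphere 0 1 \<in> sets \<mu>" unfolding \<mu>(1) by (auto simp: sets_restrict_space)
    then have "D \<in> sets \<mu>" using D(2) by (simp add: Int_absorb2)
    then show ?thesis using that by simp
  qed
  have off_D: "emeasure \<mu> (A - D) \<le> emeasure (density sphere_measure (\<lambda>\<zeta>. ennreal (w \<zeta>))) A" if A: "A \<in> sets \<mu>" for A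
  proof -
    have "A - D \<in> sets \<mu>s" using D_sets [OF A] \<mu>(1) sets_s by simp
    then have "emeasure \<mu>s (A - D) = (\<Sum>k. if k \<in> I then ennreal (\<rho> k) * indicator (A - D) (a k) else 0)"
      using a(2) by blast
    also have "\<dots> = (\<Sum>k. 0)"
      by (intro suminf_cong) (auto simp: D_def indicator_def)
    finally have "emeasure \<mu> (A - D) = emeasure (density sphere_measure (\<lambda>\<zeta>. ennreal (w \<zeta>))) (A - D)"
      using \<mu>(2) [OF D_sets [OF A]] by simp
    also have "\<dots> \<le> emeasure (density sphere_measure (\<lambda>\<zeta>. ennreal (w \<zeta>))) A"
      using A \<mu>(1) by (intro emeasure_mono) auto
    finally show ?thesis .
  qed
  have remove: "(\<integral>\<zeta>. indicator (- D) \<zeta> * (cmod (p \<zeta>))\<^sup>2 \<partial>\<mu>) \<le> (\<integral>\<zeta>. (cmod (p \<zeta>))\<^sup>2 * w \<zeta> \<partial>sphere_measure)"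
    if p: "poly_fun m p" for p :: "'n cspace \<Rightarrow> complex" and m
  proof -
    have ind: "(\<lambda>\<zeta>. indicator (- D) \<zeta> :: real) \<in> borel_measurable \<mu>"
      by (rule borel_measurable_indicator_compl [OF D(1) \<mu>(1)])
    have meas_p: "(\<lambda>\<zeta>. (cmod (p \<zeta>))\<^sup>2) \<in> borel_measurable \<mu>"
      using int_mu [OF p] by (rule borel_measurable_integrable)
    have int: "integrable \<mu> (\<lambda>\<zeta>. indicator (- D) \<zeta> * (cmod (p \<zeta>))\<^sup>2)"
      by (rule Bochner_Integration.integrable_bound [OF int_mu [OF p]])
         (use ind meas_p in \<open>auto simp: indicator_def\<close>)
    have "ennreal (\<integral>\<zeta>. indicator (- D) \<zeta> * (cmod (p \<zeta>))\<^sup>2 \<partial>\<mu>) = (\<integral>\<^sup>+\<zeta>. ennreal (indicator (- D) \<zeta> * (cmod (p \<zeta>))\<^sup>2) \<partial>\<mu>)"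
      by (intro nn_integral_eq_integral [symmetric] int) simp
    also have "\<dots> = (\<integral>\<^sup>+\<zeta>. ennreal (indicator (- D) \<zeta>) * ennreal ((cmod (p \<zeta>))\<^sup>2) \<partial>\<mu>)"
      by (intro nn_integral_cong) (simp add: ennreal_mult)
    also have "\<dots> = (\<integral>\<^sup>+\<zeta>. ennreal ((cmod (p \<zeta>))\<^sup>2) \<partial>density \<mu> (\<lambda>\<zeta>. ennreal (indicator (- D) \<zeta>)))"
      using ind meas_p by (subst nn_integral_density) auto
    also have "\<dots> \<le> (\<integral>\<^sup>+\<zeta>. ennreal ((cmod (p \<zeta>))\<^sup>2) \<partial>density sphere_measure (\<lambda>\<zeta>. ennreal (w \<zeta>)))"
    proof (rule nn_integral_mono_measure)
      show "sets (density \<mu> (\<lambda>\<zeta>. ennreal (indicator (- D) \<zeta>))) = sets (density sphere_measure (\<lambda>\<zeta>. ennreal (w \<zeta>)))"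
        using \<mu>(1) by simp
      fix A assume "A \<in> sets (density \<mu> (\<lambda>\<zeta>. ennreal (indicator (- D) \<zeta>)))"
      then have A: "A \<in> sets \<mu>" by simp
      have "emeasure (density \<mu> (\<lambda>\<zeta>. ennreal (indicator (- D) \<zeta>))) A = (\<integral>\<^sup>+\<zeta>. ennreal (indicator (- D) \<zeta>) * indicator A \<zeta> \<partial>\<mu>)"
        using ind A by (intro emeasure_density) auto
      also have "\<dots> = (\<integral>\<^sup>+\<zeta>. indicator (A - D) \<zeta> \<partial>\<mu>)"
        by (intro nn_integral_cong) (auto simp: indicator_def)
      also have "\<dots> = emeasure \<mu> (A - D)"
        by (rule nn_integral_indicator [OF D_sets [OF A]])
      also have "\<dots> \<le> emeasure (density sphere_measure (\<lambda>\<zeta>. ennreal (w \<zeta>))) A"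
        by (rule off_D [OF A])
      finally show "emeasure (density \<mu> (\<lambda>\<zeta>. ennreal (indicator (- D) \<zeta>))) A
          \<le> emeasure (density sphere_measure (\<lambda>\<zeta>. ennreal (w \<zeta>))) A" .
    qed
    also have "\<dots> = ennreal (\<integral>\<zeta>. (cmod (p \<zeta>))\<^sup>2 * w \<zeta> \<partial>sphere_measure)"
      by (rule nn_weight [OF p])
    finally show ?thesis using w_nonneg by (subst (asm) ennreal_le_iff) simp_all
  qed
  have "(\<lambda>n. \<Prod>k<n. 1 - (cmod (verblunsky \<mu> 0 (shortlex_enum k)))\<^sup>2) \<longlonglongrightarrow> (cmod (g 0))\<^sup>2"
  proof (rule \<mu>.verblunsky_product_limit)
    show "measure \<mu> (space \<mu>) = 1" by (rule \<mu>.prob_space)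
    fix p :: "'n cspace \<Rightarrow> complex" and m assume p: "poly_fun m p" "p 0 = 1"
    have "(cmod (g 0))\<^sup>2 = (cmod (p 0))\<^sup>2 * (cmod (g 0))\<^sup>2" by (simp add: p(2))
    also have "\<dots> \<le> (\<integral>\<zeta>. (cmod (p \<zeta>))\<^sup>2 * w \<zeta> \<partial>sphere_measure)"
      unfolding w by (rule g.szego_lower_bound [OF p(1)])
    also have "\<dots> \<le> \<mu>.N2 p" unfolding \<mu>.N2_def by (rule weight_le [OF p(1)])
    finally show "(cmod (g 0))\<^sup>2 \<le> \<mu>.N2 p" .
  next
    fix L assume L: "\<And>p m. poly_fun m p \<Longrightarrow> L * (cmod (p 0))\<^sup>2 \<le> \<mu>.N2 p"
    show "L \<le> (cmod (g 0))\<^sup>2"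
    proof (rule g.szego_upper_bound)
      fix p :: "'n cspace \<Rightarrow> complex" and m assume p: "poly_fun m p"
      have "L * (cmod (p 0))\<^sup>2 \<le> (\<integral>\<zeta>. indicator (- D) \<zeta> * (cmod (p \<zeta>))\<^sup>2 \<partial>\<mu>)"
        by (rule remove_countably_many_points [OF _ \<mu>(1) _ D p])
           (use L \<mu>.finite_measure_axioms in \<open>auto simp: \<mu>.N2_def\<close>)
      also have "\<dots> \<le> (\<integral>\<zeta>. (cmod (p \<zeta>))\<^sup>2 * (cmod (boundary_value g \<zeta>))\<^sup>2 \<partial>sphere_measure)"
        using remove [OF p] unfolding w .
      finally show "L * (cmod (p 0))\<^sup>2 \<le> (\<integral>\<zeta>. (cmod (p \<zeta>))\<^sup>2 * (cmod (boundary_value g \<zeta>))\<^sup>2 \<partial>sphere_measure)" .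
    qed
  qed
  moreover have "exp (\<integral>\<zeta>. ln (w \<zeta>) \<partial>sphere_measure) = (cmod (g 0))\<^sup>2"
    unfolding w g.integral_ln_weight using g.nonzero [of 0] by simp
  ultimately show ?thesis by (simp add: has_shortlex_prod_def)
qed

end
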